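(* Let $n\geq 2$ and let $\alpha_1,\dots,\alpha_n$ be equipotent infinite ordinals, of common cardinality $\kappa$ (viewed as an initial ordinal). For each $i$ let $\alpha_i=\kappa\cdot q_i+r_i$ with $r_i<\kappa$ be the Euclidean division of $\alpha_i$ by $\kappa$. Then the ordinal \[ \kappa\cdot\bigotimes_{1\leq i\leq n}q_i+\Big|\sum_{1\leq i\leq n}r_i\Big|^+ \] is the least strict upper bound (the least ordinal strictly greater than every element) of the class of lengths $\ell(X,\leq)$ of posets $(X,\leq)$ whose ordering $\leq$ is the intersection of $n$ orderings $\leq_1,\dots,\leq_n$ on $X$ such that each $(X,\leq_i)$ is a WPO of length $\alpha_i$. Moreover, this least strict upper bound is unchanged if each ordering $\leq_i$ is in addition required to be linear (so that $(X,\leq_i)$ is a well order of type $\alpha_i$).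
   Context: Orderings are partial orders, seen as sets of ordered pairs; the intersection of orderings on the same set $X$ is their set-theoretic intersection. A poset is well partially ordered (WPO) if it is well founded and has no infinite antichain; equivalently all its linear extensions are well orders. The length $\ell(\mathbf p)$ of a WPO $\mathbf p$ is the largest ordinal type of a linear extension of $\mathbf p$ (the maximum exists by de Jongh–Parikh); for a well order it is its order type. An intersection of finitely many WPO orderings on a set is again WPO. $\otimes$ denotes the Hessenberg (natural) product of ordinals; $+$ and $\cdot$ are the usual ordinal sum and product, with $\kappa\cdot q$ being the type of $q$ successive copies of $\kappa$. For an ordinal $\rho$, $|\rho|$ denotes its cardinality (as the least ordinal equipotent to it); an ordinal is initial if $|\rho|=\rho$ (all finite ordinals are initial), and $|\rho|^+$ denotes the least initial ordinal greater than $\rho$. *)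

theory Defs
  imports Main "HOL-Library.Equipollence"
begin

unbundle cardinal_syntax

section \<open>Ordinals\<close>

text \<open>
  The ordinals of cardinality at most that of \<^typ>\<open>'a\<close> (more precisely: below the cardinal
  successor of \<^typ>\<open>'a\<close>), realised as the elements of a well order of type \<open>|'a|\<^sup>+\<close>. When
  \<^typ>\<open>'a\<close> is infinite this initial segment of the ordinals is closed under every operation
  defined below, except for the successor cardinal of an ordinal that already has the
  cardinality of \<^typ>\<open>'a\<close>. Infinite ordinals of a given cardinality, and posets with carriers of
  that cardinality, all have copies over one suitable type \<^typ>\<open>'a\<close>, so being polymorphic in
  \<^typ>\<open>'a\<close> is the same as ranging over all ordinals and all posets.
\<close>

typedef 'a ordinal = "Field (cardSuc |UNIV :: 'a set| )"
  using Field_cardSuc_not_empty[OF card_of_Card_order] by blast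

instantiation ordinal :: (type) wellorder
begin

definition less_eq_ordinal :: "'a ordinal \<Rightarrow> 'a ordinal \<Rightarrow> bool" where
  "x \<le> y \<longleftrightarrow> (Rep_ordinal x, Rep_ordinal y) \<in> cardSuc |UNIV :: 'a set|"

definition less_ordinal :: "'a ordinal \<Rightarrow> 'a ordinal \<Rightarrow> bool" where
  "(x :: 'a ordinal) < y \<longleftrightarrow> x \<le> y \<and> x \<noteq> y"

instance
proof
  let ?R = "cardSuc |UNIV :: 'a set|"
  have wo: "Well_order ?R"
    using cardSuc_Card_order[OF card_of_Card_order] by (rule card_order_on_well_order_on)
  then have refl: "(Rep_ordinal x, Rep_ordinal x) \<in> ?R" for x :: "'a ordinal"
    using Rep_ordinal[of x] by (auto simp: order_on_defs refl_on_def)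
  from wo have trans: "trans ?R" and anti: "antisym ?R"
    and total: "total_on (Field ?R) ?R" and wf: "wf (?R - Id)"
    by (auto simp: order_on_defs)
  have le_anti: "x \<le> y \<Longrightarrow> y \<le> x \<Longrightarrow> x = y" for x y :: "'a ordinal"
    using anti unfolding less_eq_ordinal_def by (meson Rep_ordinal_inject antisymD)
  fix x y z :: "'a ordinal"
  show "x \<le> x"
    using refl by (simp add: less_eq_ordinal_def)
  show "x \<le> y \<Longrightarrow> y \<le> x \<Longrightarrow> x = y"
    by (rule le_anti)
  show "x < y \<longleftrightarrow> x \<le> y \<and> \<not> y \<le> x"
    using refl le_anti by (auto simp: less_ordinal_def less_eq_ordinal_def)
  show "x \<le> y \<Longrightarrow> y \<le> z \<Longrightarrow> x \<le> z"
    using trans unfolding less_eq_ordinal_def by (meson transD)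
  show "x \<le> y \<or> y \<le> x"
    using total refl Rep_ordinal unfolding less_eq_ordinal_def total_on_def by metis
  fix P :: "'a ordinal \<Rightarrow> bool" and a
  assume step: "\<And>x. (\<And>y. y < x \<Longrightarrow> P y) \<Longrightarrow> P x"
  have "wf (inv_image (?R - Id) Rep_ordinal)"
    using wf by (rule wf_inv_image)
  then show "P a"
  proof (induction a rule: wf_induct_rule)
    case (less x)
    show ?case
    proof (rule step)
      fix y assume "y < x"
      then show "P y"
        using less by (auto simp: less_ordinal_def less_eq_ordinal_def Rep_ordinal_inject)
    qed
  qed
qed

end

text \<open>An ordinal, viewed as the well-ordered set of all smaller ordinals.\<close>

definition segment :: "'a ordinal \<Rightarrow> 'a ordinal rel" where
  "segment a = {(x, y). x \<le> y \<and> y < a}"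

text \<open>
  The order type is only meaningful for well orders whose type lies in \<^typ>\<open>'a ordinal\<close>;
  for infinite \<^typ>\<open>'a\<close> this includes all well orders of subsets of \<^typ>\<open>'a\<close>.
\<close>

definition otype :: "'b rel \<Rightarrow> 'a ordinal" where
  "otype s = (THE a. s =o segment a)"

instantiation ordinal :: (type) "{zero, one, plus, times}"
begin

definition zero_ordinal :: "'a ordinal" where
  "0 = (LEAST a :: 'a ordinal. True)"

definition one_ordinal :: "'a ordinal" where
  "1 = (LEAST a :: 'a ordinal. 0 < a)"

definition plus_ordinal :: "'a ordinal \<Rightarrow> 'a ordinal \<Rightarrow> 'a ordinal" where
  "(a :: 'a ordinal) + b = otype
    ({(Inl x, Inl y) | x y. (x, y) \<in> segment a} \<union>
     {(Inr x, Inr y) | x y. (x, y) \<in> segment b} \<union>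
     {(Inl x, Inr y) | x y. x < a \<and> y < b})"

text \<open>\<open>a * b\<close> is the type of \<open>b\<close> successive copies of \<open>a\<close>; the first components index the copies.\<close>

definition times_ordinal :: "'a ordinal \<Rightarrow> 'a ordinal \<Rightarrow> 'a ordinal" where
  "(a :: 'a ordinal) * b = otype
    {((i, x), (j, y)) | i x j y. i < b \<and> j < b \<and> x < a \<and> y < a \<and> (i < j \<or> i = j \<and> x \<le> y)}"

instance ..

end

definition ord_omega :: "'a ordinal" where
  "ord_omega = (LEAST a. infinite {..<a})"

text \<open>
  The power \<open>\<omega>\<^sup>a\<close>; the single clause gives \<open>\<omega>\<^sup>0 = 1\<close>, \<open>\<omega>\<^bsup>a+1\<^esup> = \<omega>\<^sup>a \<cdot> \<omega>\<close>, and the supremum of the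
  previous powers at limits.
\<close>

function omega_pow :: "'a ordinal \<Rightarrow> 'a ordinal" where
  "omega_pow a = (LEAST c. 0 < c \<and> (\<forall>b<a. omega_pow b * ord_omega \<le> c))"
  by auto
termination
  by (relation "{(x, y). x < y}") (auto simp: wf)

declare omega_pow.simps [simp del]

subsection \<open>Hessenberg product via Cantor normal forms\<close>

text \<open>
  \<open>\<omega>\<^bsup>e\<^sub>1\<^esup> + \<dots> + \<omega>\<^bsup>e\<^sub>k\<^esup>\<close>. A Cantor normal form is given by its non-increasing list of exponents, each
  repeated according to its coefficient.
\<close>

definition omega_sum :: "'a ordinal list \<Rightarrow> 'a ordinal" where
  "omega_sum es = foldr (\<lambda>e s. omega_pow e + s) es 0"

definition cnf :: "'a ordinal \<Rightarrow> 'a ordinal list" where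
  "cnf a = (THE es. sorted (rev es) \<and> omega_sum es = a)"

definition hsum :: "'a ordinal \<Rightarrow> 'a ordinal \<Rightarrow> 'a ordinal" where
  "hsum a b = omega_sum (rev (sort (cnf a @ cnf b)))"

text \<open>Cantor normal forms are multiplied like polynomials in \<open>\<omega>\<close>, exponents being added by \<^const>\<open>hsum\<close>.\<close>

definition hprod :: "'a ordinal \<Rightarrow> 'a ordinal \<Rightarrow> 'a ordinal" where
  "hprod a b = omega_sum (rev (sort [hsum d e. d \<leftarrow> cnf a, e \<leftarrow> cnf b]))"

definition ord_sum_upto :: "nat \<Rightarrow> (nat \<Rightarrow> 'a ordinal) \<Rightarrow> 'a ordinal" where
  "ord_sum_upto n f = foldr (\<lambda>i s. f i + s) [1..<Suc n] 0"

definition hprod_upto :: "nat \<Rightarrow> (nat \<Rightarrow> 'a ordinal) \<Rightarrow> 'a ordinal" where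
  "hprod_upto n f = foldr (\<lambda>i s. hprod (f i) s) [1..<Suc n] 1"

subsection \<open>Cardinality\<close>

definition ord_card :: "'a ordinal \<Rightarrow> 'a ordinal" where
  "ord_card a = (LEAST b. {..<b} \<approx> {..<a})"

definition initial_ord :: "'a ordinal \<Rightarrow> bool" where
  "initial_ord a \<longleftrightarrow> ord_card a = a"

text \<open>The least initial ordinal \<open>|a|\<^sup>+\<close> greater than \<open>a\<close>; it is \<open>a + 1\<close> for finite \<open>a\<close>.\<close>

definition next_initial :: "'a ordinal \<Rightarrow> 'a ordinal" where
  "next_initial a = (LEAST b. initial_ord b \<and> a < b)"

definition least_strict_upper_bound :: "'a ordinal set \<Rightarrow> 'a ordinal \<Rightarrow> bool" where
  "least_strict_upper_bound C u \<longleftrightarrow>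
    (\<forall>c\<in>C. c < u) \<and> (\<forall>v. (\<forall>c\<in>C. c < v) \<longrightarrow> u \<le> v)"

section \<open>Well partial orders and their lengths\<close>

definition wpo_on :: "'b set \<Rightarrow> 'b rel \<Rightarrow> bool" where
  "wpo_on X r \<longleftrightarrow> partial_order_on X r \<and> wf (r - Id) \<and>
    (\<forall>A\<subseteq>X. (\<forall>x\<in>A. \<forall>y\<in>A. (x, y) \<in> r \<longrightarrow> x = y) \<longrightarrow> finite A)"

text \<open>
  All linear extensions of a WPO are well orders, so requiring this of \<open>s\<close> excludes none.
  Carriers are taken inside the type indexing the ordinals, so that \<^const>\<open>otype\<close> is meaningful.
\<close>

definition wpo_length :: "'a set \<Rightarrow> 'a rel \<Rightarrow> 'a ordinal" where
  "wpo_length X r = (GREATEST a. \<exists>s. well_order_on X s \<and> r \<subseteq> s \<and> a = otype s)"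

end

(*
Upper bound. The length of a well partial order X is also the rank of its tree of bad sequences, i.e.
the least ordinal above the lengths of all residuals {y. not x <= y}. In this form it is monotone and
subadditive for the Hessenberg sum; that it is attained by a linear extension is the theorem of
de Jongh and Parikh. Each order splits into an initial segment of length at most kappa * q_i and a rest
of at most |r_i| elements. All rests together have at most |r_1 + ... + r_n| elements, hence contribute
less than |r_1 + ... + r_n|^+. On the common part of the initial segments the bound
kappa * (q_1 (x) q_2) for two orders is proved by induction: a q_i that is not a power of omega is split
off; if both are powers of omega, a residual of the intersection is the union of two residuals, each of
which has, up to fewer than kappa elements, length at most kappa * d with a smaller d in one of the orders.

Lower bound. The product order on q_1 x ... x q_n has a linear extension of type at least
q_1 (x) ... (x) q_n. Every point is replaced by a block of kappa elements, which produces n well orders of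
types kappa * q_i. Then r_i further points are put on top of the i-th order and at the bottom of all the
others, where they are absorbed. As n >= 2, their arrangement at the bottom is free, so in a linear
extension of the intersection they can form any ordinal of cardinality |r_1 + ... + r_n| on top.
*)
theory Submission
  imports Defs "HOL-Library.Multiset_Order" "HOL-Library.Product_Lexorder" "HOL-Library.Ramsey"
begin

section \<open>Ranks of well orders\<close>

text \<open>The length is used in two guises. As a rank it is monotone and subadditive; as the type
  of a linear extension it has the cardinality of the set, and extensions can be cut and stacked.
  Single arguments mix both guises: stacked extensions justify cutting an order of length
  \<open>a + b\<close> into parts of lengths at most \<open>a\<close> and \<open>b\<close>, and
  ranks estimate the parts.

  The role of \<kappa>: an infinite initial ordinal is closed under addition, hence of the form
  \<open>omega_pow m\<close>. Left multiplication by it shifts exponents by \<open>m\<close>, so it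
  commutes with the Hessenberg sum, and \<kappa> times a power of omega is again closed under
  Hessenberg sums: two parts shorter than it never reach it together. Exponents of a rest lie below
  \<open>m\<close>, those of a multiple of \<kappa> do not, so there the Hessenberg sum is the
  ordinary sum. A rest is controlled only through its number of elements, which leaves every ordinal
  of that cardinality possible; hence the successor cardinal.

  All ordinals live in one type, so a new ordinal needs a cardinality bound (\<open>small\<close>)
  before it exists.\<close>

locale infinite_type =
  fixes T :: "'a itself"
  assumes infinite_UNIV_type: "infinite (UNIV :: 'a set)"

lemma strict_mono_on_ordinal_ge:
  fixes f :: "'a ordinal \<Rightarrow> 'a ordinal"
  assumes mono: "\<And>x y. x < y \<Longrightarrow> y < a \<Longrightarrow> f x < f y" and "x < a"
  shows "x \<le> f x"
  using \<open>x < a\<close>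
proof (induction x rule: less_induct)
  case (less x)
  show ?case
  proof (rule ccontr)
    assume "\<not> x \<le> f x"
    then have lt: "f x < x" by simp
    then have "f x \<le> f (f x)" using less by auto
    moreover have "f (f x) < f x" using mono lt less.prems by auto
    ultimately show False by simp
  qed
qed

text \<open>An order embedding of \<open>{..<a}\<close> never moves a point down, so with
  \<open>b < a\<close> the image of \<open>b\<close> could not stay below \<open>b\<close>. Order
  types are compared through this.\<close>

lemma strict_mono_on_ordinal_le:
  fixes f :: "'a ordinal \<Rightarrow> 'a ordinal"
  assumes mono: "\<And>x y. x < y \<Longrightarrow> y < a \<Longrightarrow> f x < f y" and into: "\<And>x. x < a \<Longrightarrow> f x < b"
  shows "a \<le> b"
proof (rule ccontr)
  assume "\<not> a \<le> b"
  then have "b < a" by simp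
  then have "b \<le> f b" "f b < b" using strict_mono_on_ordinal_ge[of a f b] mono into by auto
  then show False by simp
qed

lemma cardSuc_facts:
  "Card_order (cardSuc |UNIV :: 'a set| )" "Well_order (cardSuc |UNIV :: 'a set| )"
  using cardSuc_Card_order[OF card_of_Card_order] by (auto simp: card_order_on_def)

lemma image_Rep_lessThan:
  "Rep_ordinal ` {..<a :: 'a ordinal} = underS (cardSuc |UNIV :: 'a set| ) (Rep_ordinal a)"
proof -
  have "y \<in> Rep_ordinal ` {..<a}" if "y \<noteq> Rep_ordinal a" "(y, Rep_ordinal a) \<in> cardSuc |UNIV :: 'a set|" for y
  proof -
    have "y \<in> Field (cardSuc |UNIV :: 'a set| )" using that by (auto simp: Field_def)
    then have y: "y = Rep_ordinal (Abs_ordinal y)" by (simp add: Abs_ordinal_inverse)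
    then have "Abs_ordinal y < a" using that by (auto simp: less_ordinal_def less_eq_ordinal_def)
    then show ?thesis using y by blast
  qed
  then show ?thesis
    by (auto simp: underS_def less_ordinal_def less_eq_ordinal_def Rep_ordinal_inject)
qed

text \<open>Proper initial segments of a cardinal are smaller than it, and what is smaller than the
  cardinal successor is at most \<open>UNIV\<close>.\<close>

lemma card_lessThan_ordinal: "|{..<a :: 'a ordinal}| \<le>o |UNIV :: 'a set|"
proof -
  let ?r = "cardSuc |UNIV :: 'a set|"
  have "|underS ?r (Rep_ordinal a)| <o ?r"
    using card_of_underS[OF cardSuc_facts(1) Rep_ordinal] .
  then have "|underS ?r (Rep_ordinal a)| \<le>o |UNIV :: 'a set|"
    using cardSuc_ordLess_ordLeq[OF card_of_Card_order card_of_Card_order]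
      cardSuc_ordLeq_ordLess[OF card_of_Card_order card_of_Card_order] by blast
  moreover have "|{..<a}| =o |underS ?r (Rep_ordinal a)|"
    unfolding image_Rep_lessThan[symmetric]
    by (rule card_of_ordIsoI[of Rep_ordinal]) (auto simp: bij_betw_def inj_on_def Rep_ordinal_inject)
  ultimately show ?thesis using ordIso_ordLeq_trans by blast
qed

text \<open>A well order at least as long as the successor cardinal would have too many elements. So
  \<open>r\<close> is isomorphic to a proper initial segment of it, that is, to the ordinals below
  some \<open>a\<close>.\<close>

lemma ex_rank:
  fixes r :: "'b rel"
  assumes wo: "Well_order r" and small: "|Field r| \<le>o |UNIV :: 'a set|"
  obtains a :: "'a ordinal" and f where "bij_betw f (Field r) {..<a}"
    "\<And>x y. x \<in> Field r \<Longrightarrow> y \<in> Field r \<Longrightarrow> (x, y) \<in> r \<longleftrightarrow> f x \<le> f y"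
proof -
  let ?c = "cardSuc |UNIV :: 'a set|"
  have "r <o ?c"
  proof (rule ccontr)
    assume "\<not> r <o ?c"
    then have "?c \<le>o r" using not_ordLess_iff_ordLeq[OF cardSuc_facts(2)[where 'a='a] wo] by simp
    then have "|Field ?c| \<le>o |Field r|" by (rule card_of_mono2)
    then have "|Field ?c| \<le>o |UNIV :: 'a set|" using small by (rule ordLeq_transitive)
    then have "?c \<le>o |UNIV :: 'a set|"
      by (rule ordIso_ordLeq_trans[OF ordIso_symmetric[OF card_of_Field_ordIso[OF cardSuc_facts(1)]]])
    moreover have "|UNIV :: 'a set| <o ?c" by (rule cardSuc_greater[OF card_of_Card_order])
    ultimately show False using not_ordLess_ordLeq by blast
  qed
  then obtain p where p: "p \<in> Field ?c" "r =o Restr ?c (underS ?c p)"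
    using ordLess_iff_ordIso_Restr[OF cardSuc_facts(2) wo] by blast
  define a where "a = (Abs_ordinal p :: 'a ordinal)"
  have pa: "p = Rep_ordinal a" using p(1) by (simp add: a_def Abs_ordinal_inverse)
  have fld: "Field (Restr ?c (underS ?c p)) = underS ?c p"
  proof (rule Refl_Field_Restr2)
    show "Refl ?c" using cardSuc_facts(2)[where 'a='a] by (simp add: order_on_defs)
    show "underS ?c p \<subseteq> Field ?c" by (auto simp: underS_def Field_def)
  qed
  obtain g where g: "iso r (Restr ?c (underS ?c p)) g"
    using p(2) by (auto simp: ordIso_def)
  have g1: "bij_betw g (Field r) (underS ?c p)" "\<And>x y. x \<in> Field r \<Longrightarrow> y \<in> Field r \<Longrightarrow> (x, y) \<in> r \<longleftrightarrow> (g x, g y) \<in> Restr ?c (underS ?c p)"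
    using g fld unfolding iso_iff2 by auto
  have in_fld: "g x \<in> underS ?c p" if "x \<in> Field r" for x using g1(1) that by (auto simp: bij_betw_def)
  have in_fld2: "g x \<in> Field ?c" if "x \<in> Field r" for x using in_fld[OF that] by (auto simp: underS_def Field_def)
  show ?thesis
  proof
    have "bij_betw Abs_ordinal (underS ?c p) {..<a}"
      unfolding pa image_Rep_lessThan[symmetric]
      by (rule bij_betwI[of _ _ _ Rep_ordinal]) (auto simp: Rep_ordinal_inverse)
    then show "bij_betw (Abs_ordinal \<circ> g) (Field r) {..<a}"
      using g1(1) bij_betw_trans by blast
    show "(x, y) \<in> r \<longleftrightarrow> (Abs_ordinal \<circ> g) x \<le> (Abs_ordinal \<circ> g) y" if "x \<in> Field r" "y \<in> Field r" for x y
      using g1(2)[OF that] in_fld that in_fld2 by (simp add: less_eq_ordinal_def Abs_ordinal_inverse)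
  qed
qed

lemma Well_order_inj_on:
  fixes f :: "'b \<Rightarrow> 'c :: wellorder"
  assumes "inj_on f X" and r: "r = {(x, y). x \<in> X \<and> y \<in> X \<and> f x \<le> f y}"
  shows "Well_order r" "Field r = X" "well_order_on X r"
proof -
  show F: "Field r = X" unfolding r Field_def by auto
  have "wf (inv_image {(x, y). x < y} f)" by (intro wf_inv_image wf)
  moreover have "r - Id \<subseteq> inv_image {(x, y). x < y} f"
  proof
    fix p assume "p \<in> r - Id"
    then obtain x y where p: "p = (x, y)" "x \<in> X" "y \<in> X" "f x \<le> f y" "x \<noteq> y" unfolding r by auto
    then have "f x \<noteq> f y" using assms(1) by (simp add: inj_on_eq_iff)
    then show "p \<in> inv_image {(x, y). x < y} f" using p by simp
  qed
  ultimately have "wf (r - Id)" by (rule wf_subset)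
  moreover have "refl_on X r" "r \<subseteq> X \<times> X" "trans r" "total_on X r"
    unfolding r refl_on_def trans_def total_on_def by auto
  moreover have "antisym r"
    using assms(1) unfolding r antisym_def inj_on_def by auto
  ultimately show "well_order_on X r"
    by (simp add: order_on_defs)
  then show "Well_order r" using F by simp
qed

lemma segment_Well_order: "Well_order (segment a)" "Field (segment a) = {..<a}"
proof -
  have s: "segment a = {(x, y). x \<in> {..<a} \<and> y \<in> {..<a} \<and> id x \<le> id y}"
    by (auto simp: segment_def)
  show "Well_order (segment a)" "Field (segment a) = {..<a}"
    using Well_order_inj_on[OF _ s] by auto
qed

lemma ordIso_segment_iff:
  fixes r :: "'b rel" and a :: "'a ordinal"
  assumes "Well_order r"
  shows "r =o segment a \<longleftrightarrow> (\<exists>f. bij_betw f (Field r) {..<a} \<and>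
    (\<forall>x\<in>Field r. \<forall>y\<in>Field r. (x, y) \<in> r \<longleftrightarrow> f x \<le> f y))"
proof -
  have "iso r (segment a) f \<longleftrightarrow> bij_betw f (Field r) {..<a} \<and>
    (\<forall>x\<in>Field r. \<forall>y\<in>Field r. (x, y) \<in> r \<longleftrightarrow> f x \<le> f y)" for f
    unfolding iso_iff2 segment_Well_order(2)
    by (rule conj_cong[OF refl]) (auto simp: segment_def bij_betw_def)
  then show ?thesis using assms segment_Well_order(1)[of a] by (auto simp: ordIso_def)
qed

text \<open>\<open>g\<close> after the inverse of \<open>f\<close> is an order embedding. One
  inequality is enough, since equality follows by exchanging the two rankings.\<close>

lemma bij_betw_lessThan_unique:
  fixes a b :: "'a ordinal"
  assumes "bij_betw f X {..<a}" "bij_betw g X {..<b}"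
    and iff: "\<And>x y. x \<in> X \<Longrightarrow> y \<in> X \<Longrightarrow> f x \<le> f y \<longleftrightarrow> g x \<le> g y"
  shows "a \<le> b"
proof (rule strict_mono_on_ordinal_le[of a "g \<circ> inv_into X f"])
  have inv: "inv_into X f x \<in> X" "f (inv_into X f x) = x" if "x < a" for x
    using assms(1) that by (auto simp: bij_betw_def inv_into_into f_inv_into_f)
  show "(g \<circ> inv_into X f) x < (g \<circ> inv_into X f) y" if "x < y" "y < a" for x y
    using inv[of x] inv[of y] that iff[of "inv_into X f y" "inv_into X f x"]
    by (auto simp: not_le[symmetric])
  show "(g \<circ> inv_into X f) x < b" if "x < a" for x
    using inv[of x] that assms(2) by (auto simp: bij_betw_def)
qed

lemma otype_eqI:
  fixes r :: "'b rel" and a :: "'a ordinal"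
  assumes f: "bij_betw f (Field r) {..<a}"
    and iff: "\<And>x y. x \<in> Field r \<Longrightarrow> y \<in> Field r \<Longrightarrow> (x, y) \<in> r \<longleftrightarrow> f x \<le> f y"
  shows "otype r = a"
proof -
  have r: "r = {(x, y). x \<in> Field r \<and> y \<in> Field r \<and> f x \<le> f y}"
    using iff by (auto simp: Field_def)
  have wo: "Well_order r"
    by (rule Well_order_inj_on[OF _ r]) (use f in \<open>simp add: bij_betw_def\<close>)
  show ?thesis unfolding otype_def
  proof (rule the_equality)
    show "r =o segment a" using ordIso_segment_iff[OF wo] f iff by blast
    fix b :: "'a ordinal" assume "r =o segment b"
    then obtain g where "bij_betw g (Field r) {..<b}" "\<forall>x\<in>Field r. \<forall>y\<in>Field r. (x, y) \<in> r \<longleftrightarrow> g x \<le> g y"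
      using ordIso_segment_iff[OF wo] by blast
    then show "b = a"
      using f iff bij_betw_lessThan_unique[of f "Field r" a g b] bij_betw_lessThan_unique[of g "Field r" b f a]
      by (auto intro: antisym)
  qed
qed

lemma otype_rank:
  fixes r :: "'b rel"
  assumes "Well_order r" and "|Field r| \<le>o |UNIV :: 'a set|"
  obtains f where "bij_betw f (Field r) {..<otype r :: 'a ordinal}"
    "\<And>x y. x \<in> Field r \<Longrightarrow> y \<in> Field r \<Longrightarrow> (x, y) \<in> r \<longleftrightarrow> f x \<le> f y"
  using ex_rank[OF assms] otype_eqI by metis

text \<open>The usual source of new ordinals: points are sorted by an arbitrary key, and the key is
  then replaced by its rank.\<close>

lemma collapse:
  fixes f :: "'b \<Rightarrow> 'c :: wellorder"
  assumes "inj_on f X" and "|X| \<le>o |UNIV :: 'a set|"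
  obtains t :: "'a ordinal" and g where "bij_betw g X {..<t}"
    "\<And>x y. x \<in> X \<Longrightarrow> y \<in> X \<Longrightarrow> g x \<le> g y \<longleftrightarrow> f x \<le> f y"
proof -
  define r where "r = {(x, y). x \<in> X \<and> y \<in> X \<and> f x \<le> f y}"
  note w = Well_order_inj_on[OF assms(1) r_def]
  obtain a :: "'a ordinal" and g where "bij_betw g (Field r) {..<a}"
    "\<And>x y. x \<in> Field r \<Longrightarrow> y \<in> Field r \<Longrightarrow> (x, y) \<in> r \<longleftrightarrow> g x \<le> g y"
    using ex_rank[OF w(1)] assms(2) w(2) by metis
  then show thesis using that[of g a] w(2) by (auto simp: r_def)
qed

text \<open>The bound under which a well order has its type in \<open>'a ordinal\<close>. The first
  argument only names \<open>'a\<close>, which does not occur in the type of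
  \<open>A\<close>.\<close>

abbreviation small :: "'a itself \<Rightarrow> 'b set \<Rightarrow> bool"
  where "small T A \<equiv> |A| \<le>o |UNIV :: 'a set|"

section \<open>Closure properties of small sets\<close>

context infinite_type
begin

lemma small_Plus:
  "small T A \<Longrightarrow> small T B \<Longrightarrow> small T (A <+> B)"
  using card_of_Plus_ordLeq_infinite_Field[of "|UNIV :: 'a set|" A B] infinite_UNIV_type
  by (simp add: Field_card_of card_of_card_order_on)

lemma small_Times:
  "small T A \<Longrightarrow> small T B \<Longrightarrow> small T (A \<times> B)"
  using card_of_Times_ordLeq_infinite_Field[of "|UNIV :: 'a set|" A B] infinite_UNIV_type
  by (simp add: Field_card_of card_of_card_order_on)

lemma small_UN:
  "small T A \<Longrightarrow> (\<And>x. x \<in> A \<Longrightarrow> small T (B x)) \<Longrightarrow> small T (\<Union>x\<in>A. B x)"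
  using card_of_UNION_ordLeq_infinite[OF infinite_UNIV_type] by blast

lemma small_subset: "A \<subseteq> B \<Longrightarrow> small T B \<Longrightarrow> small T A"
  using card_of_mono1 ordLeq_transitive by blast

lemma small_image: "small T A \<Longrightarrow> small T (f ` A)"
  using card_of_image ordLeq_transitive by blast

lemma small_finite: "finite A \<Longrightarrow> small T A"
  using finite_ordLess_infinite[OF card_of_Well_order card_of_Well_order, of A "UNIV :: 'a set"]
  by (simp add: Field_card_of infinite_UNIV_type ordLess_imp_ordLeq)

lemma not_small_ordinals: "\<not> |UNIV :: 'a ordinal set| \<le>o |UNIV :: 'a set|"
proof -
  let ?c = "cardSuc |UNIV :: 'a set|"
  have "|UNIV :: 'a ordinal set| =o |Field ?c|"
    by (rule card_of_ordIsoI[of Rep_ordinal])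
      (simp add: bij_betw_def inj_on_def Rep_ordinal_inject type_definition.Rep_range[OF type_definition_ordinal])
  then have "|UNIV :: 'a ordinal set| =o ?c"
    using card_of_Field_ordIso[OF cardSuc_facts(1)] ordIso_transitive by blast
  moreover have "|UNIV :: 'a set| <o ?c" by (rule cardSuc_greater[OF card_of_Card_order])
  ultimately show ?thesis
    by (meson not_ordLess_ordLeq ordIso_symmetric ordIso_ordLeq_trans)
qed

text \<open>Regularity of the successor cardinal: a union of at most \<open>UNIV\<close> many
  initial segments is still small and cannot exhaust the type. It provides the bounds that make the
  \<open>LEAST\<close> in \<open>omega_pow\<close> and \<open>ol\<close> meaningful.\<close>

lemma small_bounded:
  fixes A :: "'a ordinal set"
  assumes "small T A"
  obtains b where "\<And>a. a \<in> A \<Longrightarrow> a < b"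
proof -
  have "{..a} = insert a {..<a}" for a :: "'a ordinal" by auto
  then have "small T {..a}" for a :: "'a ordinal"
    using small_UN[of "{True, False}" "\<lambda>b. if b then {a} else {..<a}"] small_finite[of "{True,False}"]
      small_finite[of "{a}"] card_lessThan_ordinal[of a] by auto
  then have "small T (\<Union>a\<in>A. {..a})" using assms by (intro small_UN) auto
  then obtain b where "b \<notin> (\<Union>a\<in>A. {..a})" using not_small_ordinals by (metis UNIV_eq_I)
  then show thesis using that[of b] by (auto simp: not_le)
qed

end

section \<open>Sums and products\<close>

lemma ordinal_eqI: "(\<And>z. z < a \<longleftrightarrow> z < b) \<Longrightarrow> a = b" for a b :: "'a :: linorder"
  by (metis less_irrefl linorder_neqE)

lemma ordinal_leI: "(\<And>z. z < a \<Longrightarrow> z < b) \<Longrightarrow> a \<le> b" for a b :: "'a :: linorder"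
  by (meson less_irrefl not_le)

lemma ordinal_zero_le [simp]: "0 \<le> (x :: 'a ordinal)"
  unfolding zero_ordinal_def by (rule Least_le) simp

lemma ordinal_not_less_zero [simp]: "\<not> (x :: 'a ordinal) < 0"
  by (simp add: not_less)

lemma ordinal_le_zero [simp]: "x \<le> 0 \<longleftrightarrow> (x :: 'a ordinal) = 0"
  by (simp add: order.antisym iffI)

lemma ordinal_pos_iff: "0 < x \<longleftrightarrow> (x :: 'a ordinal) \<noteq> 0"
  by (metis ordinal_zero_le order.not_eq_order_implies_strict less_irrefl)

lemma lessThan_ordinal_zero [simp]: "{..<0 :: 'a ordinal} = {}"
  by auto

lemma Inl_in_Plus [simp]: "Inl x \<in> A <+> B \<longleftrightarrow> x \<in> A"
  by auto

lemma Inr_in_Plus [simp]: "Inr x \<in> A <+> B \<longleftrightarrow> x \<in> B"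
  by auto

text \<open>In any ranking the rank of \<open>x\<close> is the order type of the points before
  \<open>x\<close>, and both \<open>f\<close> and \<open>g\<close> rank those.\<close>

lemma rank_eqI:
  fixes t c :: "'a ordinal" and k :: "'b \<Rightarrow> 'c :: wellorder"
  assumes f: "bij_betw f X {..<t}" "\<And>x y. x \<in> X \<Longrightarrow> y \<in> X \<Longrightarrow> f x \<le> f y \<longleftrightarrow> k x \<le> k y"
    and x: "x \<in> X"
    and g: "bij_betw g {y \<in> X. k y < k x} {..<c}"
      "\<And>y z. y \<in> X \<Longrightarrow> z \<in> X \<Longrightarrow> k y < k x \<Longrightarrow> k z < k x \<Longrightarrow> g y \<le> g z \<longleftrightarrow> k y \<le> k z"
  shows "f x = c"
proof -
  have lt: "k y < k x \<longleftrightarrow> f y < f x" if "y \<in> X" for y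
    using f(2)[OF x that] by (simp add: not_le[symmetric])
  have fx: "f x < t" using f(1) x by (auto simp: bij_betw_def)
  have "f ` {y \<in> X. k y < k x} = {..<f x}"
  proof (intro equalityI subsetI)
    fix z assume "z \<in> {..<f x}"
    then have "z < t" using fx by auto
    then obtain y where "y \<in> X" "z = f y" using f(1) by (auto simp: bij_betw_def)
    then show "z \<in> f ` {y \<in> X. k y < k x}" using \<open>z \<in> {..<f x}\<close> lt by auto
  qed (use lt in auto)
  moreover have "inj_on f {y \<in> X. k y < k x}"
    using f(1) by (auto simp: bij_betw_def intro: inj_on_subset)
  ultimately have b: "bij_betw f {y \<in> X. k y < k x} {..<f x}" by (simp add: bij_betw_def)
  have "f x \<le> c" by (rule bij_betw_lessThan_unique[OF b g(1)]) (use f(2) g(2) in auto)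
  moreover have "c \<le> f x" by (rule bij_betw_lessThan_unique[OF g(1) b]) (use f(2) g(2) in auto)
  ultimately show ?thesis by simp
qed

context infinite_type
begin

lemma ex_greater_ordinal: "\<exists>b :: 'a ordinal. a < b"
  using small_bounded[OF small_finite[of "{a}"]] by auto

text \<open>The tags 0 and 1 put the left summand before the right one in the lexicographic
  order.\<close>

definition sum_key :: "'a ordinal + 'a ordinal \<Rightarrow> nat \<times> 'a ordinal"
  where "sum_key = case_sum (\<lambda>x. (0, x)) (\<lambda>y. (1, y))"

text \<open>The \<open>otype\<close> in the definition of addition has an explicit ranking: the
  points before \<open>Inr y\<close> form the ordered sum of \<open>a\<close> and \<open>y\<close>,
  so the rank of \<open>Inr y\<close> is \<open>a + y\<close>.\<close>

lemma plus_rank: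
  fixes a b :: "'a ordinal"
  shows "bij_betw (case_sum (\<lambda>x. x) ((+) a)) ({..<a} <+> {..<b}) {..<a + b}"
    "u \<in> {..<a} <+> {..<b} \<Longrightarrow> v \<in> {..<a} <+> {..<b} \<Longrightarrow>
      case_sum (\<lambda>x. x) ((+) a) u \<le> case_sum (\<lambda>x. x) ((+) a) v \<longleftrightarrow> sum_key u \<le> sum_key v"
proof -
  define F where "F b = {..<a} <+> {..<b}" for b :: "'a ordinal"
  have ex: "\<exists>f. bij_betw f (F b) {..<a + b} \<and> (\<forall>u\<in>F b. \<forall>v\<in>F b. f u \<le> f v \<longleftrightarrow> sum_key u \<le> sum_key v)" for b
  proof -
    let ?r = "{(Inl x, Inl y) | x y. (x, y) \<in> segment a} \<union>
     {(Inr x, Inr y) | x y. (x, y) \<in> segment b} \<union>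
     {(Inl x, Inr y) | x y. x < a \<and> y < b}"
    have r: "?r = {(u, v). u \<in> F b \<and> v \<in> F b \<and> sum_key u \<le> sum_key v}"
    proof (rule set_eqI)
      fix p :: "('a ordinal + 'a ordinal) \<times> ('a ordinal + 'a ordinal)"
      obtain u v where "p = (u, v)" by (cases p)
      then show "p \<in> ?r \<longleftrightarrow> p \<in> {(u, v). u \<in> F b \<and> v \<in> F b \<and> sum_key u \<le> sum_key v}"
        by (cases u; cases v) (auto simp: F_def sum_key_def segment_def)
    qed
    have "inj_on sum_key (F b)" by (auto simp: inj_on_def F_def sum_key_def)
    note wo = Well_order_inj_on[OF this r]
    have "small T (Field ?r)"
      unfolding wo(2) unfolding F_def by (intro small_Plus card_lessThan_ordinal)
    then obtain f where f: "bij_betw f (Field ?r) {..<otype ?r :: 'a ordinal}"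
      "\<And>x y. x \<in> Field ?r \<Longrightarrow> y \<in> Field ?r \<Longrightarrow> (x, y) \<in> ?r \<longleftrightarrow> f x \<le> f y"
      using otype_rank[OF wo(1)] by blast
    have "otype ?r = a + b" by (simp add: plus_ordinal_def)
    moreover have "f u \<le> f v \<longleftrightarrow> sum_key u \<le> sum_key v" if "u \<in> F b" "v \<in> F b" for u v
      using f(2)[of u v] that unfolding wo(2) unfolding r by blast
    ultimately show ?thesis using f(1) unfolding wo(2) by auto
  qed
  obtain f where f: "bij_betw f (F b) {..<a + b}" "\<And>u v. u\<in>F b \<Longrightarrow> v\<in>F b \<Longrightarrow> f u \<le> f v \<longleftrightarrow> sum_key u \<le> sum_key v"
    using ex[of b] by blast
  have inl: "f (Inl x) = x" if "x < a" for x
  proof (rule rank_eqI[OF f])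
    show "Inl x \<in> F b" using that by (simp add: F_def)
    have "{y \<in> F b. sum_key y < sum_key (Inl x)} = Inl ` {..<x}"
      using that by (auto simp: F_def sum_key_def)
    then show "bij_betw projl {y \<in> F b. sum_key y < sum_key (Inl x)} {..<x}"
      by (simp add: bij_betw_def inj_on_def image_image)
  qed (auto simp: F_def sum_key_def)
  have inr: "f (Inr y) = a + y" if "y < b" for y
  proof -
    obtain g where g: "bij_betw g (F y) {..<a + y}" "\<And>u v. u\<in>F y \<Longrightarrow> v\<in>F y \<Longrightarrow> g u \<le> g v \<longleftrightarrow> sum_key u \<le> sum_key v"
      using ex[of y] by blast
    have *: "{z \<in> F b. sum_key z < sum_key (Inr y)} = F y"
      using that by (auto simp: F_def sum_key_def)
    show ?thesis
    proof (rule rank_eqI[OF f])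
      show "Inr y \<in> F b" using that by (simp add: F_def)
      show "bij_betw g {z \<in> F b. sum_key z < sum_key (Inr y)} {..<a + y}" using g(1) * by simp
      show "g u \<le> g v \<longleftrightarrow> sum_key u \<le> sum_key v"
        if "u \<in> F b" "v \<in> F b" "sum_key u < sum_key (Inr y)" "sum_key v < sum_key (Inr y)" for u v
        using g(2)[of u v] that unfolding *[symmetric] by simp
    qed
  qed
  have eq: "case_sum (\<lambda>x. x) ((+) a) u = f u" if "u \<in> F b" for u
    using that inl inr by (auto simp: F_def)
  show "bij_betw (case_sum (\<lambda>x. x) ((+) a)) ({..<a} <+> {..<b}) {..<a + b}"
    using f(1) eq bij_betw_cong[of "F b" "case_sum (\<lambda>x. x) ((+) a)" f] by (simp add: F_def)
  show "case_sum (\<lambda>x. x) ((+) a) u \<le> case_sum (\<lambda>x. x) ((+) a) v \<longleftrightarrow> sum_key u \<le> sum_key v"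
    if "u \<in> {..<a} <+> {..<b}" "v \<in> {..<a} <+> {..<b}"
    using f(2)[of u v] eq[of u] eq[of v] that by (simp add: F_def)
qed

text \<open>The recursion for addition, from which its algebraic laws follow by induction on the
  right argument without reference to \<open>otype\<close>.\<close>

lemma less_plus_iff: "z < a + b \<longleftrightarrow> z < a \<or> (\<exists>y<b. z = a + y)" for a b z :: "'a ordinal"
proof -
  have "{..<a + b} = case_sum (\<lambda>x. x) ((+) a) ` ({..<a} <+> {..<b})"
    using plus_rank(1)[of a b] by (simp add: bij_betw_def)
  also have "\<dots> = {..<a} \<union> (+) a ` {..<b}" by (auto simp: Plus_def image_Un image_image)
  finally show ?thesis by (auto simp: set_eq_iff)
qed

lemma plus_le_cancel [simp]: "a + x \<le> a + y \<longleftrightarrow> x \<le> y" for a x y :: "'a ordinal"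
proof -
  obtain b where b: "max x y < b" using ex_greater_ordinal by blast
  then show ?thesis
    using plus_rank(2)[of "Inr x" a b "Inr y"] by (simp add: sum_key_def)
qed

lemma plus_less_cancel [simp]: "a + x < a + y \<longleftrightarrow> x < y" for a x y :: "'a ordinal"
  by (simp add: not_le[symmetric])

lemma plus_eq_cancel [simp]: "a + x = a + y \<longleftrightarrow> x = y" for a x y :: "'a ordinal"
  by (simp add: eq_iff)

lemma plus_zero_right [simp]: "a + 0 = a" for a :: "'a ordinal"
  by (rule ordinal_eqI) (simp add: less_plus_iff)

lemma le_plus [simp]: "a \<le> a + x" for a x :: "'a ordinal"
  using plus_le_cancel[of a 0 x] by simp

lemma lessThan_plus: "{..<a + b} = {..<a} \<union> (+) a ` {..<b}" for a b :: "'a ordinal"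
  by (auto simp: less_plus_iff)

lemma lessThan_plus_disjoint: "{..<a} \<inter> (+) a ` {..<b} = {}" for a b :: "'a ordinal"
  using le_plus not_le by blast

lemma bij_betw_plus_combine:
  fixes a b :: "'a ordinal"
  assumes "bij_betw f A {..<a}" "bij_betw g B {..<b}" "A \<inter> B = {}"
    and hA: "\<And>x. x \<in> A \<Longrightarrow> h x = f x" and hB: "\<And>x. x \<in> B \<Longrightarrow> h x = a + g x"
  shows "bij_betw h (A \<union> B) {..<a + b}"
proof -
  have "bij_betw h A {..<a}" using assms(1) by (rule bij_betw_cong[THEN iffD1, rotated]) (simp add: hA)
  moreover have "bij_betw h B ((+) a ` {..<b})"
  proof -
    have "bij_betw ((+) a) {..<b} ((+) a ` {..<b})" by (auto simp: bij_betw_def inj_on_def)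
    then have "bij_betw ((+) a \<circ> g) B ((+) a ` {..<b})" using assms(2) bij_betw_trans by blast
    then show ?thesis by (rule bij_betw_cong[THEN iffD1, rotated]) (simp add: hB)
  qed
  ultimately show ?thesis unfolding lessThan_plus by (rule bij_betw_combine[OF _ _ lessThan_plus_disjoint])
qed

lemma plus_zero_left [simp]: "0 + a = a" for a :: "'a ordinal"
proof (induction a rule: less_induct)
  case (less a)
  show ?case
  proof (rule ordinal_eqI)
    fix z
    have "z < 0 + a \<longleftrightarrow> (\<exists>y<a. z = 0 + y)" by (simp only: less_plus_iff ordinal_not_less_zero simp_thms)
    also have "\<dots> \<longleftrightarrow> (\<exists>y<a. z = y)" using less by (intro ex_cong1 conj_cong refl) auto
    finally show "z < 0 + a \<longleftrightarrow> z < a" by simp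
  qed
qed

lemma plus_assoc: "a + b + c = a + (b + c)" for a b c :: "'a ordinal"
proof (induction c rule: less_induct)
  case (less c)
  show ?case
  proof (rule ordinal_eqI)
    fix z
    have "z < a + b + c \<longleftrightarrow> z < a + b \<or> (\<exists>y<c. z = a + b + y)" by (rule less_plus_iff)
    also have "\<dots> \<longleftrightarrow> z < a + b \<or> (\<exists>y<c. z = a + (b + y))"
      using less by (intro disj_cong ex_cong1 conj_cong refl) auto
    also have "\<dots> \<longleftrightarrow> z < a \<or> (\<exists>w<b + c. z = a + w)"
      unfolding less_plus_iff[of z a b] less_plus_iff[of _ b c] by blast
    also have "\<dots> \<longleftrightarrow> z < a + (b + c)" by (rule less_plus_iff[symmetric])
    finally show "z < a + b + c \<longleftrightarrow> z < a + (b + c)" .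
  qed
qed

lemma plus_mono_left: "a \<le> a' \<Longrightarrow> a + b \<le> a' + b" for a a' b :: "'a ordinal"
proof (induction b rule: less_induct)
  case (less b)
  show ?case
  proof (rule ordinal_leI)
    fix z assume "z < a + b"
    then consider "z < a" | y where "y < b" "z = a + y" by (auto simp: less_plus_iff)
    then show "z < a' + b"
    proof cases
      case 1
      then show ?thesis using less.prems le_plus[of a' b] by (meson less_le_trans)
    next
      case 2
      then have "z \<le> a' + y" using less by auto
      also have "\<dots> < a' + b" using 2 by simp
      finally show ?thesis .
    qed
  qed
qed

lemma plus_mono: "a \<le> a' \<Longrightarrow> b \<le> b' \<Longrightarrow> a + b \<le> a' + b'" for a a' b b' :: "'a ordinal"
  using plus_mono_left[of a a' b] plus_le_cancel[of a' b b'] by (meson order.trans)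

lemma le_plus2: "b \<le> a + b" for a b :: "'a ordinal"
  using plus_mono_left[of 0 a b] by simp

lemma plus_eq_zero_iff [simp]: "a + b = 0 \<longleftrightarrow> a = 0 \<and> b = 0" for a b :: "'a ordinal"
  by (metis le_plus ordinal_le_zero plus_zero_left)

lemma less_add_right: "0 < x \<Longrightarrow> a < a + x" for a x :: "'a ordinal"
  using plus_less_cancel[of a 0 x] by simp

lemma ex_plus: "a \<le> c \<Longrightarrow> \<exists>d. c = a + d" for a c :: "'a ordinal"
proof -
  assume "a \<le> c"
  \<comment> \<open>\<open>e\<close> is merely a bound: \<open>e \<le> a + e\<close> puts
    \<open>c\<close> below \<open>a + e\<close>, and \<open>less_plus_iff\<close> then yields the
    difference.\<close>
  obtain e where "c < e" using ex_greater_ordinal by blast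
  then have "c < a + e" using le_plus2[of e a] by auto
  then show ?thesis using \<open>a \<le> c\<close> by (auto simp: less_plus_iff)
qed

lemma less_one_iff [simp]: "x < 1 \<longleftrightarrow> x = 0" for x :: "'a ordinal"
proof -
  have "0 < (1 :: 'a ordinal)"
    unfolding one_ordinal_def by (rule LeastI_ex) (rule ex_greater_ordinal)
  moreover have "\<not> 0 < x" if "x < 1"
    using not_less_Least[of x "\<lambda>a. 0 < a"] that by (simp add: one_ordinal_def)
  ultimately show ?thesis by (auto simp: ordinal_pos_iff)
qed

lemma zero_less_one_ordinal [simp]: "0 < (1 :: 'a ordinal)"
  by simp

lemma less_plus_one_iff [simp]: "x < a + 1 \<longleftrightarrow> x \<le> a" for a x :: "'a ordinal"
  by (auto simp: less_plus_iff)

lemma lessThan_one [simp]: "{..<1 :: 'a ordinal} = {0}"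
  by auto

text \<open>As for sums: the points before \<open>(i, x)\<close> are \<open>i\<close> full copies of
  \<open>a\<close> followed by \<open>x\<close> points of the next copy.\<close>

lemma times_rank:
  fixes a b :: "'a ordinal"
  shows "bij_betw (\<lambda>(i, x). a * i + x) ({..<b} \<times> {..<a}) {..<a * b}"
    "u \<in> {..<b} \<times> {..<a} \<Longrightarrow> v \<in> {..<b} \<times> {..<a} \<Longrightarrow>
      (\<lambda>(i, x). a * i + x) u \<le> (\<lambda>(i, x). a * i + x) v \<longleftrightarrow> u \<le> v"
proof -
  define F where "F b = {..<b} \<times> {..<a}" for b :: "'a ordinal"
  have ex: "\<exists>f. bij_betw f (F b) {..<a * b} \<and> (\<forall>u\<in>F b. \<forall>v\<in>F b. f u \<le> f v \<longleftrightarrow> u \<le> v)" for b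
  proof -
    let ?r = "{((i, x), (j, y)) | i x j y. i < b \<and> j < b \<and> x < a \<and> y < a \<and> (i < j \<or> i = j \<and> x \<le> y)}"
    have r: "?r = {(u, v). u \<in> F b \<and> v \<in> F b \<and> id u \<le> id v}"
      by (auto simp: F_def)
    note wo = Well_order_inj_on[OF inj_on_id r]
    have "small T (Field ?r)"
      unfolding wo(2) unfolding F_def by (intro small_Times card_lessThan_ordinal)
    then obtain f where f: "bij_betw f (Field ?r) {..<otype ?r :: 'a ordinal}"
      "\<And>x y. x \<in> Field ?r \<Longrightarrow> y \<in> Field ?r \<Longrightarrow> (x, y) \<in> ?r \<longleftrightarrow> f x \<le> f y"
      using otype_rank[OF wo(1)] by blast
    have "otype ?r = a * b" unfolding times_ordinal_def ..
    moreover have "f u \<le> f v \<longleftrightarrow> u \<le> v" if "u \<in> F b" "v \<in> F b" for u v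
      using f(2)[of u v] that unfolding wo(2) unfolding r by auto
    ultimately show ?thesis using f(1) unfolding wo(2) by auto
  qed
  obtain f where f: "bij_betw f (F b) {..<a * b}" "\<And>u v. u\<in>F b \<Longrightarrow> v\<in>F b \<Longrightarrow> f u \<le> f v \<longleftrightarrow> u \<le> v"
    using ex[of b] by blast
  have val: "f (i, x) = a * i + x" if "i < b" "x < a" for i x
  proof -
    obtain g where g: "bij_betw g (F i) {..<a * i}" "\<And>u v. u\<in>F i \<Longrightarrow> v\<in>F i \<Longrightarrow> g u \<le> g v \<longleftrightarrow> u \<le> v"
      using ex[of i] by blast
    define h where "h = (\<lambda>(j, y). if j < i then g (j, y) else a * i + y)"
    have D: "{z \<in> F b. z < (i, x)} = F i \<union> {i} \<times> {..<x}" using that by (auto simp: F_def)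
    have gi: "g (j, y) < a * i" if "j < i" "y < a" for j y
      using g(1) that by (auto simp: bij_betw_def F_def)
    have h1: "h u \<le> h v \<longleftrightarrow> u \<le> v" if "u \<in> F i \<union> {i} \<times> {..<x}" "v \<in> F i \<union> {i} \<times> {..<x}" for u v
    proof -
      obtain j y k z where uv: "u = (j, y)" "v = (k, z)" by (metis surj_pair)
      show ?thesis
      proof (cases "j < i"; cases "k < i")
        assume "j < i" "k < i"
        then show ?thesis using that g(2)[of "(j, y)" "(k, z)"] by (auto simp: uv h_def F_def)
      next
        assume *: "j < i" "\<not> k < i"
        then have "y < a" using that by (auto simp: uv F_def)
        then have "g (j, y) \<le> a * i + z" using * gi[of j y] le_plus[of "a * i" z] by (meson less_imp_le less_le_trans)
        then show ?thesis using * that by (auto simp: uv h_def F_def)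
      next
        assume *: "\<not> j < i" "k < i"
        then have "z < a" using that by (auto simp: uv F_def)
        then have "g (k, z) < a * i + y" using * gi[of k z] le_plus[of "a * i" y] by (meson less_le_trans)
        then show ?thesis using * that by (auto simp: uv h_def F_def)
      next
        assume "\<not> j < i" "\<not> k < i"
        then show ?thesis using that by (auto simp: uv h_def F_def)
      qed
    qed
    have "h ` F i = g ` F i" by (rule image_cong) (auto simp: h_def F_def)
    moreover have *: "h ` ({i} \<times> {..<x}) = (+) (a * i) ` {..<x}" by (force simp: h_def)
    ultimately have "h ` (F i \<union> {i} \<times> {..<x}) = {..<a * i} \<union> (+) (a * i) ` {..<x}"
      using g(1) * by (simp add: bij_betw_def image_Un)
    also have "\<dots> = {..<a * i + x}" by (auto simp: less_plus_iff less_le_trans)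
    finally have "h ` (F i \<union> {i} \<times> {..<x}) = {..<a * i + x}" .
    moreover have "inj_on h (F i \<union> {i} \<times> {..<x})"
      by (rule inj_onI) (metis h1 order.antisym order.refl)
    ultimately have "bij_betw h (F i \<union> {i} \<times> {..<x}) {..<a * i + x}" by (simp add: bij_betw_def)
    then have hb: "bij_betw h {z \<in> F b. z < (i, x)} {..<a * i + x}" unfolding D .
    show ?thesis
    proof (rule rank_eqI[OF f _ hb])
      show "(i, x) \<in> F b" using that by (simp add: F_def)
      show "h u \<le> h v \<longleftrightarrow> u \<le> v" if "u \<in> F b" "v \<in> F b" "u < (i, x)" "v < (i, x)" for u v
        using h1[of u v] that D by blast
    qed
  qed
  have eq: "(\<lambda>(i, x). a * i + x) u = f u" if "u \<in> F b" for u
    using that val by (auto simp: F_def)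
  show "bij_betw (\<lambda>(i, x). a * i + x) ({..<b} \<times> {..<a}) {..<a * b}"
    using f(1) eq bij_betw_cong[of "F b" "\<lambda>(i, x). a * i + x" f] by (simp add: F_def)
  show "(\<lambda>(i, x). a * i + x) u \<le> (\<lambda>(i, x). a * i + x) v \<longleftrightarrow> u \<le> v"
    if "u \<in> {..<b} \<times> {..<a}" "v \<in> {..<b} \<times> {..<a}"
    using f(2)[of u v] eq[of u] eq[of v] that by (simp add: F_def)
qed

lemma less_times_iff: "z < a * b \<longleftrightarrow> (\<exists>i<b. \<exists>x<a. z = a * i + x)" for a b z :: "'a ordinal"
proof -
  have "{..<a * b} = (\<lambda>(i, x). a * i + x) ` ({..<b} \<times> {..<a})"
    using times_rank(1)[of a b] by (simp add: bij_betw_def)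
  then show ?thesis by (auto simp: set_eq_iff)
qed

lemma times_plus_le_iff:
  "x < a \<Longrightarrow> y < a \<Longrightarrow> a * i + x \<le> a * j + y \<longleftrightarrow> i < j \<or> i = j \<and> x \<le> y" for a i j x y :: "'a ordinal"
proof -
  assume "x < a" "y < a"
  obtain b where b: "max i j < b" using ex_greater_ordinal by blast
  then show ?thesis
    using times_rank(2)[of "(i, x)" b a "(j, y)"] \<open>x < a\<close> \<open>y < a\<close> by auto
qed

lemma times_zero_right [simp]: "a * 0 = 0" for a :: "'a ordinal"
  by (rule ordinal_eqI) (simp add: less_times_iff)

lemma times_zero_left [simp]: "0 * a = 0" for a :: "'a ordinal"
  by (rule ordinal_eqI) (simp add: less_times_iff)

lemma times_one_right [simp]: "a * 1 = a" for a :: "'a ordinal"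
  by (rule ordinal_eqI) (simp add: less_times_iff)

lemma distrib_left_ordinal: "a * (b + c) = a * b + a * c" for a b c :: "'a ordinal"
proof (induction c rule: less_induct)
  case (less c)
  show ?case
  proof (rule ordinal_eqI)
    fix z
    have "z < a * (b + c) \<longleftrightarrow> z < a * b \<or> (\<exists>y<c. \<exists>x<a. z = a * (b + y) + x)"
      unfolding less_times_iff less_plus_iff[of _ b c] by blast
    also have "\<dots> \<longleftrightarrow> z < a * b \<or> (\<exists>y<c. \<exists>x<a. z = a * b + (a * y + x))"
      using less by (intro disj_cong ex_cong1 conj_cong refl) (auto simp: plus_assoc)
    also have "\<dots> \<longleftrightarrow> z < a * b + a * c"
      unfolding less_plus_iff[of z "a * b"] less_times_iff[of _ a c] by blast
    finally show "z < a * (b + c) \<longleftrightarrow> z < a * b + a * c" .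
  qed
qed

lemma times_less_cancel: "0 < a \<Longrightarrow> a * x < a * y \<longleftrightarrow> x < y" for a x y :: "'a ordinal"
  using times_plus_le_iff[of 0 a 0 y x] by (simp add: not_le[symmetric]) (auto simp: not_less)

lemma times_mono_right: "x \<le> y \<Longrightarrow> a * x \<le> a * y" for a x y :: "'a ordinal"
  using times_less_cancel[of a y x] by (cases "a = 0") (auto simp: ordinal_pos_iff not_less[symmetric])

lemma le_times: "0 < a \<Longrightarrow> b \<le> a * b" for a b :: "'a ordinal"
  by (rule strict_mono_on_ordinal_le[of b "\<lambda>x. a * x"]) (simp_all add: times_less_cancel)

end

section \<open>Cantor normal forms and Hessenberg operations\<close>

lemma omega_sum_Nil [simp]: "omega_sum [] = 0"
  by (simp add: omega_sum_def)

lemma omega_sum_Cons [simp]: "omega_sum (e # es) = omega_pow e + omega_sum es"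
  by (simp add: omega_sum_def)

text \<open>Cantor normal forms as multisets of exponents. The non-increasing order is imposed only
  on evaluation, so the Hessenberg sum becomes the union of multisets and comparison becomes the
  multiset order.\<close>

definition osum :: "'a ordinal multiset \<Rightarrow> 'a ordinal"
  where "osum M = omega_sum (rev (sorted_list_of_multiset M))"

lemma osum_empty [simp]: "osum {#} = 0"
  by (simp add: osum_def)

lemma osum_add_mset: "(\<And>x. x \<in># M \<Longrightarrow> x \<le> e) \<Longrightarrow> osum (add_mset e M) = omega_pow e + osum M"
  by (simp add: osum_def sorted_insort_is_snoc)

text \<open>The description is justified later by existence and uniqueness of normal forms,
  \<open>ex_osum\<close> and \<open>osum_eq_iff\<close>.\<close>

definition exps :: "'a ordinal \<Rightarrow> 'a ordinal multiset"
  where "exps a = (THE M. osum M = a)"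

definition hprod_mset :: "'a ordinal multiset \<Rightarrow> 'a ordinal multiset \<Rightarrow> 'a ordinal multiset"
  where "hprod_mset A B = (\<Sum>d\<in>#A. image_mset (hsum d) B)"

text \<open>A largest exponent is split off because \<open>osum_add_mset\<close> can put only such
  an exponent in front of a normal form.\<close>

lemma multiset_Max_induct [case_names empty add]:
  fixes P :: "'b :: linorder multiset \<Rightarrow> bool"
  assumes "P {#}" and add: "\<And>e M. P M \<Longrightarrow> (\<And>x. x \<in># M \<Longrightarrow> x \<le> e) \<Longrightarrow> P (add_mset e M)"
  shows "P M"
proof (induction "size M" arbitrary: M)
  case 0
  then show ?case using assms(1) by simp
next
  case (Suc n)
  define e where "e = Max (set_mset M)"
  have ne: "set_mset M \<noteq> {}" using Suc(2) by auto
  then have "e \<in># M" unfolding e_def by (intro Max_in) auto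
  then obtain N where N: "M = add_mset e N" by (meson multi_member_split)
  moreover have "x \<le> e" if "x \<in># N" for x
    unfolding e_def by (rule Max_ge) (use that N in auto)
  ultimately show ?case using add Suc by auto
qed

lemma multiset_Max_cases:
  "M = {#} \<or> (\<exists>e N. M = add_mset e N \<and> (\<forall>x\<in>#N. x \<le> e))" for M :: "'b :: linorder multiset"
  by (induction M rule: multiset_Max_induct) auto

context infinite_type
begin

section \<open>Powers of omega\<close>

lemma ex_infinite_lessThan: "\<exists>a :: 'a ordinal. infinite {..<a}"
proof -
  obtain a :: "'a ordinal" and f where f: "bij_betw f (Field |UNIV :: 'a set| ) {..<a}"
    using ex_rank[of "|UNIV :: 'a set|"] card_of_Well_order[of "UNIV :: 'a set"]
      ordLeq_reflexive[OF card_of_Well_order] by (metis Field_card_of)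
  then show ?thesis using bij_betw_finite[OF f] infinite_UNIV_type by (auto simp: Field_card_of)
qed

lemma infinite_lessThan_omega: "infinite {..<ord_omega :: 'a ordinal}"
  unfolding ord_omega_def by (rule LeastI_ex) (rule ex_infinite_lessThan)

lemma finite_less_omega: "a < ord_omega \<Longrightarrow> finite {..<a :: 'a ordinal}"
  unfolding ord_omega_def using not_less_Least by blast

lemma one_less_omega: "1 < (ord_omega :: 'a ordinal)"
proof (rule ccontr)
  assume "\<not> ?thesis"
  then have "{..<ord_omega :: 'a ordinal} \<subseteq> {..<1}" unfolding lessThan_subset_iff by (simp add: not_less)
  then show False using infinite_lessThan_omega finite_subset[of _ "{..<1 :: 'a ordinal}"] by auto
qed

lemma omega_pow_facts:
  "0 < omega_pow a" "b < a \<Longrightarrow> omega_pow b * ord_omega \<le> omega_pow a" for a b :: "'a ordinal"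
proof -
  have "small T ((\<lambda>b. omega_pow b * ord_omega) ` {..<a})"
    by (intro small_image card_lessThan_ordinal)
  then obtain c where c: "\<And>x. x \<in> (\<lambda>b. omega_pow b * ord_omega) ` {..<a} \<Longrightarrow> x < c"
    using small_bounded by blast
  \<comment> \<open>\<open>c + 1\<close> instead of \<open>c\<close>: the candidate also has to be
    positive, and for \<open>a = 0\<close> the bound \<open>c\<close> may be 0.\<close>
  have "\<forall>b<a. omega_pow b * ord_omega \<le> c + 1" using c by (meson imageI lessThan_iff le_plus less_imp_le order.trans)
  moreover have "0 < c + 1" by simp
  ultimately have "\<exists>c. 0 < c \<and> (\<forall>b<a. omega_pow b * ord_omega \<le> c)" by blast
  from LeastI_ex[OF this] show "0 < omega_pow a" "b < a \<Longrightarrow> omega_pow b * ord_omega \<le> omega_pow a"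
    by (auto simp: omega_pow.simps[of a])
qed

lemma omega_pow_neq_zero [simp]: "omega_pow a \<noteq> 0" for a :: "'a ordinal"
  using omega_pow_facts(1)[of a] by auto

lemma omega_pow_le: "0 < c \<Longrightarrow> (\<And>b. b < a \<Longrightarrow> omega_pow b * ord_omega \<le> c) \<Longrightarrow> omega_pow a \<le> c"
  for a c :: "'a ordinal"
  unfolding omega_pow.simps[of a] by (rule Least_le) simp

lemma omega_pow_strict_mono: "b < a \<Longrightarrow> omega_pow b < omega_pow a" for a b :: "'a ordinal"
  using omega_pow_facts(2)[of b a] times_less_cancel[of "omega_pow b" 1 ord_omega] omega_pow_facts(1)[of b] one_less_omega
  by (simp add: less_le_trans)

lemma omega_pow_less_iff [simp]: "omega_pow a < omega_pow b \<longleftrightarrow> a < b" for a b :: "'a ordinal"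
  using omega_pow_strict_mono by (metis less_asym linorder_neqE)

lemma omega_pow_le_iff [simp]: "omega_pow a \<le> omega_pow b \<longleftrightarrow> a \<le> b" for a b :: "'a ordinal"
  by (simp add: not_less[symmetric])

lemma omega_pow_zero [simp]: "omega_pow 0 = (1 :: 'a ordinal)"
proof (rule order.antisym)
  show "omega_pow 0 \<le> (1 :: 'a ordinal)" by (rule omega_pow_le) auto
  show "(1 :: 'a ordinal) \<le> omega_pow 0" using less_one_iff[of "omega_pow 0"] omega_pow_facts(1)[of 0] by (metis not_le ordinal_not_less_zero)
qed

lemma le_omega_pow: "a \<le> omega_pow a" for a :: "'a ordinal"
  by (rule strict_mono_on_ordinal_le[of a omega_pow]) auto

lemma omega_sum_replicate_add:
  "omega_sum (replicate (m + n) b) = omega_sum (replicate m b) + omega_sum (replicate n b)" for b :: "'a ordinal"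
  by (induction m) (auto simp: plus_assoc)

lemma one_neq_zero_ordinal [simp]: "(1 :: 'a ordinal) \<noteq> 0"
  using zero_less_one_ordinal by force

lemma times_finite:
  fixes k :: "'a ordinal"
  assumes "finite {..<k}"
  shows "omega_pow b * k = omega_sum (replicate (card {..<k}) b)"
  using assms
proof (induction "card {..<k}" arbitrary: k)
  case 0
  then have "{..<k} = {}" by simp
  then have "k = 0" by (metis lessThan_iff empty_iff ordinal_pos_iff)
  then show ?case by simp
next
  case (Suc m)
  then have "{..<k} \<noteq> {}" by auto
  then have "k \<noteq> 0" by auto
  then have "1 \<le> k" by (auto simp: not_less[symmetric])
  \<comment> \<open>One is removed on the left, so that distributivity produces exactly one
    \<open>Cons\<close> of \<open>replicate\<close>.\<close>
  then obtain j where j: "k = 1 + j" using ex_plus by blast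
  have k: "{..<k} = insert 0 ((+) 1 ` {..<j})" by (auto simp: j less_plus_iff)
  then have "finite ((+) 1 ` {..<j})" using Suc by simp
  then have fin: "finite {..<j}" by (rule finite_imageD) (auto simp: inj_on_def)
  have "card {..<k} = Suc (card {..<j})"
    unfolding k using fin by (subst card_insert_disjoint) (auto simp: card_image inj_on_def)
  then show ?case using Suc(1)[of j] fin Suc(2) by (simp add: j distrib_left_ordinal)
qed

text \<open>A positive \<open>x\<close> that no finite multiple of a smaller power exceeds is a
  candidate in the \<open>LEAST\<close> that defines \<open>omega_pow a\<close>. The case
  \<open>x = 0\<close> is separate because for \<open>a = 0\<close> there is no smaller
  power.\<close>

lemma less_omega_powD:
  fixes x a :: "'a ordinal"
  assumes "x < omega_pow a" shows "x = 0 \<or> (\<exists>b<a. \<exists>m. x < omega_sum (replicate m b))"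
proof (rule ccontr)
  assume *: "\<not> ?thesis"
  have "omega_pow b * ord_omega \<le> x" if "b < a" for b
  proof (rule ordinal_leI)
    fix z assume "z < omega_pow b * ord_omega"
    then obtain i y where z: "z = omega_pow b * i + y" "i < ord_omega" "y < omega_pow b" by (auto simp: less_times_iff)
    then have "z < omega_pow b * i + omega_pow b" by simp
    also have "\<dots> = omega_sum (replicate (card {..<i} + 1) b)"
      unfolding omega_sum_replicate_add using times_finite[OF finite_less_omega[OF z(2)]] by simp
    also have "\<dots> \<le> x" using * that by (meson not_le)
    finally show "z < x" .
  qed
  then have "omega_pow a \<le> x" using omega_pow_le[of x a] * by (auto simp: ordinal_pos_iff)
  then show False using assms by simp
qed

lemma omega_sum_replicate_less: "b < a \<Longrightarrow> omega_sum (replicate m b) < omega_pow a" for a b :: "'a ordinal"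
proof -
  assume "b < a"
  have ex: "\<exists>k :: 'a ordinal. k < ord_omega \<and> card {..<k} = m" for m
  proof (induction m)
    case 0
    have "0 < (ord_omega :: 'a ordinal)" using one_less_omega by (meson le_less_trans ordinal_zero_le)
    then show ?case by (intro exI[of _ 0]) simp
  next
    case (Suc m)
    then obtain k :: "'a ordinal" where k: "k < ord_omega" "card {..<k} = m" by blast
    have *: "{..<k + 1} = insert k {..<k}" by auto
    then have "finite {..<k + 1}" using finite_less_omega[OF k(1)] by simp
    then have "\<not> ord_omega \<le> k + 1" using infinite_lessThan_omega finite_subset[of "{..<ord_omega}" "{..<k + 1}"]
      by (auto simp: lessThan_subset_iff)
    then show ?case using k * finite_less_omega[OF k(1)] by (intro exI[of _ "k + 1"]) auto
  qed
  then obtain k :: "'a ordinal" where k: "k < ord_omega" "card {..<k} = m" by blast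
  then have "omega_sum (replicate m b) = omega_pow b * k" using times_finite[OF finite_less_omega] by metis
  also have "\<dots> < omega_pow b * ord_omega" using k times_less_cancel[OF omega_pow_facts(1)] by blast
  also have "\<dots> \<le> omega_pow a" by (rule omega_pow_facts(2)[OF \<open>b < a\<close>])
  finally show ?thesis .
qed

lemma omega_sum_replicate_mono:
  fixes b c :: "'a ordinal"
  assumes "b \<le> c" shows "omega_sum (replicate m b) \<le> omega_sum (replicate m c)"
  by (induction m) (use assms in \<open>auto intro!: plus_mono\<close>)

text \<open>Both summands lie below finite multiples of one smaller power, taken with the larger of
  the two exponents, and the multiplicities add up.\<close>

lemma omega_pow_add_less: "x < omega_pow a \<Longrightarrow> y < omega_pow a \<Longrightarrow> x + y < omega_pow a" for x y a :: "'a ordinal"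
proof -
  assume xy: "x < omega_pow a" "y < omega_pow a"
  show ?thesis
  proof (cases "x = 0 \<or> y = 0")
    case True
    then show ?thesis using xy by auto
  next
    case False
    then obtain b m c n where *: "b < a" "x < omega_sum (replicate m b)" "c < a" "y < omega_sum (replicate n c)"
      using xy less_omega_powD by metis
    define d where "d = max b c"
    have "x \<le> omega_sum (replicate m d)" "y \<le> omega_sum (replicate n d)"
      using * omega_sum_replicate_mono[of b d m] omega_sum_replicate_mono[of c d n] by (auto simp: d_def)
    then have "x + y \<le> omega_sum (replicate (m + n) d)" by (auto simp: omega_sum_replicate_add intro: plus_mono)
    also have "\<dots> < omega_pow a" by (rule omega_sum_replicate_less) (use * in \<open>auto simp: d_def\<close>)
    finally show ?thesis .
  qed
qed

section \<open>Existence and uniqueness of Cantor normal forms\<close>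

lemma osum_less_omega_pow: "(\<And>x. x \<in># M \<Longrightarrow> x < e) \<Longrightarrow> osum M < omega_pow e" for e :: "'a ordinal"
proof (induction M rule: multiset_Max_induct)
  case empty
  then show ?case by (simp add: ordinal_pos_iff)
next
  case (add c M)
  then show ?case by (simp add: osum_add_mset omega_pow_add_less)
qed

text \<open>The multiset order compares largest elements first, as normal forms are compared. A
  common largest exponent cancels; if \<open>M\<close> lacks the largest exponent \<open>e\<close>
  on the right, all of \<open>M\<close> stays below \<open>omega_pow e\<close>. Uniqueness of normal
  forms follows, and monotonicity of the Hessenberg operations is inherited from the multiset
  order.\<close>

lemma osum_strict_mono: "M < N \<Longrightarrow> osum M < osum N" for M N :: "'a ordinal multiset"
proof (induction N arbitrary: M rule: multiset_Max_induct)
  case empty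
  then show ?case by simp
next
  case (add e N)
  have "\<not> e < x" if "x \<in># M" for x
  proof
    assume "e < x"
    then have "add_mset e N < M" using that add.hyps
      by (intro ex_gt_imp_less_multiset) (auto intro: le_less_trans)
    then show False using add.prems by simp
  qed
  then have le: "x \<le> e" if "x \<in># M" for x using that not_le by blast
  show ?case
  proof (cases "e \<in># M")
    case True
    then obtain M' where M': "M = add_mset e M'" by (meson multi_member_split)
    then have "M' < N" using add.prems by simp
    then show ?thesis using add le M' by (simp add: osum_add_mset)
  next
    case False
    then have "osum M < omega_pow e" using le by (intro osum_less_omega_pow) (metis le_less)
    also have "\<dots> \<le> osum (add_mset e N)" using add.hyps by (simp add: osum_add_mset)
    finally show ?thesis .
  qed
qed

lemma osum_less_iff [simp]: "osum M < osum N \<longleftrightarrow> M < N" for M N :: "'a ordinal multiset"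
  using osum_strict_mono by (metis less_asym linorder_neqE)

lemma osum_le_iff [simp]: "osum M \<le> osum N \<longleftrightarrow> M \<le> N" for M N :: "'a ordinal multiset"
  by (simp add: not_less[symmetric])

lemma osum_eq_iff [simp]: "osum M = osum N \<longleftrightarrow> M = N" for M N :: "'a ordinal multiset"
  by (simp add: eq_iff)

lemma osum_single [simp]: "osum {#e#} = omega_pow e" for e :: "'a ordinal"
  using osum_add_mset[of "{#}" e] by simp

lemma osum_append:
  "(\<And>x y. x \<in># M \<Longrightarrow> y \<in># N \<Longrightarrow> y \<le> x) \<Longrightarrow> osum (M + N) = osum M + osum N" for M N :: "'a ordinal multiset"
proof (induction M rule: multiset_Max_induct)
  case empty
  then show ?case by simp
next
  case (add e M)
  then have "osum (M + N) = osum M + osum N" by simp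
  moreover have "osum (add_mset e (M + N)) = omega_pow e + osum (M + N)"
    using add by (intro osum_add_mset) auto
  ultimately show ?case using add.hyps by (simp add: osum_add_mset plus_assoc)
qed

text \<open>With \<open>e\<close> least such that \<open>a < omega_pow e\<close>, some
  \<open>omega_pow b\<close> with \<open>b < e\<close> is the leading term; the remainder is smaller
  than \<open>a\<close> and has a normal form by induction.\<close>

lemma ex_osum: "\<exists>M. a = osum M" for a :: "'a ordinal"
proof (induction a rule: less_induct)
  case (less a)
  show ?case
  proof (cases "a = 0")
    case True
    then show ?thesis by (metis osum_empty)
  next
    case False
    define e where "e = (LEAST e. a < omega_pow e)"
    have "\<exists>e. a < omega_pow e" using ex_greater_ordinal[of a] le_omega_pow by (meson less_le_trans)
    then have e: "a < omega_pow e" unfolding e_def by (rule LeastI_ex)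
    then obtain b m where b: "b < e" "a < omega_sum (replicate m b)" using less_omega_powD False by blast
    have "\<not> a < omega_pow b" using b(1) not_less_Least e_def by blast
    then obtain c where c: "a = omega_pow b + c" using ex_plus[of "omega_pow b" a] by (auto simp: not_less)
    \<comment> \<open>If the remainder were \<open>a\<close> itself, then \<open>a\<close> would
      absorb \<open>omega_pow b\<close> on the left and be at least every finite multiple of it,
      against the choice of \<open>b\<close>.\<close>
    have "c \<noteq> a"
    proof
      assume "c = a"
      then have a: "omega_pow b + a = a" using c by simp
      have "omega_sum (replicate m b) \<le> a" for m
      proof (induction m)
        case (Suc m)
        then have "omega_pow b + omega_sum (replicate m b) \<le> omega_pow b + a" by simp
        then show ?case using a by simp
      qed simp
      then show False using b by (meson not_le)
    qed
    moreover have "c \<le> a" using c le_plus2 by simp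
    ultimately have "c < a" by simp
    then obtain M where M: "c = osum M" using less by blast
    \<comment> \<open>This makes \<open>b\<close> a leading exponent: a power with a larger exponent
      is above all finite multiples of \<open>omega_pow b\<close>, but \<open>a\<close> is
      not.\<close>
    have "\<not> b < x" if "x \<in># M" for x
    proof
      assume "b < x"
      have "omega_sum (replicate m b) < omega_pow x" by (rule omega_sum_replicate_less[OF \<open>b < x\<close>])
      also have "\<dots> = osum {#x#}" by simp
      also have "\<dots> \<le> osum M" using that unfolding osum_le_iff by (simp add: subset_eq_imp_le_multiset)
      also have "\<dots> \<le> a" using \<open>c \<le> a\<close> M by simp
      finally show False using b by simp
    qed
    then have "a = osum (add_mset b M)" using c M by (subst osum_add_mset) (auto simp: not_less)
    then show ?thesis by blast
  qed
qed

lemma osum_exps [simp]: "osum (exps a) = a"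
  for a :: "'a ordinal"
proof -
  obtain M where "osum M = a" using ex_osum by metis
  then show ?thesis unfolding exps_def by (rule theI2) (use \<open>osum M = a\<close> in \<open>auto simp flip: osum_eq_iff\<close>)
qed

lemma exps_osum [simp]: "exps (osum M) = M"
  for M :: "'a ordinal multiset"
  using osum_eq_iff osum_exps by metis

lemma exps_zero [simp]: "exps (0 :: 'a ordinal) = {#}"
  using exps_osum[of "{#}"] by simp

lemma exps_omega_pow [simp]: "exps (omega_pow e) = {#e#}"
  for e :: "'a ordinal"
  using exps_osum[of "{#e#}"] by simp

lemma exps_less_iff: "exps a < exps b \<longleftrightarrow> a < b"
  for a b :: "'a ordinal"
  using osum_less_iff[of "exps a" "exps b"] by simp

lemma cnf_eq: "cnf a = rev (sorted_list_of_multiset (exps a))"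
  for a :: "'a ordinal"
  unfolding cnf_def
proof (rule the_equality)
  show "sorted (rev (rev (sorted_list_of_multiset (exps a)))) \<and> omega_sum (rev (sorted_list_of_multiset (exps a))) = a"
    using osum_exps[of a] by (simp add: osum_def)
  fix es assume es: "sorted (rev es) \<and> omega_sum es = a"
  then have s: "sorted_list_of_multiset (mset es) = rev es"
    by (metis mset_rev sorted_list_of_multiset_mset sorted_sort_id)
  then have "osum (mset es) = a" using es by (simp add: osum_def)
  then show "es = rev (sorted_list_of_multiset (exps a))" using s by auto
qed

lemma mset_cnf: "mset (cnf a) = exps a"
  for a :: "'a ordinal"
  by (simp add: cnf_eq)

text \<open>From here on Hessenberg operations are computed on multisets of exponents.\<close>

lemma hsum_eq: "hsum a b = osum (exps a + exps b)"
  for a b :: "'a ordinal"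
proof -
  have "sort (cnf a @ cnf b) = sorted_list_of_multiset (mset (cnf a @ cnf b))"
    by (simp only: sorted_list_of_multiset_mset)
  then show ?thesis by (simp add: hsum_def osum_def mset_cnf)
qed

lemma exps_hsum [simp]: "exps (hsum a b) = exps a + exps b"
  for a b :: "'a ordinal"
  by (simp add: hsum_eq)

lemma hsum_commute: "hsum a b = hsum b a"
  for a b :: "'a ordinal"
  by (simp add: hsum_eq add.commute)

lemma hsum_zero [simp]: "hsum a 0 = a" "hsum 0 a = a"
  for a :: "'a ordinal"
  by (simp_all add: hsum_eq)

lemma hsum_less_left: "a < a' \<Longrightarrow> hsum a b < hsum a' b"
  for a a' b :: "'a ordinal"
  by (simp add: hsum_eq exps_less_iff)

lemma hsum_less_right: "b < b' \<Longrightarrow> hsum a b < hsum a b'"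
  for a b b' :: "'a ordinal"
  by (simp add: hsum_eq exps_less_iff)

lemma hsum_mono: "a \<le> a' \<Longrightarrow> b \<le> b' \<Longrightarrow> hsum a b \<le> hsum a' b'"
  for a a' b b' :: "'a ordinal"
  using hsum_less_left[of a a' b] hsum_less_right[of b b' a'] by (metis le_less less_le_trans order.trans)

lemma hprod_mset_simps [simp]:
  "hprod_mset {#} B = {#}" "hprod_mset (add_mset d A) B = image_mset (hsum d) B + hprod_mset A B"
  "hprod_mset A {#} = {#}"
  "hprod_mset (A + A') B = hprod_mset A B + hprod_mset A' B"
  for d :: "'a ordinal" and A A' B :: "'a ordinal multiset"
  by (simp_all add: hprod_mset_def)

lemma hprod_mset_add_right: "hprod_mset A (B + B') = hprod_mset A B + hprod_mset A B'"
  for A B B' :: "'a ordinal multiset"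
  by (induction A) (auto simp: ac_simps)

lemma hprod_mset_single [simp]: "hprod_mset A {#e#} = image_mset (\<lambda>d. hsum d e) A"
  for d e :: "'a ordinal" and A :: "'a ordinal multiset"
  by (induction A) auto

lemma hprod_eq: "hprod a b = osum (hprod_mset (exps a) (exps b))"
  for a b :: "'a ordinal"
proof -
  have *: "mset (concat (map (\<lambda>d. map (hsum d) ys) xs)) = hprod_mset (mset xs) (mset ys)" for xs ys :: "'a ordinal list"
    by (induction xs) auto
  have "sort (concat (map (\<lambda>d. map (hsum d) (cnf b)) (cnf a))) =
    sorted_list_of_multiset (mset (concat (map (\<lambda>d. map (hsum d) (cnf b)) (cnf a))))"
    by (simp only: sorted_list_of_multiset_mset)
  then show ?thesis unfolding hprod_def osum_def * mset_cnf by simp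
qed

lemma exps_hprod [simp]: "exps (hprod a b) = hprod_mset (exps a) (exps b)"
  for a b :: "'a ordinal"
  by (simp add: hprod_eq)

lemma exps_one [simp]: "exps (1 :: 'a ordinal) = {#0#}"
  using exps_omega_pow[of 0] by simp

lemma hprod_one [simp]: "hprod a 1 = a"
  for a :: "'a ordinal"
  by (simp add: hprod_eq)

lemma less_omega_pow_iff: "a < omega_pow e \<longleftrightarrow> (\<forall>x\<in>#exps a. x < e)"
  for a e :: "'a ordinal"
proof
  assume "a < omega_pow e"
  show "\<forall>x\<in>#exps a. x < e"
  proof (rule ballI, rule ccontr)
    fix x assume x: "x \<in># exps a" "\<not> x < e"
    then have "omega_pow e \<le> omega_pow x" by simp
    also have "\<dots> = osum {#x#}" by simp
    also have "\<dots> \<le> osum (exps a)" using x unfolding osum_le_iff by (simp add: subset_eq_imp_le_multiset)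
    finally show False using \<open>a < omega_pow e\<close> by simp
  qed
next
  assume "\<forall>x\<in>#exps a. x < e"
  then show "a < omega_pow e" using osum_less_omega_pow[of "exps a" e] by simp
qed

lemma hsum_less_omega_pow: "a < omega_pow e \<Longrightarrow> b < omega_pow e \<Longrightarrow> hsum a b < omega_pow e"
  for a b e :: "'a ordinal"
  by (auto simp: less_omega_pow_iff)

lemma hprod_less_omega_pow: "a < omega_pow d \<Longrightarrow> hprod a (omega_pow e) < omega_pow (hsum d e)"
  for a d e :: "'a ordinal"
  by (auto simp: less_omega_pow_iff hsum_less_left)

text \<open>Under this hypothesis the concatenation of the two normal forms is already
  sorted.\<close>

lemma hsum_eq_plus: "(\<And>x y. x \<in># exps a \<Longrightarrow> y \<in># exps b \<Longrightarrow> y \<le> x) \<Longrightarrow> hsum a b = a + b"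
  for a b :: "'a ordinal"
  by (simp add: hsum_eq osum_append)

lemma hprod_commute: "hprod a b = hprod b a"
  for a b :: "'a ordinal"
proof -
  have "hprod_mset A B = hprod_mset B A" for A B :: "'a ordinal multiset"
  proof (induction A)
    case (add d A)
    have "hprod_mset B (add_mset d A) = hprod_mset B {#d#} + hprod_mset B A"
      using hprod_mset_add_right[of B "{#d#}" A] by simp
    moreover have "image_mset (hsum d) B = image_mset (\<lambda>x. hsum x d) B"
      by (intro image_mset_cong hsum_commute)
    ultimately show ?case using add by simp
  qed simp
  then show ?thesis by (simp add: hprod_eq)
qed

lemma hprod_mono_right: "b \<le> b' \<Longrightarrow> hprod a b \<le> hprod a b'"
  for a b b' :: "'a ordinal"
proof -
  have "hprod_mset A B \<le> hprod_mset A B'" if "B \<le> B'" for A B B' :: "'a ordinal multiset"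
  proof (induction A)
    case (add d A)
    have "image_mset (hsum d) B \<le> image_mset (hsum d) B'"
    proof (cases "B = B'")
      case False
      then have "B < B'" using that by simp
      then have "image_mset (hsum d) B < image_mset (hsum d) B'"
        by (rule image_mset_strict_mono[rotated]) (auto intro: hsum_less_right)
      then show ?thesis by simp
    qed simp
    then show ?case using add by (auto intro: add_mono)
  qed simp
  moreover assume "b \<le> b'"
  then have "exps b \<le> exps b'" using exps_less_iff[of b' b] by (simp add: not_less[symmetric])
  ultimately show ?thesis by (simp add: hprod_eq)
qed

text \<open>As \<open>omega_pow\<close> is defined as a least bound, both inequalities go through
  finite multiples of smaller powers; \<open>rep\<close> is the induction hypothesis extended to
  those multiples.\<close>

lemma omega_pow_plus: "omega_pow m * omega_pow e = omega_pow (m + e)" for m e :: "'a ordinal"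
proof (induction e rule: less_induct)
  case (less e)
  have rep: "omega_sum (replicate k (m + b)) = omega_pow m * omega_sum (replicate k b)" if "b < e" for k b
    by (induction k) (use less that in \<open>auto simp: distrib_left_ordinal\<close>)
  have pos: "0 < omega_pow m * omega_pow e"
    using times_less_cancel[of "omega_pow m" 0 "omega_pow e"] by (simp add: ordinal_pos_iff)
  show ?case
  proof (rule order.antisym; rule ordinal_leI)
    fix z assume "z < omega_pow m * omega_pow e"
    then obtain y x where z: "y < omega_pow e" "x < omega_pow m" "z = omega_pow m * y + x"
      by (auto simp: less_times_iff)
    have x: "x < omega_pow (m + e)" using z(2) by (rule less_le_trans) simp
    have "omega_pow m * y < omega_pow (m + e)"
    proof (cases "y = 0")
      case False
      then obtain b k where b: "b < e" "y < omega_sum (replicate k b)" using z less_omega_powD by metis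
      then have "omega_pow m * y \<le> omega_sum (replicate k (m + b))"
        using rep times_mono_right by simp
      also have "\<dots> < omega_pow (m + e)" by (rule omega_sum_replicate_less) (use b in simp)
      finally show ?thesis .
    qed (simp add: ordinal_pos_iff)
    then show "z < omega_pow (m + e)" using x z by (simp add: omega_pow_add_less)
  next
    fix z assume z: "z < omega_pow (m + e)"
    show "z < omega_pow m * omega_pow e"
    proof (cases "z = 0")
      case False
      then obtain b' k where b': "b' < m + e" "z < omega_sum (replicate k b')" using z less_omega_powD by metis
      show ?thesis
      proof (cases "b' < m")
        case True
        then have "z < omega_pow m" using b' omega_sum_replicate_less[of b' m k] by simp
        also have "\<dots> \<le> omega_pow m * omega_pow e"
          using times_mono_right[of 1 "omega_pow e" "omega_pow m"] by (simp add: not_less[symmetric])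
        finally show ?thesis .
      next
        case False
        then obtain b where b: "b < e" "b' = m + b" using b' by (auto simp: less_plus_iff)
        have "z < omega_pow m * omega_sum (replicate k b)" using b' b rep by simp
        also have "\<dots> < omega_pow m * omega_pow e"
          using b omega_sum_replicate_less by (simp add: times_less_cancel ordinal_pos_iff)
        finally show ?thesis .
      qed
    qed (use pos in simp)
  qed
qed

text \<open>Shifting all exponents by \<open>m\<close> on the left preserves their order, so a
  normal form stays one. Hence left multiplication by \<open>omega_pow m\<close> commutes with the
  Hessenberg sum.\<close>

lemma omega_pow_times_osum: "omega_pow m * osum M = osum (image_mset ((+) m) M)" for m :: "'a ordinal"
proof (induction M rule: multiset_Max_induct)
  case (add e M)
  then have "osum (image_mset ((+) m) (add_mset e M)) = omega_pow (m + e) + osum (image_mset ((+) m) M)"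
    by (simp, intro osum_add_mset) auto
  then show ?case using add by (simp add: osum_add_mset distrib_left_ordinal omega_pow_plus)
qed simp

lemma exps_omega_pow_times [simp]: "exps (omega_pow m * a) = image_mset ((+) m) (exps a)"
  for a m :: "'a ordinal"
  using omega_pow_times_osum[of m "exps a"] by simp

lemma omega_pow_times_hsum: "omega_pow m * hsum a b = hsum (omega_pow m * a) (omega_pow m * b)"
  for a b m :: "'a ordinal"
  by (simp add: hsum_eq omega_pow_times_osum)

text \<open>In a normal form with at least two terms the leading term and the remainder are both
  smaller than \<open>c\<close>, yet their sum is \<open>c\<close>.\<close>

lemma indecomposable_omega_pow:
  fixes c :: "'a ordinal"
  assumes "0 < c" and ind: "\<And>x y. x < c \<Longrightarrow> y < c \<Longrightarrow> x + y < c"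
  obtains m where "c = omega_pow m"
proof -
  obtain M where M: "c = osum M" using ex_osum by blast
  then have "M \<noteq> {#}" using \<open>0 < c\<close> by auto
  then obtain e N where N: "M = add_mset e N" "\<And>x. x \<in># N \<Longrightarrow> x \<le> e" using multiset_Max_cases[of M] by blast
  then have c: "c = omega_pow e + osum N" using M by (simp add: osum_add_mset)
  show thesis
  proof (cases "N = {#}")
    case True
    then show ?thesis using c that by simp
  next
    case False
    then have "osum N \<noteq> 0" using osum_eq_iff[of N "{#}"] by simp
    then have "omega_pow e < c" using c less_add_right by (simp add: ordinal_pos_iff)
    moreover have "osum N < c" using M N osum_less_iff[of N "add_mset e N"] by simp
    ultimately show ?thesis using ind c by auto
  qed
qed

text \<open>A property of the Hessenberg sum that is usually taken as its recursive definition.\<close>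

lemma less_hsumD:
  fixes a b c :: "'a ordinal"
  assumes "c < hsum a b"
  shows "(\<exists>a'<a. c \<le> hsum a' b) \<or> (\<exists>b'<b. c \<le> hsum a b')"
proof -
  \<comment> \<open>Only the last term of the sum, with the least exponent \<open>m\<close>, has to
    be lowered. \<open>main\<close> treats the case that it comes from \<open>a\<close>; the other
    case exchanges the summands.\<close>
  have main: "\<exists>a'<a. c \<le> hsum a' b"
    if c: "c < hsum a b" and m: "m \<in># exps a" "\<And>x. x \<in># exps a + exps b \<Longrightarrow> m \<le> x"
    for a b m :: "'a ordinal"
  proof -
    obtain A where A: "exps a = add_mset m A" using m by (meson multi_member_split)
    define K where "K = A + exps b"
    have Km: "m \<le> x" if "x \<in># K" for x using m that A by (auto simp: K_def)
    have "hsum a b = osum (K + {#m#})" by (simp add: hsum_eq A K_def)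
    also have "\<dots> = osum K + omega_pow m" using Km by (subst osum_append) auto
    finally consider "c \<le> osum K" | d where "d < omega_pow m" "c = osum K + d"
      using c by (auto simp: less_plus_iff)
    then obtain d where d: "d < omega_pow m" "c \<le> osum K + d"
    proof cases
      case 1
      then show ?thesis using that[of 0] omega_pow_facts(1) by simp
    qed (use that in auto)
    \<comment> \<open>\<open>a'\<close> has \<open>d\<close> in place of one term
      \<open>omega_pow m\<close> of \<open>a\<close>. The exponents of \<open>d\<close> lie below
      \<open>m\<close>, so \<open>a'\<close> is smaller than \<open>a\<close>, and the normal forms
      of \<open>K\<close> and \<open>d\<close> concatenate.\<close>
    define a' where "a' = osum (A + exps d)"
    have lt: "x < m" if "x \<in># exps d" for x using d that by (auto simp: less_omega_pow_iff)
    have "exps d < {#m#}" using lt by (intro ex_gt_imp_less_multiset) auto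
    then have "A + exps d < A + {#m#}" by (rule add_strict_left_mono)
    then have "a' < osum (exps a)" unfolding a'_def A osum_less_iff by simp
    moreover have "hsum a' b = osum (K + exps d)" by (simp add: hsum_eq a'_def K_def ac_simps)
    moreover have "\<dots> = osum K + d" using Km lt by (subst osum_append) force+
    ultimately show ?thesis using d by auto
  qed
  have ne: "exps a + exps b \<noteq> {#}"
  proof
    assume "exps a + exps b = {#}"
    then have "hsum a b = 0" by (simp add: hsum_eq)
    then show False using assms by simp
  qed
  define m where "m = Min (set_mset (exps a + exps b))"
  have "m \<in># exps a + exps b" unfolding m_def using ne by (intro Min_in) auto
  moreover have "\<And>x. x \<in># exps a + exps b \<Longrightarrow> m \<le> x" unfolding m_def by (intro Min_le) auto
  ultimately show ?thesis
    using main[of a b m] main[of b a m] assms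
    unfolding hsum_commute[of _ a] add.commute[of "exps b"] by auto
qed

end

section \<open>Lengths of well partial orders\<close>

definition good :: "'b rel \<Rightarrow> 'b set \<Rightarrow> bool"
  where "good R Z \<longleftrightarrow> (\<forall>f :: nat \<Rightarrow> 'b. range f \<subseteq> Z \<longrightarrow> (\<exists>i j. i < j \<and> (f i, f j) \<in> R))"

text \<open>All conditions are relative to \<open>Z\<close>, and \<open>R\<close> may relate points
  outside, so the same \<open>R\<close> serves for every subset of the carrier.\<close>

definition well_po :: "'b rel \<Rightarrow> 'b set \<Rightarrow> bool"
  where "well_po R Z \<longleftrightarrow> refl_on Z R \<and> trans_on Z R \<and> antisym_on Z R \<and> good R Z"

text \<open>The points that may follow \<open>x\<close> in a bad sequence, so residuals are the
  subtrees of the tree of bad sequences.\<close>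

definition resid :: "'b rel \<Rightarrow> 'b set \<Rightarrow> 'b \<Rightarrow> 'b set"
  where "resid R Z x = {y \<in> Z. (x, y) \<notin> R}"

text \<open>An inductive predicate rather than a recursive rank function: monotonicity in
  \<open>Z\<close> and the estimate for unions follow by rule induction, without goodness of
  \<open>R\<close>.\<close>

inductive lenle :: "'b rel \<Rightarrow> 'b set \<Rightarrow> 'a ordinal \<Rightarrow> bool" for R
  where lenleI: "(\<forall>x\<in>Z. \<exists>b<a. lenle R (resid R Z x) b) \<Longrightarrow> lenle R Z a"

text \<open>The length as the rank of the tree of bad sequences; it agrees with the largest type of a
  linear extension, but is monotone under inclusion by definition.\<close>

definition ol :: "'b rel \<Rightarrow> 'b set \<Rightarrow> 'a ordinal"
  where "ol R Z = (LEAST a. lenle R Z a)"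

text \<open>A linear extension of type \<open>t\<close>, represented by its ranking instead of a
  relation.\<close>

definition lext :: "'b rel \<Rightarrow> 'b set \<Rightarrow> 'a ordinal \<Rightarrow> bool"
  where "lext R Z t \<longleftrightarrow> (\<exists>f. bij_betw f Z {..<t} \<and> (\<forall>x\<in>Z. \<forall>y\<in>Z. (x, y) \<in> R \<longrightarrow> f x \<le> f y))"

section \<open>Well partial orders relative to a set\<close>

lemma goodD: "good R Z \<Longrightarrow> range f \<subseteq> Z \<Longrightarrow> \<exists>i j :: nat. i < j \<and> (f i, f j) \<in> R"
  unfolding good_def by simp

lemma good_subset: "good R Z \<Longrightarrow> W \<subseteq> Z \<Longrightarrow> good R W"
  unfolding good_def by (meson order.trans)

lemma well_poD:
  assumes "well_po R Z"
  shows "good R Z" "x \<in> Z \<Longrightarrow> (x, x) \<in> R"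
    "x \<in> Z \<Longrightarrow> y \<in> Z \<Longrightarrow> z \<in> Z \<Longrightarrow> (x, y) \<in> R \<Longrightarrow> (y, z) \<in> R \<Longrightarrow> (x, z) \<in> R"
    "x \<in> Z \<Longrightarrow> y \<in> Z \<Longrightarrow> (x, y) \<in> R \<Longrightarrow> (y, x) \<in> R \<Longrightarrow> x = y"
  using assms unfolding well_po_def by (blast intro: refl_onD trans_onD antisym_onD)+

lemma well_poI:
  assumes "good R Z" "\<And>x. x \<in> Z \<Longrightarrow> (x, x) \<in> R"
    "\<And>x y z. x \<in> Z \<Longrightarrow> y \<in> Z \<Longrightarrow> z \<in> Z \<Longrightarrow> (x, y) \<in> R \<Longrightarrow> (y, z) \<in> R \<Longrightarrow> (x, z) \<in> R"
    "\<And>x y. x \<in> Z \<Longrightarrow> y \<in> Z \<Longrightarrow> (x, y) \<in> R \<Longrightarrow> (y, x) \<in> R \<Longrightarrow> x = y"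
  shows "well_po R Z"
  unfolding well_po_def
proof (intro conjI)
  show "refl_on Z R" using assms(2) by (simp add: refl_on_def)
  show "trans_on Z R" by (rule trans_onI) (rule assms(3))
  show "antisym_on Z R" by (rule antisym_onI) (rule assms(4))
qed fact

lemma well_po_subset: "well_po R Z \<Longrightarrow> W \<subseteq> Z \<Longrightarrow> well_po R W"
  unfolding well_po_def
  by (auto intro: trans_on_subset antisym_on_subset good_subset simp: refl_on_def)

lemma resid_subset: "resid R Z x \<subseteq> Z"
  by (auto simp: resid_def)

lemma resid_mono: "W \<subseteq> Z \<Longrightarrow> resid R W x \<subseteq> resid R Z x"
  by (auto simp: resid_def)

lemma resid_Un: "resid R (A \<union> B) x = resid R A x \<union> resid R B x"
  by (auto simp: resid_def)

text \<open>Passing to residuals terminates, because an infinite chain of residuals picks a bad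
  sequence.\<close>

lemma resid_induct [consumes 2]:
  assumes "good R U" "Z \<subseteq> U"
    and step: "\<And>Z. Z \<subseteq> U \<Longrightarrow> (\<And>x. x \<in> Z \<Longrightarrow> P (resid R Z x)) \<Longrightarrow> P Z"
  shows "P Z"
proof -
  let ?r = "{(resid R Z x, Z) | Z x. Z \<subseteq> U \<and> x \<in> Z}"
  have "wf ?r"
    unfolding wf_iff_no_infinite_down_chain
  proof
    assume "\<exists>f. \<forall>i. (f (Suc i), f i) \<in> ?r"
    then obtain f where "\<forall>i. (f (Suc i), f i) \<in> ?r" by blast
    then have "\<forall>i. \<exists>x. x \<in> f i \<and> f i \<subseteq> U \<and> f (Suc i) = resid R (f i) x" by blast
    then obtain x where x: "\<And>i. x i \<in> f i" "\<And>i. f i \<subseteq> U" "\<And>i. f (Suc i) = resid R (f i) (x i)" by metis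
    have dec: "f j \<subseteq> f i" if "i \<le> j" for i j
      using that
    proof (induction j rule: dec_induct)
      case (step j)
      then show ?case using x(3)[of j] resid_subset[of R "f j" "x j"] by simp
    qed simp
    have "(x i, x j) \<notin> R" if "i < j" for i j
      using dec[of "Suc i" j] that x(1)[of j] x(3)[of i] by (auto simp: resid_def)
    moreover have "range x \<subseteq> U" using x by blast
    ultimately show False using \<open>good R U\<close> unfolding good_def by blast
  qed
  then show ?thesis using \<open>Z \<subseteq> U\<close>
  proof (induction Z rule: wf_induct_rule)
    case (less Z)
    show ?case
    proof (rule step[OF less.prems])
      fix x assume "x \<in> Z"
      then show "P (resid R Z x)" using less resid_subset[of R Z x] by blast
    qed
  qed
qed

text \<open>Ramsey's theorem for pairs. A colour of ordered pairs becomes one of two-element sets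
  through minimum and maximum, and the homogeneous set is enumerated increasingly.\<close>

lemma homogeneous_sequence:
  fixes P :: "nat \<Rightarrow> nat \<Rightarrow> nat"
  assumes "\<And>i j. P i j < s"
  obtains t and g :: "nat \<Rightarrow> nat" where "t < s" "strict_mono g" "\<And>i j. i < j \<Longrightarrow> P (g i) (g j) = t"
proof -
  define c where "c A = P (Min A) (Max A)" for A
  obtain Y t where Y: "infinite Y" "t < s" "\<forall>x\<in>Y. \<forall>y\<in>Y. x \<noteq> y \<longrightarrow> c {x, y} = t"
    using Ramsey2[of UNIV c s] assms by (auto simp: c_def)
  show thesis
  proof
    show "t < s" by fact
    show "strict_mono (enumerate Y)" by (rule strict_mono_enumerate[OF Y(1)])
    fix i j :: nat assume "i < j"
    then have lt: "enumerate Y i < enumerate Y j" using enumerate_mono[OF _ Y(1)] by blast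
    moreover have "enumerate Y i \<in> Y" "enumerate Y j \<in> Y" using enumerate_in_set[OF Y(1)] by auto
    ultimately have "c {enumerate Y i, enumerate Y j} = t" using Y(3) by (metis less_irrefl)
    then show "P (enumerate Y i) (enumerate Y j) = t" using lt by (simp add: c_def min_def max_def)
  qed
qed

text \<open>Colour 0 means that \<open>R\<close> fails, 1 that only \<open>S\<close> fails, 2 that
  both hold. On a homogeneous subsequence goodness of \<open>R\<close> excludes 0 and goodness of
  \<open>S\<close> excludes 1.\<close>

lemma good_Int:
  assumes "good R Z" "good S Z"
  shows "good (R \<inter> S) Z"
  unfolding good_def
proof (intro allI impI)
  fix f :: "nat \<Rightarrow> 'a" assume f: "range f \<subseteq> Z"
  define P where "P i j = (if (f i, f j) \<notin> R then 0 else if (f i, f j) \<notin> S then 1 else 2 :: nat)" for i j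
  have P3: "P i j < 3" for i j by (simp add: P_def)
  obtain t and g :: "nat \<Rightarrow> nat" where g: "strict_mono g" "\<And>i j. i < j \<Longrightarrow> P (g i) (g j) = t"
    by (rule homogeneous_sequence[of P 3, OF P3]) (rule that)
  have r: "range (f \<circ> g) \<subseteq> Z" using f by auto
  obtain i j where 1: "i < j" "(f (g i), f (g j)) \<in> R" using goodD[OF assms(1) r] by auto
  obtain i' j' where 2: "i' < j'" "(f (g i'), f (g j')) \<in> S" using goodD[OF assms(2) r] by auto
  have "t \<noteq> 0" using g(2)[OF 1(1)] 1(2) by (auto simp: P_def split: if_splits)
  moreover have "t \<noteq> 1" using g(2)[OF 2(1)] 2(2) by (auto simp: P_def split: if_splits)
  ultimately have "(f (g i), f (g j)) \<in> R \<inter> S" using g(2)[OF 1(1)] by (auto simp: P_def split: if_splits)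
  moreover have "g i < g j" using g(1) 1(1) by (simp add: strict_mono_less)
  ultimately show "\<exists>i j. i < j \<and> (f i, f j) \<in> R \<inter> S" by blast
qed

lemma well_po_Int: "well_po R Z \<Longrightarrow> well_po S Z \<Longrightarrow> well_po (R \<inter> S) Z"
  by (rule well_poI) (auto intro: good_Int well_poD(1) dest: well_poD(2-))

text \<open>By Ramsey's theorem a bad sequence has a subsequence that either descends strictly or is
  an infinite antichain.\<close>

lemma well_po_if_wpo_on:
  assumes "wpo_on X R"
  shows "well_po R X"
proof -
  have po: "refl_on X R" "trans R" "antisym R" "wf (R - Id)"
    and anti: "\<And>A. A \<subseteq> X \<Longrightarrow> (\<forall>x\<in>A. \<forall>y\<in>A. (x, y) \<in> R \<longrightarrow> x = y) \<Longrightarrow> finite A"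
    using assms partial_order_onD[of X R] unfolding wpo_on_def by simp_all
  have "good R X"
    unfolding good_def
  proof (intro allI impI, rule ccontr)
    fix f :: "nat \<Rightarrow> 'a"
    assume f: "range f \<subseteq> X" and "\<not> (\<exists>i j. i < j \<and> (f i, f j) \<in> R)"
    then have bad: "\<And>i j. i < j \<Longrightarrow> (f i, f j) \<notin> R" by blast
    define P where "P i j = (if (f j, f i) \<in> R then 0 else 1 :: nat)" for i j
    have P2: "P i j < 2" for i j by (simp add: P_def)
    obtain t and g :: "nat \<Rightarrow> nat" where g: "t < 2" "strict_mono g" "\<And>i j. i < j \<Longrightarrow> P (g i) (g j) = t"
      by (rule homogeneous_sequence[of P 2, OF P2]) (rule that)
    have bad': "(f (g i), f (g j)) \<notin> R" if "i < j" for i j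
      using bad strict_mono_less[OF g(2)] that by blast
    have refl: "(f i, f i) \<in> R" for i using po(1) f by (auto simp: refl_on_def)
    have neq: "f (g i) \<noteq> f (g j)" if "i < j" for i j using bad'[OF that] refl by metis
    show False
    proof (cases "t = 0")
      case True
      then have "(f (g (Suc i)), f (g i)) \<in> R" for i
        using g(3)[of i "Suc i"] by (auto simp: P_def split: if_splits)
      then have "(f (g (Suc i)), f (g i)) \<in> R - Id" for i using neq[of i "Suc i"] by auto
      then have "\<exists>h. \<forall>i. (h (Suc i), h i) \<in> R - Id" by (intro exI[of _ "f \<circ> g"]) simp
      then show False using po(4) unfolding wf_iff_no_infinite_down_chain by blast
    next
      case False
      then have inc: "(f (g j), f (g i)) \<notin> R" if "i < j" for i j
        using g(3)[OF that] g(1) by (auto simp: P_def split: if_splits)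
      have inj: "inj (f \<circ> g)"
        by (rule injI) (metis comp_apply neq linorder_neqE_nat)
      have "finite (range (f \<circ> g))"
      proof (rule anti)
        show "range (f \<circ> g) \<subseteq> X" using f by auto
        have "f (g i) = f (g j)" if "(f (g i), f (g j)) \<in> R" for i j
          using that bad'[of i j] inc[of j i] by (cases i j rule: linorder_cases) auto
        then show "\<forall>x\<in>range (f \<circ> g). \<forall>y\<in>range (f \<circ> g). (x, y) \<in> R \<longrightarrow> x = y" by auto
      qed
      then show False using inj finite_imageD infinite_UNIV_nat by blast
    qed
  qed
  then show ?thesis
    by (rule well_poI) (use po in \<open>auto simp: refl_on_def dest: transD antisymD\<close>)
qed

context infinite_type
begin

section \<open>The length as a rank\<close>

lemma lenle_mono: "lenle R Z a \<Longrightarrow> a \<le> b \<Longrightarrow> lenle R Z b" for a b :: "'a ordinal"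
  by (subst lenle.simps, subst (asm) lenle.simps) (meson less_le_trans)

lemma lenle_subset: "lenle R Z a \<Longrightarrow> W \<subseteq> Z \<Longrightarrow> lenle R W a" for a :: "'a ordinal"
proof (induction arbitrary: W rule: lenle.induct)
  case (lenleI Z a)
  show ?case
    by (rule lenle.lenleI) (use lenleI resid_mono[of W Z R] in blast)
qed

lemma ex_lenle:
  fixes Z :: "'b set"
  assumes "good R Z" "small T Z"
  shows "\<exists>a :: 'a ordinal. lenle R Z a"
proof -
  have "\<exists>a :: 'a ordinal. lenle R W a" if "W \<subseteq> Z" for W
    using assms(1) that
  proof (induction W rule: resid_induct)
    case (1 W)
    then obtain h :: "'b \<Rightarrow> 'a ordinal" where h: "\<And>x. x \<in> W \<Longrightarrow> lenle R (resid R W x) (h x)" by metis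
    have "small T (h ` W)"
      by (intro small_image small_subset[OF 1(1) assms(2)])
    then obtain b where "\<And>x. x \<in> h ` W \<Longrightarrow> x < b" using small_bounded by blast
    then have "lenle R W b" using h by (intro lenle.lenleI ballI) (metis imageI)
    then show ?case by blast
  qed
  then show ?thesis by blast
qed

lemma lenle_iff:
  fixes a :: "'a ordinal"
  assumes "good R Z" "small T Z"
  shows "lenle R Z a \<longleftrightarrow> ol R Z \<le> a"
proof -
  have "lenle R Z (ol R Z :: 'a ordinal)"
    unfolding ol_def by (rule LeastI_ex) (rule ex_lenle[OF assms])
  then show ?thesis using lenle_mono by (auto simp: ol_def intro: Least_le)
qed

lemma ol_mono:
  assumes "good R Z" "small T Z" "W \<subseteq> Z"
  shows "ol R W \<le> (ol R Z :: 'a ordinal)"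
  using lenle_iff[OF assms(1,2)] lenle_iff[OF good_subset[OF assms(1,3)] small_subset[OF assms(3,2)]]
    lenle_subset[OF _ assms(3)] by blast

lemma ol_resid_less:
  assumes "good R Z" "small T Z" "x \<in> Z"
  shows "ol R (resid R Z x) < (ol R Z :: 'a ordinal)"
proof -
  have "lenle R Z (ol R Z :: 'a ordinal)" using lenle_iff[OF assms(1,2)] by blast
  then obtain b where "b < (ol R Z :: 'a ordinal)" "lenle R (resid R Z x) b"
    using assms(3) by (auto elim: lenle.cases)
  then show ?thesis
    using lenle_iff[OF good_subset[OF assms(1) resid_subset] small_subset[OF resid_subset assms(2)]]
    by (meson le_less_trans)
qed

lemma ol_leI:
  fixes c :: "'a ordinal"
  assumes "good R Z" "small T Z" "\<And>x. x \<in> Z \<Longrightarrow> ol R (resid R Z x) < c"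
  shows "ol R Z \<le> c"
proof -
  have "lenle R (resid R Z x) (ol R (resid R Z x) :: 'a ordinal)" for x
    using lenle_iff[OF good_subset[OF assms(1) resid_subset] small_subset[OF resid_subset assms(2)]] by blast
  then have "lenle R Z c" using assms(3) by (intro lenle.lenleI) blast
  then show ?thesis using lenle_iff[OF assms(1,2)] by blast
qed

text \<open>A residual at a point of one part lowers the bound of that part and does not raise the
  other, and the Hessenberg sum is strictly increasing in each argument.\<close>

lemma lenle_Un: "lenle R A a \<Longrightarrow> lenle R B b \<Longrightarrow> lenle R (A \<union> B) (hsum a b)" for a b :: "'a ordinal"
proof (induction arbitrary: B b rule: lenle.induct)
  case (lenleI A a)
  note A = lenleI.IH
  show ?case using lenleI.prems
  proof (induction rule: lenle.induct)
    case (lenleI B b)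
    have B: "lenle R B b" by (rule lenle.lenleI) (use lenleI in blast)
    have "\<exists>c<hsum a b. lenle R (resid R (A \<union> B) x) c" if "x \<in> A \<union> B" for x
    proof (cases "x \<in> A")
      case True
      then obtain a' where "a' < a" "lenle R (resid R A x \<union> resid R B x) (hsum a' b)"
        using A lenle_subset[OF B resid_subset] by blast
      then show ?thesis unfolding resid_Un using hsum_less_left by blast
    next
      case False
      then obtain b' where "b' < b" "lenle R (A \<union> resid R B x) (hsum a b')"
        using \<open>x \<in> A \<union> B\<close> lenleI by (metis UnE)
      then have "lenle R (resid R A x \<union> resid R B x) (hsum a b')"
        using lenle_subset resid_subset[of R A x] by (metis Un_mono order.refl)
      then show ?thesis unfolding resid_Un using \<open>b' < b\<close> hsum_less_right by blast
    qed
    then show ?case by (intro lenle.lenleI) blast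
  qed
qed

lemma ol_Un:
  assumes "good R Z" "small T Z" "A \<subseteq> Z" "B \<subseteq> Z"
  shows "ol R (A \<union> B) \<le> hsum (ol R A) (ol R B :: 'a ordinal)"
proof -
  have "lenle R W (ol R W :: 'a ordinal)" if "W \<subseteq> Z" for W
    using lenle_iff[OF good_subset[OF assms(1) that] small_subset[OF that assms(2)]] by blast
  then have "lenle R (A \<union> B) (hsum (ol R A) (ol R B :: 'a ordinal))"
    by (intro lenle_Un) (use assms in auto)
  moreover have "A \<union> B \<subseteq> Z" using assms by simp
  ultimately show ?thesis
    using lenle_iff[OF good_subset[OF assms(1)] small_subset[OF _ assms(2)]] by blast
qed

text \<open>In an extension of type beyond \<open>a\<close>, the points before the point
  \<open>x\<close> of rank \<open>a\<close> are not above \<open>x\<close>. So they lie in the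
  residual of \<open>x\<close>, whose bound is less than \<open>a\<close>, although their type is
  \<open>a\<close>.\<close>

lemma lext_le_lenle: "lenle R Z a \<Longrightarrow> W \<subseteq> Z \<Longrightarrow> lext R W t \<Longrightarrow> t \<le> a" for a t :: "'a ordinal"
proof (induction arbitrary: W t rule: lenle.induct)
  case (lenleI Z a)
  show ?case
  proof (rule ccontr)
    assume "\<not> t \<le> a"
    then have at: "a < t" by simp
    obtain f where f: "bij_betw f W {..<t}" "\<forall>x\<in>W. \<forall>y\<in>W. (x, y) \<in> R \<longrightarrow> f x \<le> f y"
      using lenleI by (auto simp: lext_def)
    then obtain x where x: "x \<in> W" "f x = a"
      using at by (metis bij_betw_imp_surj_on imageE lessThan_iff)
    have "x \<in> Z" using x lenleI.prems by blast
    then obtain b where b: "b < a" "\<And>V s. V \<subseteq> resid R Z x \<Longrightarrow> lext R V s \<Longrightarrow> s \<le> b"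
      using lenleI.IH by meson
    let ?V = "{y \<in> W. f y < a}"
    have "f ` ?V = {..<a}"
    proof (intro equalityI subsetI)
      fix z assume "z \<in> {..<a}"
      then have "z \<in> f ` W" using f(1) at by (auto simp: bij_betw_def)
      then show "z \<in> f ` ?V" using \<open>z \<in> {..<a}\<close> by auto
    qed auto
    moreover have "inj_on f ?V" using f(1) by (auto simp: bij_betw_def inj_on_def)
    ultimately have "lext R ?V a" using f(2) unfolding lext_def bij_betw_def by blast
    moreover have "?V \<subseteq> resid R Z x" using x f(2) lenleI.prems(1) by (force simp: resid_def)
    ultimately have "a \<le> b" using b by blast
    then show False using b by simp
  qed
qed

lemma lext_le_ol:
  fixes t :: "'a ordinal"
  assumes "good R Z" "small T Z" "lext R Z t"
  shows "t \<le> ol R Z"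
  using lext_le_lenle[OF _ order.refl assms(3)] lenle_iff[OF assms(1,2)] by blast

lemma lext_combine:
  fixes s t :: "'a ordinal"
  assumes "lext R A s" "lext R B t" "A \<inter> B = {}" and no: "\<And>x y. x \<in> B \<Longrightarrow> y \<in> A \<Longrightarrow> (x, y) \<notin> R"
  shows "lext R (A \<union> B) (s + t)"
proof -
  obtain f where f: "bij_betw f A {..<s}" "\<forall>x\<in>A. \<forall>y\<in>A. (x, y) \<in> R \<longrightarrow> f x \<le> f y"
    using assms by (auto simp: lext_def)
  obtain g where g: "bij_betw g B {..<t}" "\<forall>x\<in>B. \<forall>y\<in>B. (x, y) \<in> R \<longrightarrow> g x \<le> g y"
    using assms by (auto simp: lext_def)
  define h where "h x = (if x \<in> A then f x else s + g x)" for x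
  have hB: "h x = s + g x" if "x \<in> B" for x using that assms(3) by (auto simp: h_def)
  have "bij_betw h (A \<union> B) {..<s + t}"
    by (rule bij_betw_plus_combine[OF f(1) g(1) assms(3)], simp add: h_def, simp add: hB)
  moreover have "h x \<le> h y" if "x \<in> A \<union> B" "y \<in> A \<union> B" "(x, y) \<in> R" for x y
  proof (cases "x \<in> A")
    case True
    then have "h x < s" using f(1) by (auto simp: h_def bij_betw_def)
    then show ?thesis using True that f(2) le_plus[of s "g y"] by (auto simp: h_def intro: order.trans less_imp_le)
  next
    case False
    then have "x \<in> B" "y \<in> B" using that no by auto
    then show ?thesis using g(2) that by (simp add: hB)
  qed
  ultimately show ?thesis unfolding lext_def by metis
qed

text \<open>The second conclusion transfers lower bounds: a part on which the key has type
  \<open>s\<close> embeds into the extension.\<close>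

lemma lextI:
  fixes k :: "'b \<Rightarrow> 'c :: wellorder"
  assumes "inj_on k Z" "\<And>x y. x \<in> Z \<Longrightarrow> y \<in> Z \<Longrightarrow> (x, y) \<in> R \<Longrightarrow> k x \<le> k y" "small T Z"
  obtains t :: "'a ordinal" where "lext R Z t"
    "\<And>W s h. W \<subseteq> Z \<Longrightarrow> bij_betw h W {..<s} \<Longrightarrow> (\<And>x y. x \<in> W \<Longrightarrow> y \<in> W \<Longrightarrow> h x \<le> h y \<longleftrightarrow> k x \<le> k y) \<Longrightarrow> s \<le> t"
proof -
  obtain t :: "'a ordinal" and g where g: "bij_betw g Z {..<t}"
    "\<And>x y. x \<in> Z \<Longrightarrow> y \<in> Z \<Longrightarrow> g x \<le> g y \<longleftrightarrow> k x \<le> k y"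
    using collapse[OF assms(1,3)] by metis
  show thesis
  proof
    show "lext R Z t" unfolding lext_def using g assms(2) by blast
    fix W and s :: "'a ordinal" and h :: "'b \<Rightarrow> 'a ordinal"
    assume W: "W \<subseteq> Z" and h: "bij_betw h W {..<s}"
      and iff: "\<And>x y. x \<in> W \<Longrightarrow> y \<in> W \<Longrightarrow> h x \<le> h y \<longleftrightarrow> k x \<le> k y"
    have inv: "inv_into W h x \<in> W" "h (inv_into W h x) = x" if "x < s" for x
      using h that by (auto simp: bij_betw_def inv_into_into f_inv_into_f)
    show "s \<le> t"
    proof (rule strict_mono_on_ordinal_le[of s "g \<circ> inv_into W h"])
      fix x y assume "x < y" "y < s"
      then show "(g \<circ> inv_into W h) x < (g \<circ> inv_into W h) y"
      proof -
        have "x < s" using \<open>x < y\<close> \<open>y < s\<close> by simp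
        note x = inv[OF this] and y = inv[OF \<open>y < s\<close>]
        have "inv_into W h x \<in> Z" "inv_into W h y \<in> Z" using x y W by auto
        then show ?thesis
          using x y iff[OF y(1) x(1)] g(2)[of "inv_into W h y" "inv_into W h x"] \<open>x < y\<close>
          by (simp add: not_le[symmetric])
      qed
    next
      fix x assume "x < s"
      then show "(g \<circ> inv_into W h) x < t" using inv[of x] W g(1) by (auto simp: bij_betw_def)
    qed
  qed
qed

text \<open>Each fibre of \<open>c\<close> is ordered by its own extension, and the fibres follow
  one another. The bound by single fibres is weaker than the sum of their types, but enough when the
  \<open>t i\<close> are unbounded in the target.\<close>

lemma lext_lexicographic:
  fixes c :: "'b \<Rightarrow> 'c :: wellorder" and t :: "'c \<Rightarrow> 'a ordinal"
  assumes small: "small T Z"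
    and mono: "\<And>x y. x \<in> Z \<Longrightarrow> y \<in> Z \<Longrightarrow> (x, y) \<in> R \<Longrightarrow> c x \<le> c y"
    and fib: "\<And>i. i \<in> c ` Z \<Longrightarrow> lext R {x \<in> Z. c x = i} (t i)"
  obtains S :: "'a ordinal" where "lext R Z S" "\<And>i. i \<in> c ` Z \<Longrightarrow> t i \<le> S"
proof -
  define F where "F i = {x \<in> Z. c x = i}" for i
  have "\<forall>i\<in>c ` Z. \<exists>f. bij_betw f (F i) {..<t i} \<and> (\<forall>x\<in>F i. \<forall>y\<in>F i. (x, y) \<in> R \<longrightarrow> f x \<le> f y)"
    using fib unfolding lext_def F_def by blast
  from bchoice[OF this] obtain f where f0: "\<forall>i\<in>c ` Z. bij_betw (f i) (F i) {..<t i} \<and>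
    (\<forall>x\<in>F i. \<forall>y\<in>F i. (x, y) \<in> R \<longrightarrow> f i x \<le> f i y)" by blast
  have f: "bij_betw (f i) (F i) {..<t i}" "x \<in> F i \<Longrightarrow> y \<in> F i \<Longrightarrow> (x, y) \<in> R \<Longrightarrow> f i x \<le> f i y"
    if "i \<in> c ` Z" for i x y
    using bspec[OF f0 that] by simp_all
  define k where "k x = (c x, f (c x) x)" for x
  have inj: "inj_on k Z"
  proof (rule inj_onI)
    fix x y assume "x \<in> Z" "y \<in> Z" "k x = k y"
    then have "c x = c y" "f (c x) x = f (c x) y" by (auto simp: k_def)
    then show "x = y" using f(1)[of "c x"] \<open>x \<in> Z\<close> \<open>y \<in> Z\<close> by (auto simp: F_def bij_betw_def inj_on_def)
  qed
  have "k x \<le> k y" if "x \<in> Z" "y \<in> Z" "(x, y) \<in> R" for x y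
    using mono[OF that] f(2)[of "c x" x y] that by (cases "c x = c y") (auto simp: k_def F_def)
  then obtain S :: "'a ordinal" where S: "lext R Z S"
    "\<And>W s h. W \<subseteq> Z \<Longrightarrow> bij_betw h W {..<s} \<Longrightarrow> (\<And>x y. x \<in> W \<Longrightarrow> y \<in> W \<Longrightarrow> h x \<le> h y \<longleftrightarrow> k x \<le> k y) \<Longrightarrow> s \<le> S"
    using lextI[OF inj _ small] by metis
  show thesis
  proof
    show "lext R Z S" by fact
    fix i assume "i \<in> c ` Z"
    show "t i \<le> S"
      by (rule S(2)[OF _ f(1)[OF \<open>i \<in> c ` Z\<close>]]) (auto simp: k_def F_def)
  qed
qed

lemma ex_injection:
  fixes Z :: "'b set"
  assumes "small T Z"
  obtains e :: "'b \<Rightarrow> 'a ordinal" where "inj_on e Z"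
proof -
  obtain a :: "'a ordinal" and f where "bij_betw f (Field |Z| ) {..<a}"
    using ex_rank[of "|Z|"] assms card_of_Well_order[of Z] by (metis Field_card_of)
  then show thesis using that by (auto simp: bij_betw_def Field_card_of)
qed

text \<open>By transitivity the residual of \<open>x\<close> lies in that of \<open>y\<close>. It
  even lies in a residual of it, since antisymmetry puts \<open>x\<close> itself into the residual
  of \<open>y\<close>.\<close>

lemma ol_resid_strict_mono:
  assumes Z: "well_po R Z" "small T Z" and xy: "x \<in> Z" "y \<in> Z" "(x, y) \<in> R" "x \<noteq> y"
  shows "ol R (resid R Z x) < (ol R (resid R Z y) :: 'a ordinal)"
proof -
  have g: "good R (resid R Z y)" "small T (resid R Z y)"
    using good_subset[OF well_poD(1)[OF Z(1)] resid_subset] small_subset[OF resid_subset Z(2)] .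
  have "resid R Z x \<subseteq> resid R (resid R Z y) x"
  proof
    fix z assume z: "z \<in> resid R Z x"
    then show "z \<in> resid R (resid R Z y) x"
      using well_poD(3)[OF Z(1), of x y z] xy by (auto simp: resid_def)
  qed
  then have "ol R (resid R Z x) \<le> (ol R (resid R (resid R Z y) x) :: 'a ordinal)"
    by (intro ol_mono good_subset[OF g(1) resid_subset] small_subset[OF resid_subset g(2)])
  also have "\<dots> < ol R (resid R Z y)"
    by (rule ol_resid_less[OF g]) (use xy well_poD(4)[OF Z(1), of x y] in \<open>auto simp: resid_def\<close>)
  finally show ?thesis .
qed

text \<open>Points are sorted by the length of their residual, which is strictly monotone, with ties
  broken by an injection.\<close>

lemma ex_lext:
  assumes Z: "well_po R Z" "small T Z"
  obtains t :: "'a ordinal" where "lext R Z t"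
proof -
  obtain e :: "'b \<Rightarrow> 'a ordinal" where e: "inj_on e Z" using ex_injection[OF Z(2)] by blast
  define k where "k x = (ol R (resid R Z x) :: 'a ordinal, e x)" for x
  have "inj_on k Z" using e by (auto simp: inj_on_def k_def)
  moreover have "k x \<le> k y" if "x \<in> Z" "y \<in> Z" "(x, y) \<in> R" for x y
    using ol_resid_strict_mono[OF Z that] by (cases "x = y") (auto simp: k_def)
  ultimately show thesis using lextI[OF _ _ Z(2)] that by metis
qed

lemma lext_eqpoll: "lext R Z t \<Longrightarrow> Z \<approx> {..<t}"
  by (auto simp: lext_def eqpoll_def)

end

section \<open>Maximal linear extensions\<close>

text \<open>Selects points spaced by the jumps \<open>k\<close>. Membership depends on all smaller
  members, hence the well-founded recursion; admitting every point that qualifies is what will keep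
  the selection cofinal.\<close>

function greedy :: "('c :: wellorder \<Rightarrow> 'c) \<Rightarrow> ('c \<Rightarrow> bool) \<Rightarrow> 'c \<Rightarrow> bool" where
  "greedy k Q x \<longleftrightarrow> Q x \<and> (\<forall>y<x. greedy k Q y \<longrightarrow> k y \<le> x)"
  by auto
termination
  by (relation "inv_image {(x, y). x < y} (\<lambda>(k, Q, x). x)") (auto simp: wf)

declare greedy.simps [simp del]

context infinite_type
begin

text \<open>If \<open>a\<close> is below \<open>osum K\<close>, the Hessenberg sum is below
  \<open>osum K + b\<close>. Otherwise \<open>a\<close> is \<open>osum K + d\<close> with
  \<open>d\<close> below \<open>omega_pow m\<close>, and \<open>b\<close> only joins the tail
  \<open>d\<close>.\<close>

lemma hsum_less_tail:
  fixes a b c :: "'a ordinal"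
  assumes K: "\<And>x. x \<in># K \<Longrightarrow> m \<le> x" and a: "a < osum K + omega_pow m" and b: "b < omega_pow m"
  shows "hsum a b < osum K + omega_pow m"
proof -
  have bm: "y < m" if "y \<in># exps b" for y using b that by (auto simp: less_omega_pow_iff)
  consider "a < osum K" | d where "d < omega_pow m" "a = osum K + d"
    using a by (auto simp: less_plus_iff)
  then show ?thesis
  proof cases
    case 1
    then have "hsum a b < hsum (osum K) b" by (rule hsum_less_left)
    also have "\<dots> = osum K + b"
      by (rule hsum_eq_plus) (use K bm in force)
    also have "\<dots> < osum K + omega_pow m" using b by simp
    finally show ?thesis .
  next
    case 2
    have "y < m" if "y \<in># exps d" for y using 2 that by (auto simp: less_omega_pow_iff)
    then have "a = osum (K + exps d)" using K 2 by (subst osum_append) force+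
    then have "hsum a b = osum (K + (exps d + exps b))" by (simp add: hsum_eq ac_simps)
    also have "\<dots> = osum K + hsum d b"
      using K 2 bm by (subst osum_append) (force simp: less_omega_pow_iff hsum_eq)+
    also have "\<dots> < osum K + omega_pow m" using 2 b by (simp add: hsum_less_omega_pow)
    finally show ?thesis .
  qed
qed

text \<open>The points above \<open>x\<close> form a nonempty final segment, which is stacked on the
  extension of the residual.\<close>

lemma lext_successor_case:
  assumes X: "well_po R X" "small T X"
    and x: "x \<in> X" and t: "lext R (resid R X x) (t :: 'a ordinal)"
  obtains s where "lext R X s" "t + 1 \<le> s"
proof -
  let ?U = "{y \<in> X. (x, y) \<in> R}"
  have U: "?U \<subseteq> X" by auto
  obtain u :: "'a ordinal" where u: "lext R ?U u"
    using ex_lext[OF well_po_subset[OF X(1) U] small_subset[OF U X(2)]] .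
  have "x \<in> ?U" using x well_poD(2)[OF X(1) x] by simp
  then have "u \<noteq> 0" using u by (auto simp: lext_def bij_betw_def)
  then have "1 \<le> u" by (simp flip: not_less)
  have "lext R (resid R X x \<union> ?U) (t + u)"
  proof (rule lext_combine[OF t u])
    show "(y, z) \<notin> R" if "y \<in> ?U" "z \<in> resid R X x" for y z
      using that well_poD(3)[OF X(1) x, of y z] by (auto simp: resid_def)
  qed (auto simp: resid_def)
  moreover have "resid R X x \<union> ?U = X" by (auto simp: resid_def)
  ultimately show thesis using that[of "t + u"] \<open>1 \<le> u\<close> by simp
qed

text \<open>
  An increasing chain of initial segments \<open>I \<theta>\<close>, whose lengths are unbounded in the length of \<open>X\<close>,
  is cut along a greedily chosen set \<open>C\<close> of indices into consecutive differences. The lengths of these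
  are still unbounded in the last Cantor normal form term \<open>\<omega>\<^sup>m\<close>, so it suffices to stack them on the
  first segment.
\<close>

lemma lext_limit_case:
  assumes X: "well_po R X" "small T X"
    and IH: "\<And>x W. x \<in> X \<Longrightarrow> W \<subseteq> resid R X x \<Longrightarrow> lext R W (ol R W :: 'a ordinal)"
    and ne: "X \<noteq> {}"
    and limit: "\<And>x. x \<in> X \<Longrightarrow> ol R (resid R X x) + 1 < (ol R X :: 'a ordinal)"
  obtains s where "lext R X s" "(ol R X :: 'a ordinal) \<le> s"
proof -
  have gX: "good R X" by (rule well_poD(1)[OF X(1)])
  have gsub: "good R W" "small T W" if "W \<subseteq> X" for W
    using good_subset[OF gX that] small_subset[OF that X(2)] .
  define L where "L = (ol R X :: 'a ordinal)"
  define \<rho> where "\<rho> x = (ol R (resid R X x) :: 'a ordinal)" for x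
  have \<rho>_less: "\<rho> x < L" if "x \<in> X" for x
    using limit[OF that] less_plus_one_iff[of "\<rho> x" "\<rho> x"] unfolding \<rho>_def L_def by (meson less_trans order.refl)
  have unb: "\<exists>x\<in>X. \<tau> \<le> \<rho> x" if "\<tau> < L" for \<tau>
  proof (rule ccontr)
    assume "\<not> ?thesis"
    then have "ol R X \<le> \<tau>" by (intro ol_leI gX X(2)) (auto simp: \<rho>_def not_le)
    then show False using that by (simp add: L_def)
  qed
  have lim: "\<tau> + 1 < L" if \<tau>: "\<tau> < L" for \<tau>
  proof -
    obtain x where "x \<in> X" "\<tau> \<le> \<rho> x" using unb[OF \<tau>] by blast
    then have "\<tau> + 1 \<le> \<rho> x + 1" by (intro plus_mono_left)
    also have "\<dots> < L" using limit \<open>x \<in> X\<close> by (simp add: \<rho>_def L_def)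
    finally show ?thesis .
  qed
  define unbounded where "unbounded J \<longleftrightarrow> (\<forall>\<tau><L. \<exists>x\<in>J. \<tau> \<le> \<rho> x)" for J
  \<comment> \<open>A cofinal set of points is replaced by a residual as long as some residual
    remains cofinal. In the resulting \<open>J\<close> each \<open>x\<close> lies below every
    \<open>y\<close> in \<open>J\<close> with \<rho> large enough; \<open>b x\<close> will be such a
    threshold.\<close>
  have "unbounded J \<longrightarrow> (\<exists>J'\<subseteq>J. unbounded J' \<and> (\<forall>x\<in>J'. \<not> unbounded (resid R J' x)))" if "J \<subseteq> X" for J
    using gX that
  proof (induction J rule: resid_induct)
    case (1 J)
    show ?case
    proof (cases "\<exists>x\<in>J. unbounded (resid R J x)")
      case True
      then obtain x where x: "x \<in> J" "unbounded (resid R J x)" by blast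
      then obtain J' where "J' \<subseteq> resid R J x" "unbounded J'" "\<forall>x\<in>J'. \<not> unbounded (resid R J' x)"
        using 1(2)[OF x(1)] by blast
      then show ?thesis using resid_subset[of R J x] by (meson order.trans)
    qed auto
  qed
  moreover have "unbounded X" using unb by (simp add: unbounded_def)
  ultimately obtain J where J: "J \<subseteq> X" "unbounded J" "\<And>x. x \<in> J \<Longrightarrow> \<not> unbounded (resid R J x)"
    by (metis order.refl)
  have "\<forall>x\<in>J. \<exists>b. b < L \<and> (\<forall>y\<in>J. (x, y) \<notin> R \<longrightarrow> \<rho> y < b)"
  proof
    fix x assume "x \<in> J"
    then obtain \<tau> where "\<tau> < L" "\<forall>y\<in>resid R J x. \<not> \<tau> \<le> \<rho> y" using J(3) unfolding unbounded_def by blast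
    then show "\<exists>b. b < L \<and> (\<forall>y\<in>J. (x, y) \<notin> R \<longrightarrow> \<rho> y < b)" by (auto simp: resid_def not_le)
  qed
  from bchoice[OF this] obtain b where b0: "\<forall>x\<in>J. b x < L \<and> (\<forall>y\<in>J. (x, y) \<notin> R \<longrightarrow> \<rho> y < b x)" by blast
  have b: "b x < L" "y \<in> J \<Longrightarrow> (x, y) \<notin> R \<Longrightarrow> \<rho> y < b x" if "x \<in> J" for x y
    using bspec[OF b0 that] by auto
  \<comment> \<open>For \<open>\<theta> < L\<close> these residuals all lie in the residual of a
    single \<open>w\<close> in \<open>J\<close> with \<open>\<theta> \<le> \<rho> w\<close>. This
    keeps the induction hypothesis available for \<open>I \<theta>\<close> and its subsets.\<close>
  define I where "I \<theta> = (\<Union>y\<in>{y \<in> J. b y \<le> \<theta>}. resid R X y)" for \<theta>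
  have I_X: "I \<theta> \<subseteq> X" for \<theta> unfolding I_def by (intro UN_least resid_subset)
  have I_mono: "I \<theta> \<subseteq> I \<theta>'" if "\<theta> \<le> \<theta>'" for \<theta> \<theta>'     unfolding I_def using that by (intro UN_mono) auto
  have I_init: "z' \<in> I \<theta>" if z: "z \<in> I \<theta>" "(z', z) \<in> R" "z' \<in> X" for z z' \<theta>
  proof -
    obtain y where y: "y \<in> J" "b y \<le> \<theta>" "z \<in> X" "(y, z) \<notin> R" using z(1) by (auto simp: I_def resid_def)
    then have "(y, z') \<notin> R" using well_poD(3)[OF X(1), of y z' z] z J(1) by blast
    then show ?thesis using y z(3) by (auto simp: I_def resid_def)
  qed
  have I_sub: "\<exists>w\<in>X. I \<theta> \<subseteq> resid R X w" if \<theta>: "\<theta> < L" for \<theta>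
  proof -
    obtain w where w: "w \<in> J" "\<theta> \<le> \<rho> w" using J(2) \<theta> unfolding unbounded_def by blast
    have "resid R X y \<subseteq> resid R X w" if y: "y \<in> J" "b y \<le> \<theta>" for y
    proof -
      have "(y, w) \<in> R" using b(2)[OF y(1) w(1)] w(2) y(2) by (meson leD order.trans)
      then show ?thesis
        using well_poD(3)[OF X(1), of y w] y w J(1) by (auto simp: resid_def)
    qed
    then have "I \<theta> \<subseteq> resid R X w" by (auto simp: I_def)
    then show ?thesis using w J(1) by blast
  qed
  have I_lext: "lext R W (ol R W :: 'a ordinal)" if "\<theta> < L" "W \<subseteq> I \<theta>" for \<theta> W
    using I_sub[OF that(1)] IH that(2) by (meson order.trans)
  have I_less: "ol R (I \<theta>) < L" if \<theta>: "\<theta> < L" for \<theta>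
  proof -
    obtain w where w: "w \<in> X" "I \<theta> \<subseteq> resid R X w" using I_sub[OF \<theta>] by blast
    then have "ol R (I \<theta>) \<le> \<rho> w" unfolding \<rho>_def by (intro ol_mono gsub resid_subset)
    then show ?thesis using \<rho>_less[OF w(1)] by simp
  qed
  have I_unb: "\<exists>\<theta><L. \<forall>\<theta>'\<ge>\<theta>. \<tau> \<le> ol R (I \<theta>')" if \<tau>: "\<tau> < L" for \<tau>
  proof -
    obtain y where y: "y \<in> J" "\<tau> \<le> \<rho> y" using J(2) \<tau> unfolding unbounded_def by blast
    have "\<tau> \<le> ol R (I \<theta>')" if "b y \<le> \<theta>'" for \<theta>'
    proof -
      have "resid R X y \<subseteq> I \<theta>'" using y that by (auto simp: I_def)
      then have "\<rho> y \<le> ol R (I \<theta>')" unfolding \<rho>_def by (intro ol_mono gsub I_X)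
      then show ?thesis using y by simp
    qed
    then show ?thesis using b(1)[OF y(1)] by blast
  qed
  have "L \<noteq> 0" using ne \<rho>_less by fastforce
  then have "exps L \<noteq> {#}" using osum_exps[of L] by force
  then have minin: "Min (set_mset (exps L)) \<in># exps L" by (intro Min_in) auto
  then obtain K where K: "exps L = add_mset (Min (set_mset (exps L))) K" by (meson multi_member_split)
  \<comment> \<open>\<open>m\<close> is the least exponent of \<open>L\<close>, so \<open>L\<close>
    is \<open>\<beta> + omega_pow m\<close>, and the differences have to supply the tail
    \<open>omega_pow m\<close>.\<close>
  define m where "m = Min (set_mset (exps L))"
  have Km: "m \<le> x" if "x \<in># K" for x
  proof -
    have "x \<in># exps L" by (subst K) (use that in simp)
    then show ?thesis unfolding m_def by (intro Min_le) auto
  qed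
  define \<beta> where "\<beta> = osum K"
  have "osum (K + {#m#}) = \<beta> + omega_pow m" unfolding \<beta>_def using Km by (subst osum_append) auto
  moreover have "K + {#m#} = exps L" by (subst K) (simp add: m_def)
  ultimately have L: "L = \<beta> + omega_pow m" by simp
  \<comment> \<open>By \<open>hsum_less_tail\<close> the Hessenberg sum of
    \<open>ol R (I \<theta>)\<close> and \<tau> stays below \<open>L\<close>, so later segments
    reach it; subadditivity leaves at least \<tau> for the difference.\<close>
  have I_diff: "\<exists>k<L. \<forall>\<theta>'<L. k \<le> \<theta>' \<longrightarrow> \<tau> \<le> ol R (I \<theta>' - I \<theta>)"
    if \<theta>: "\<theta> < L" and \<tau>: "\<tau> < omega_pow m" for \<theta> \<tau>
  proof -
    have "hsum (ol R (I \<theta>)) \<tau> < L"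
      using hsum_less_tail[of K m "ol R (I \<theta>)" \<tau>] Km I_less[OF \<theta>] \<tau> by (simp add: L \<beta>_def)
    then obtain k where k: "k < L" "\<forall>\<theta>'\<ge>k. hsum (ol R (I \<theta>)) \<tau> \<le> ol R (I \<theta>')" using I_unb by blast
    have "\<tau> \<le> ol R (I \<theta>' - I \<theta>)" if "k \<le> \<theta>'" for \<theta>'
    proof (rule ccontr)
      assume "\<not> ?thesis"
      then have "hsum (ol R (I \<theta>)) (ol R (I \<theta>' - I \<theta>)) < hsum (ol R (I \<theta>)) \<tau>"
        by (intro hsum_less_right) simp
      moreover have "ol R (I \<theta>') \<le> (ol R (I \<theta> \<union> (I \<theta>' - I \<theta>)) :: 'a ordinal)"
        by (intro ol_mono gsub) (use I_X in auto)
      moreover have "\<dots> \<le> hsum (ol R (I \<theta>)) (ol R (I \<theta>' - I \<theta>))"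
        by (rule ol_Un[OF gX X(2)]) (use I_X in auto)
      ultimately show False using k(2) that by (meson leD le_less_trans order.trans)
    qed
    then show ?thesis using k(1) by blast
  qed
  obtain \<theta>1 where \<theta>1: "\<theta>1 < L" "\<forall>\<theta>'\<ge>\<theta>1. \<beta> \<le> ol R (I \<theta>')"
    using I_unb[of \<beta>] less_add_right[of "omega_pow m" \<beta>] omega_pow_facts(1)[of m] L by auto
  \<comment> \<open>From \<theta>0 on, every index has the form \<open>\<beta> + \<tau>\<close>, and
    the first segment alone supplies \<beta>.\<close>
  define \<theta>0 where "\<theta>0 = max \<beta> \<theta>1"
  have \<theta>0: "\<theta>0 < L" "\<beta> \<le> \<theta>0" "\<beta> \<le> ol R (I \<theta>0)"
    using \<theta>1 less_add_right[of "omega_pow m" \<beta>] omega_pow_facts(1)[of m] L by (auto simp: \<theta>0_def)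
  \<comment> \<open>The gain demanded after index \<open>\<beta> + \<tau>\<close> is \<tau> itself,
    so that the gains grow with the index.\<close>
  have "\<forall>\<theta>. \<exists>k. \<theta>0 \<le> \<theta> \<and> \<theta> < L \<longrightarrow>
    k < L \<and> (\<forall>\<theta>'<L. k \<le> \<theta>' \<longrightarrow> (\<forall>\<tau>. \<theta> = \<beta> + \<tau> \<longrightarrow> \<tau> \<le> ol R (I \<theta>' - I \<theta>)))"
  proof
    fix \<theta>
    show "\<exists>k. \<theta>0 \<le> \<theta> \<and> \<theta> < L \<longrightarrow>
      k < L \<and> (\<forall>\<theta>'<L. k \<le> \<theta>' \<longrightarrow> (\<forall>\<tau>. \<theta> = \<beta> + \<tau> \<longrightarrow> \<tau> \<le> ol R (I \<theta>' - I \<theta>)))"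
    proof (cases "\<theta>0 \<le> \<theta> \<and> \<theta> < L")
      case True
      then obtain \<tau> where \<tau>: "\<theta> = \<beta> + \<tau>" using ex_plus[of \<beta> \<theta>] \<theta>0(2) by (meson order.trans)
      then have "\<tau> < omega_pow m" using True L by simp
      then obtain k where "k < L" "\<forall>\<theta>'<L. k \<le> \<theta>' \<longrightarrow> \<tau> \<le> ol R (I \<theta>' - I \<theta>)"
        using I_diff True by blast
      then show ?thesis using \<tau> by auto
    qed auto
  qed
  from choice[OF this] obtain k where k0: "\<forall>\<theta>. \<theta>0 \<le> \<theta> \<and> \<theta> < L \<longrightarrow>
    k \<theta> < L \<and> (\<forall>\<theta>'<L. k \<theta> \<le> \<theta>' \<longrightarrow> (\<forall>\<tau>. \<theta> = \<beta> + \<tau> \<longrightarrow> \<tau> \<le> ol R (I \<theta>' - I \<theta>)))" by blast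
  have k: "k \<theta> < L" "\<theta>' < L \<Longrightarrow> k \<theta> \<le> \<theta>' \<Longrightarrow> \<theta> = \<beta> + \<tau> \<Longrightarrow> \<tau> \<le> ol R (I \<theta>' - I \<theta>)"
    if "\<theta>0 \<le> \<theta>" "\<theta> < L" for \<theta> \<theta>' \<tau>
    using mp[OF spec[OF k0, of \<theta>] conjI[OF that]] by blast+
  define C where "C = {\<theta>. greedy k (\<lambda>\<theta>. \<theta>0 \<le> \<theta> \<and> \<theta> < L) \<theta>}"
  have C_iff: "\<theta> \<in> C \<longleftrightarrow> \<theta>0 \<le> \<theta> \<and> \<theta> < L \<and> (\<forall>\<eta>\<in>C. \<eta> < \<theta> \<longrightarrow> k \<eta> \<le> \<theta>)" for \<theta>
    unfolding C_def mem_Collect_eq by (subst greedy.simps) auto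
  have C_D: "\<theta>0 \<le> \<eta>" "\<eta> < L" "\<xi> \<in> C \<Longrightarrow> \<xi> < \<eta> \<Longrightarrow> k \<xi> \<le> \<eta>" if "\<eta> \<in> C" for \<eta> \<xi>
    using iffD1[OF C_iff that] by blast+
  have \<theta>0_C: "\<theta>0 \<in> C"
  proof (rule iffD2[OF C_iff], intro conjI ballI impI)
    show "k \<eta> \<le> \<theta>0" if "\<eta> \<in> C" "\<eta> < \<theta>0" for \<eta> using C_D(1)[OF that(1)] that(2) by simp
  qed (use \<theta>0 in auto)
  have C_unb: "\<exists>\<eta>\<in>C. \<tau> \<le> \<eta>" if \<tau>: "\<tau> < L" for \<tau>
  proof (rule ccontr)
    assume "\<not> ?thesis"
    then have below: "\<eta> < \<tau>" if "\<eta> \<in> C" for \<eta> using that not_le by blast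
    \<comment> \<open>A bounded selection would admit a further point. With a last member \<mu> it
      suffices to go to \<open>k \<mu>\<close>; without one each \<open>k \<eta>\<close> is at most
      a later member, hence below \<tau>.\<close>
    have "\<exists>\<theta>. \<tau> \<le> \<theta> \<and> \<theta> < L \<and> (\<forall>\<eta>\<in>C. k \<eta> \<le> \<theta>)"
    proof (cases "\<exists>\<mu>\<in>C. \<forall>\<eta>\<in>C. \<eta> \<le> \<mu>")
      case True
      then obtain \<mu> where \<mu>: "\<mu> \<in> C" "\<And>\<eta>. \<eta> \<in> C \<Longrightarrow> \<eta> \<le> \<mu>" by blast
      have "k \<mu> < L" using k(1) C_D[OF \<mu>(1)] by blast
      moreover have "k \<eta> \<le> max \<tau> (k \<mu>)" if "\<eta> \<in> C" for \<eta>
      proof (cases "\<eta> = \<mu>")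
        case False
        then have "\<eta> < \<mu>" using \<mu>(2)[OF that] by simp
        then have "k \<eta> \<le> \<mu>" by (rule C_D(3)[OF \<mu>(1) that])
        also have "\<mu> \<le> max \<tau> (k \<mu>)" using below[OF \<mu>(1)] by (simp add: le_max_iff_disj less_imp_le)
        finally show ?thesis .
      qed simp
      ultimately show ?thesis using \<tau> by (intro exI[of _ "max \<tau> (k \<mu>)"]) auto
    next
      case False
      have "k \<eta> \<le> \<tau>" if \<eta>: "\<eta> \<in> C" for \<eta>
      proof -
        obtain \<eta>' where "\<eta>' \<in> C" "\<eta> < \<eta>'" using False \<eta> not_le by blast
        then have "k \<eta> \<le> \<eta>'" using \<eta> C_D(3) by blast
        then show ?thesis using below[OF \<open>\<eta>' \<in> C\<close>] by simp
      qed
      then show ?thesis using \<tau> by blast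
    qed
    then obtain \<theta> where \<theta>: "\<tau> \<le> \<theta>" "\<theta> < L" "\<forall>\<eta>\<in>C. k \<eta> \<le> \<theta>" by blast
    have "\<theta> \<in> C"
      by (rule iffD2[OF C_iff]) (use \<theta> below[OF \<theta>0_C] in auto)
    then show False using below \<theta>(1) by (meson leD)
  qed
  \<comment> \<open>The first selected segment that contains \<open>p\<close>; the value
    \<open>L\<close> collects the points that lie in none.\<close>
  define g where "g p = (LEAST \<eta>. \<eta> = L \<or> \<eta> \<in> C \<and> p \<in> I \<eta>)" for p
  have g: "g p = L \<or> g p \<in> C \<and> p \<in> I (g p)" for p
    unfolding g_def by (rule LeastI[of _ L]) simp
  have g_le: "g p \<le> \<eta>" if "\<eta> = L \<or> \<eta> \<in> C \<and> p \<in> I \<eta>" for p \<eta>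
    unfolding g_def using that by (rule Least_le)
  have g_mono: "g p \<le> g q" if "p \<in> X" "q \<in> X" "(p, q) \<in> R" for p q
    using g[of q] I_init[of q "g q" p] that by (intro g_le) auto
  define A where "A = I \<theta>0"
  define B where "B = X - A"
  have BX: "B \<subseteq> X" by (auto simp: B_def)
  have A: "lext R A (ol R A :: 'a ordinal)" unfolding A_def using I_lext[OF \<theta>0(1)] by blast
  \<comment> \<open>Fibres with index below \<open>L\<close> lie in some \<open>I i\<close> and have
    optimal extensions; on the last fibre any extension will do.\<close>
  have "\<exists>t. lext R {p \<in> B. g p = i} t \<and> (i < L \<longrightarrow> t = (ol R {p \<in> B. g p = i} :: 'a ordinal))" for i
  proof (cases "i < L")
    case True
    have "{p \<in> B. g p = i} \<subseteq> I i" using g True by fastforce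
    then show ?thesis using I_lext[OF True] by blast
  next
    case False
    have s: "{p \<in> B. g p = i} \<subseteq> X" using BX by auto
    obtain t :: "'a ordinal" where "lext R {p \<in> B. g p = i} t"
      using ex_lext[OF well_po_subset[OF X(1) s] small_subset[OF s X(2)]] .
    then show ?thesis using False by blast
  qed
  then have "\<forall>i. \<exists>t. lext R {p \<in> B. g p = i} t \<and> (i < L \<longrightarrow> t = (ol R {p \<in> B. g p = i} :: 'a ordinal))"
    by (rule allI)
  from choice[OF this] obtain t where t0: "\<forall>i. lext R {p \<in> B. g p = i} (t i) \<and>
    (i < L \<longrightarrow> t i = (ol R {p \<in> B. g p = i} :: 'a ordinal))" by blast
  have t: "lext R {p \<in> B. g p = i} (t i)"
    "i < L \<Longrightarrow> t i = (ol R {p \<in> B. g p = i} :: 'a ordinal)" for i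
    using spec[OF t0, of i] by simp_all
  have gB: "g p \<le> g q" if "p \<in> B" "q \<in> B" "(p, q) \<in> R" for p q
    using g_mono[of p q] that BX by blast
  obtain S where S: "lext R B S" "\<And>i. i \<in> g ` B \<Longrightarrow> t i \<le> S"
    by (rule lext_lexicographic[where c = g and t = t, OF small_subset[OF BX X(2)] gB t(1)],
        assumption, assumption, assumption, rule that)
  have "omega_pow m \<le> S"
  proof (rule ccontr)
    assume "\<not> ?thesis"
    then have "\<beta> + S < L" using L by simp
    then have S1: "\<beta> + (S + 1) < L" using lim plus_assoc by metis
    then obtain \<eta> where \<eta>: "\<eta> \<in> C" "\<beta> + (S + 1) \<le> \<eta>" using C_unb by blast
    have \<eta>': "\<theta>0 \<le> \<eta>" "\<eta> < L" using C_D[OF \<eta>(1)] by auto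
    \<comment> \<open>\<zeta> is the next selected index after \<eta>, so its fibre contains
      \<open>I \<zeta> - I \<eta>\<close>, whose length is at least \<open>S + 1\<close>.\<close>
    define \<zeta> where "\<zeta> = (LEAST \<zeta>. \<zeta> \<in> C \<and> \<eta> < \<zeta>)"
    have "\<exists>\<zeta>. \<zeta> \<in> C \<and> \<eta> < \<zeta>"
      using C_unb[OF lim[OF \<eta>'(2)]] by (metis less_plus_one_iff less_le_trans order.refl)
    from LeastI_ex[OF this] have \<zeta>: "\<zeta> \<in> C" "\<eta> < \<zeta>" by (auto simp: \<zeta>_def)
    have nxt: "\<xi> \<le> \<eta>" if "\<xi> \<in> C" "\<xi> < \<zeta>" for \<xi>
      using not_less_Least[of \<xi> "\<lambda>\<zeta>. \<zeta> \<in> C \<and> \<eta> < \<zeta>"] that by (auto simp: \<zeta>_def)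
    have \<zeta>L: "\<zeta> < L" "k \<eta> \<le> \<zeta>" using C_D[OF \<zeta>(1)] \<zeta>(2) \<eta>(1) by auto
    obtain \<tau> where \<tau>: "\<eta> = \<beta> + \<tau>" using ex_plus[of \<beta> \<eta>] \<theta>0(2) \<eta>'(1) by (meson order.trans)
    have "S + 1 \<le> \<tau>" using \<eta>(2) \<tau> by simp
    also have "\<tau> \<le> ol R (I \<zeta> - I \<eta>)" by (rule k(2)[OF \<eta>' \<zeta>L \<tau>])
    finally have D: "S + 1 \<le> ol R (I \<zeta> - I \<eta>)" .
    have sub: "I \<zeta> - I \<eta> \<subseteq> {p \<in> B. g p = \<zeta>}"
    proof
      fix p assume p: "p \<in> I \<zeta> - I \<eta>"
      have "g p \<le> \<zeta>" using p \<zeta>(1) by (intro g_le) auto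
      moreover have "\<not> g p < \<zeta>"
      proof
        assume lt: "g p < \<zeta>"
        then have "g p \<noteq> L" using \<zeta>L(1) by auto
        then have "g p \<in> C" "p \<in> I (g p)" using g[of p] by auto
        then show False using nxt[OF _ lt] I_mono p by blast
      qed
      moreover have "p \<in> B" using p I_mono[OF \<eta>'(1)] I_X by (auto simp: A_def B_def)
      ultimately show "p \<in> {p \<in> B. g p = \<zeta>}" by simp
    qed
    have "I \<zeta> - I \<eta> \<noteq> {}"
    proof
      assume "I \<zeta> - I \<eta> = {}"
      moreover have "ol R {} \<le> (0 :: 'a ordinal)" using gsub[of "{}"] by (intro ol_leI) auto
      ultimately show False using D by (metis ordinal_le_zero order.trans plus_eq_zero_iff one_neq_zero_ordinal)
    qed
    then have "\<zeta> \<in> g ` B" using sub by auto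
    then have "ol R {p \<in> B. g p = \<zeta>} \<le> S" using S(2) t(2)[OF \<zeta>L(1)] by metis
    moreover have "ol R (I \<zeta> - I \<eta>) \<le> (ol R {p \<in> B. g p = \<zeta>} :: 'a ordinal)"
      by (intro ol_mono gsub sub) (use BX in auto)
    ultimately have "S + 1 \<le> S" using D by simp
    then show False by (metis less_plus_one_iff not_le order.refl)
  qed
  have "lext R (A \<union> B) (ol R A + S)"
  proof (rule lext_combine[OF A S(1)])
    show "(x, y) \<notin> R" if "x \<in> B" "y \<in> A" for x y
      using that I_init[of y \<theta>0 x] by (auto simp: A_def B_def)
  qed (auto simp: B_def)
  moreover have "A \<union> B = X" using I_X by (auto simp: A_def B_def)
  moreover have "ol R X \<le> ol R A + S"
    unfolding L_def[symmetric] L using \<theta>0(3) \<open>omega_pow m \<le> S\<close> by (auto simp: A_def intro: plus_mono)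
  ultimately show thesis using that by metis
qed

text \<open>The theorem of de Jongh and Parikh.\<close>

theorem lext_ol:
  assumes X: "well_po R X" "small T X"
  shows "lext R X (ol R X :: 'a ordinal)"
proof -
  \<comment> \<open>All subsets are included because the limit case extends subsets of residuals,
    not only residuals.\<close>
  have "\<forall>W\<subseteq>Z. lext R W (ol R W :: 'a ordinal)" if "Z \<subseteq> X" for Z
    using well_poD(1)[OF X(1)] that
  proof (induction Z rule: resid_induct)
    case (1 Z)
    show ?case
    proof (intro allI impI)
      fix W assume W: "W \<subseteq> Z"
      have "W \<subseteq> X" using W 1(1) by simp
      note w = well_po_subset[OF X(1) this] small_subset[OF this X(2)]
      note g = well_poD(1)[OF w(1)]
      have IH: "lext R V (ol R V :: 'a ordinal)" if "x \<in> W" "V \<subseteq> resid R W x" for x V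
        using 1(2)[of x] that W resid_mono[OF W, of R x] by (meson order.trans subsetD)
      have "\<exists>s. lext R W s \<and> (ol R W :: 'a ordinal) \<le> s"
      proof (cases "W = {}")
        case True
        have "(ol R W :: 'a ordinal) \<le> 0" by (rule ol_leI[OF g w(2)]) (use True in auto)
        moreover have "lext R W 0" using True by (auto simp: lext_def bij_betw_def)
        ultimately show ?thesis by blast
      next
        case False
        show ?thesis
        proof (cases "\<forall>x\<in>W. ol R (resid R W x) + 1 < (ol R W :: 'a ordinal)")
          case True
          show ?thesis
          proof (rule lext_limit_case[OF w])
            show "W \<noteq> {}" by fact
          qed (use IH True in blast)+
        next
          case nlim: False
          \<comment> \<open>Some residual is at most one short of \<open>W\<close>, so one more
            point on top suffices.\<close>
          then obtain x where x: "x \<in> W" "(ol R W :: 'a ordinal) \<le> ol R (resid R W x) + 1" by (auto simp: not_less)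
          obtain s where "lext R W s" "ol R (resid R W x) + 1 \<le> (s :: 'a ordinal)"
            using lext_successor_case[OF w x(1) IH[OF x(1) order.refl]] .
          then show ?thesis using x(2) by (meson order.trans)
        qed
      qed
      then obtain s where s: "lext R W s" "(ol R W :: 'a ordinal) \<le> s" by blast
      moreover have "s \<le> ol R W" by (rule lext_le_ol[OF g w(2) s(1)])
      ultimately show "lext R W (ol R W :: 'a ordinal)" by (metis order.antisym)
    qed
  qed
  then show ?thesis by blast
qed

end

section \<open>The upper bound\<close>

lemma lepoll_iff_ordLeq: "A \<lesssim> B \<longleftrightarrow> |A| \<le>o |B|"
  unfolding lepoll_def card_of_ordLeq[symmetric] by blast

lemma ord_card_eqpoll: "{..<ord_card a} \<approx> {..<a}" for a :: "'a ordinal"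
  unfolding ord_card_def by (rule LeastI[of "\<lambda>b. {..<b} \<approx> {..<a}" a]) simp

lemma ord_card_le: "{..<b} \<approx> {..<a} \<Longrightarrow> ord_card a \<le> b" for a b :: "'a ordinal"
  unfolding ord_card_def by (rule Least_le)

lemma initial_ord_card: "initial_ord (ord_card a)" for a :: "'a ordinal"
  unfolding initial_ord_def
  by (rule order.antisym; rule ord_card_le) (meson eqpoll_refl eqpoll_trans ord_card_eqpoll)+

lemma lepoll_lessThan_mono: "a \<le> b \<Longrightarrow> {..<a} \<lesssim> {..<b}" for a b :: "'a ordinal"
  by (rule subset_imp_lepoll) auto

lemma initial_ord_less:
  fixes s t k :: "'a ordinal"
  assumes k: "initial_ord k" and "{..<t} \<lesssim> {..<s}" "s < k"
  shows "t < k"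
proof (rule ccontr)
  assume "\<not> t < k"
  then have "{..<k} \<lesssim> {..<t}" by (intro lepoll_lessThan_mono) simp
  then have "{..<k} \<lesssim> {..<s}" using assms(2) by (rule lepoll_trans)
  moreover have "{..<s} \<lesssim> {..<k}" using \<open>s < k\<close> by (intro lepoll_lessThan_mono) simp
  ultimately have "{..<s} \<approx> {..<k}" using lepoll_antisym by blast
  then show False using ord_card_le[of s k] k \<open>s < k\<close> by (simp add: initial_ord_def)
qed

lemma next_initial_facts:
  fixes k s :: "'a ordinal"
  assumes k: "initial_ord k" "s < k"
  shows "next_initial s \<le> k" "initial_ord (next_initial s)" "s < next_initial s"
proof -
  show "next_initial s \<le> k" unfolding next_initial_def by (rule Least_le) (use k in simp)
  have "initial_ord (next_initial s) \<and> s < next_initial s"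
    unfolding next_initial_def by (rule LeastI[of _ k]) (use k in simp)
  then show "initial_ord (next_initial s)" "s < next_initial s" by auto
qed

text \<open>The cardinal of \<open>d\<close> is initial and at most \<open>d\<close>, so by
  minimality of \<open>next_initial s\<close> it does not exceed \<open>s\<close>.\<close>

lemma lepoll_if_less_next_initial:
  fixes d s :: "'a ordinal"
  assumes "d < next_initial s"
  shows "{..<d} \<lesssim> {..<s}"
proof -
  have "ord_card d \<le> d" by (rule ord_card_le) simp
  then have "\<not> s < ord_card d"
    using assms initial_ord_card[of d] not_less_Least[of "ord_card d" "\<lambda>b. initial_ord b \<and> s < b"]
    unfolding next_initial_def by auto
  then have "{..<ord_card d} \<lesssim> {..<s}" by (intro lepoll_lessThan_mono) simp
  then show ?thesis using ord_card_eqpoll[of d] by (meson eqpoll_sym lepoll_trans2 lepoll_trans1)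
qed

context infinite_type
begin

text \<open>By cardinal arithmetic the sum of two smaller ordinals has fewer elements than
  \<open>k\<close>, hence stays below \<open>k\<close>; indecomposable ordinals are powers of
  omega.\<close>

lemma infinite_initial_ord_eq_omega_pow:
  fixes k :: "'a ordinal"
  assumes k: "initial_ord k" "infinite {..<k}"
  obtains m where "k = omega_pow m"
proof (rule indecomposable_omega_pow)
  show "0 < k" using k(2) by (metis finite.emptyI lessThan_ordinal_zero ordinal_pos_iff)
  fix x y assume xy: "x < k" "y < k"
  have less: "|{..<z}| <o |{..<k}|" if z: "z < k" for z
  proof -
    have "\<not> {..<k} \<lesssim> {..<z}" using initial_ord_less[OF k(1) _ z] by blast
    then show ?thesis unfolding lepoll_iff_ordLeq using card_of_Well_order not_ordLeq_iff_ordLess by blast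
  qed
  have "|{..<x} <+> {..<y}| <o |{..<k}|"
    by (rule card_of_Plus_ordLess_infinite[OF k(2) less[OF xy(1)] less[OF xy(2)]])
  moreover have "|{..<x + y}| =o |{..<x} <+> {..<y}|"
    using card_of_ordIsoI[OF plus_rank(1)[of x y]] ordIso_symmetric by blast
  ultimately have "|{..<x + y}| <o |{..<k}|" by (rule ordIso_ordLess_trans[rotated])
  then have "\<not> {..<k} \<lesssim> {..<x + y}" unfolding lepoll_iff_ordLeq using not_ordLess_ordLeq by blast
  then show "x + y < k" using lepoll_lessThan_mono[of k "x + y"] not_less by blast
qed (use that in blast)

lemma Un_lepoll_plus:
  fixes a b :: "'a ordinal"
  assumes "A \<lesssim> {..<a}" "B \<lesssim> {..<b}"
  shows "A \<union> B \<lesssim> {..<a + b}"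
proof -
  have "{..<b} \<lesssim> (+) a ` {..<b}"
    by (rule inj_on_image_lepoll_2[THEN iffD2]) (auto simp: inj_on_def)
  then have B: "B \<lesssim> (+) a ` {..<b}" using assms(2) lepoll_trans by blast
  have "disjnt {..<a} ((+) a ` {..<b})" unfolding disjnt_def by (rule lessThan_plus_disjoint)
  then show ?thesis unfolding lessThan_plus using Un_lepoll_mono[OF assms(1) B] by simp
qed

lemma UN_lepoll_foldr_plus:
  fixes r :: "nat \<Rightarrow> 'a ordinal"
  assumes "\<And>i. i \<in> set is \<Longrightarrow> A i \<lesssim> {..<r i}"
  shows "(\<Union>i\<in>set is. A i) \<lesssim> {..<foldr (\<lambda>i s. r i + s) is 0}"
  using assms by (induction "is") (auto intro: Un_lepoll_plus)

lemma foldr_plus_less_omega_pow: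
  fixes r :: "nat \<Rightarrow> 'a ordinal"
  assumes "\<And>i. i \<in> set is \<Longrightarrow> r i < omega_pow m"
  shows "foldr (\<lambda>i s. r i + s) is 0 < omega_pow m"
  using assms by (induction "is") (auto intro: omega_pow_add_less simp: ordinal_pos_iff)

section \<open>Cutting a well partial order by length\<close>

lemma ol_empty [simp]: "ol R {} = (0 :: 'a ordinal)"
proof -
  have "good R {}" by (auto simp: good_def)
  moreover have "small T {}" by (rule small_finite) simp
  ultimately have "ol R {} \<le> (0 :: 'a ordinal)" by (intro ol_leI) auto
  then show ?thesis by simp
qed

lemma ol_eq_zeroD:
  assumes "good R Z" "small T Z" "ol R Z = (0 :: 'a ordinal)"
  shows "Z = {}"
  using ol_resid_less[OF assms(1,2)] assms(3) by force

text \<open>Intermediate values: as long as the length exceeds \<open>a\<close>, some residual still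
  has length at least \<open>a\<close>, and an initial segment of a residual is one of the whole
  set.\<close>

lemma ex_initial_segment:
  fixes a :: "'a ordinal"
  assumes X: "well_po R X" "small T X" and a: "a \<le> ol R X"
  obtains I where "I \<subseteq> X" "ol R I = a" "\<And>x y. x \<in> X - I \<Longrightarrow> y \<in> I \<Longrightarrow> (x, y) \<notin> R"
proof -
  have "a \<le> ol R Z \<longrightarrow> (\<exists>I\<subseteq>Z. ol R I = a \<and> (\<forall>x\<in>Z - I. \<forall>y\<in>I. (x, y) \<notin> R))" if "Z \<subseteq> X" for Z
    using well_poD(1)[OF X(1)] that
  proof (induction Z rule: resid_induct)
    case (1 Z)
    note w = well_po_subset[OF X(1) 1(1)] small_subset[OF 1(1) X(2)]
    show ?case
    proof
      assume a: "a \<le> ol R Z"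
      show "\<exists>I\<subseteq>Z. ol R I = a \<and> (\<forall>x\<in>Z - I. \<forall>y\<in>I. (x, y) \<notin> R)"
      proof (cases "ol R Z = a")
        case False
        then have "\<not> ol R Z \<le> a" using a by simp
        then obtain x where x: "x \<in> Z" "a \<le> ol R (resid R Z x)"
          using ol_leI[OF well_poD(1)[OF w(1)] w(2), of a] not_less by blast
        then obtain I where I: "I \<subseteq> resid R Z x" "ol R I = a" "\<forall>y\<in>resid R Z x - I. \<forall>z\<in>I. (y, z) \<notin> R"
          using 1(2) by blast
        have "(y, z) \<notin> R" if yz: "y \<in> Z - I" "z \<in> I" for y z
        proof (cases "y \<in> resid R Z x")
          case True
          then show ?thesis using I(3) yz by simp
        next
          case False
          have "z \<in> Z" "(x, z) \<notin> R" using I(1) yz by (auto simp: resid_def)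
          then show ?thesis using well_poD(3)[OF w(1), of x y z] False yz x(1) by (auto simp: resid_def)
        qed
        moreover have "I \<subseteq> Z" using I(1) resid_subset[of R Z x] by (rule order.trans)
        ultimately show ?thesis using I(2) by blast
      qed (intro exI[of _ Z], auto)
    qed
  qed
  from this[OF order.refl] a obtain I where "I \<subseteq> X" "ol R I = a" "\<forall>x\<in>X - I. \<forall>y\<in>I. (x, y) \<notin> R" by auto
  then show thesis by (intro that[of I]) auto
qed

text \<open>The cut is at an initial segment of length exactly \<open>a\<close>. Stacking optimal
  extensions gives \<open>a + ol R (X - I) \<le> ol R X \<le> a + b\<close>, and \<open>a\<close>
  cancels on the left.\<close>

lemma ex_split:
  fixes a b :: "'a ordinal"
  assumes X: "well_po R X" "small T X" and ab: "ol R X \<le> a + b"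
  obtains I where "I \<subseteq> X" "ol R I \<le> a" "ol R (X - I) \<le> b"
proof (cases "ol R X \<le> a")
  case True
  then show thesis using that[of X] by simp
next
  case False
  then obtain I where I: "I \<subseteq> X" "ol R I = a" "\<And>x y. x \<in> X - I \<Longrightarrow> y \<in> I \<Longrightarrow> (x, y) \<notin> R"
    using ex_initial_segment[OF X] by (metis linear)
  have D: "X - I \<subseteq> X" by auto
  have "lext R I (ol R I :: 'a ordinal)"
    by (rule lext_ol[OF well_po_subset[OF X(1) I(1)] small_subset[OF I(1) X(2)]])
  moreover have "lext R (X - I) (ol R (X - I) :: 'a ordinal)"
    by (rule lext_ol[OF well_po_subset[OF X(1) D] small_subset[OF D X(2)]])
  ultimately have "lext R (I \<union> (X - I)) (ol R I + ol R (X - I) :: 'a ordinal)"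
    by (rule lext_combine) (use I(3) in auto)
  moreover have "I \<union> (X - I) = X" using I(1) by auto
  ultimately have "ol R I + ol R (X - I) \<le> (ol R X :: 'a ordinal)"
    using lext_le_ol[OF well_poD(1)[OF X(1)] X(2)] by metis
  then have "a + ol R (X - I) \<le> a + b" using ab I(2) by (metis order.trans)
  then show thesis using that[OF I(1)] I(2) by simp
qed

lemma ol_eqpoll:
  assumes "well_po R X" "small T X"
  shows "X \<approx> {..<ol R X :: 'a ordinal}"
  by (rule lext_eqpoll[OF lext_ol[OF assms]])

text \<open>The case split of the induction for two orders. In the last case ordinary and Hessenberg
  sum agree, so \<open>ex_split\<close> cuts along the one while the product distributes over the
  other.\<close>

lemma ordinal_cases_CNF:
  fixes a :: "'a ordinal"
  obtains "a = 0" | e where "a = omega_pow e" | b c where "b < a" "c < a" "a = b + c" "a = hsum b c"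
proof (cases "exps a = {#}")
  case True
  then have "a = 0" using osum_exps[of a] by simp
  then show ?thesis using that by blast
next
  case False
  then obtain e N where N: "exps a = add_mset e N" "\<And>x. x \<in># N \<Longrightarrow> x \<le> e"
    using multiset_Max_cases[of "exps a"] by blast
  have a: "a = osum (add_mset e N)" using osum_exps[of a] by (simp add: N)
  show ?thesis
  proof (cases "N = {#}")
    case True
    then show ?thesis using that(2)[of e] a by simp
  next
    case False
    have "a = omega_pow e + osum N" using a N(2) by (simp add: osum_add_mset)
    moreover have "a = hsum (omega_pow e) (osum N)" using a by (simp add: hsum_eq)
    moreover have "osum N < a" unfolding a osum_less_iff by simp
    moreover have "omega_pow e < a"
    proof -
      have "osum {#e#} < a" unfolding a osum_less_iff using False by (simp add: subset_imp_less_mset)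
      then show ?thesis by simp
    qed
    ultimately show ?thesis using that(3) by blast
  qed
qed

lemma hprod_hsum_left: "hprod (hsum a b) c = hsum (hprod a c) (hprod b c)" for a b c :: "'a ordinal"
  by (simp add: hprod_eq hsum_eq)

lemma hprod_hsum_right: "hprod a (hsum b c) = hsum (hprod a b) (hprod a c)" for a b c :: "'a ordinal"
  by (simp add: hprod_eq hsum_eq hprod_mset_add_right)

lemma hprod_omega_pow: "hprod (omega_pow d) (omega_pow e) = omega_pow (hsum d e)" for d e :: "'a ordinal"
  by (simp add: hprod_eq)

lemma ol_Int_le_hprod:
  fixes a b k :: "'a ordinal"
  assumes U: "well_po R U" "well_po S U" "small T U"
    and k: "initial_ord k" "k = omega_pow m"
    and "Z \<subseteq> U" "ol R Z \<le> k * a" "ol S Z \<le> k * b"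
  shows "ol (R \<inter> S) Z \<le> k * hprod a b"
proof -
  have kdist: "k * hsum c d = hsum (k * c) (k * d)" for c d unfolding k(2) by (rule omega_pow_times_hsum)
  note UI = well_po_Int[OF U(1,2)]
  have un: "ol (R \<inter> S) Z \<le> hsum c (d :: 'a ordinal)"
    if "Z \<subseteq> U" "I \<subseteq> Z" "ol (R \<inter> S) I \<le> c" "ol (R \<inter> S) (Z - I) \<le> d" for Z I c d
  proof -
    have "ol (R \<inter> S) (I \<union> (Z - I)) \<le> hsum (ol (R \<inter> S) I) (ol (R \<inter> S) (Z - I) :: 'a ordinal)"
      by (rule ol_Un[OF well_poD(1)[OF UI] U(3)]) (use that in auto)
    moreover have "I \<union> (Z - I) = Z" using that by auto
    ultimately show ?thesis using hsum_mono[OF that(3,4)] by (metis order.trans)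
  qed
  \<comment> \<open>A length below \<open>k\<close> in one of the orders means fewer elements than
    \<open>k\<close>, as \<open>k\<close> is initial; cardinality then bounds the length in the
    intersection.\<close>
  have small_part: "ol (R \<inter> S) J < k" if J: "J \<subseteq> U" and Q: "Q = R \<or> Q = S" "ol Q J < k" for J Q
  proof -
    have "well_po Q J" using Q U well_po_subset[OF _ J] by blast
    then have "J \<approx> {..<ol Q J :: 'a ordinal}" using ol_eqpoll small_subset[OF J U(3)] by blast
    moreover have "J \<approx> {..<ol (R \<inter> S) J :: 'a ordinal}"
      by (rule ol_eqpoll[OF well_po_subset[OF UI J] small_subset[OF J U(3)]])
    ultimately have "{..<ol (R \<inter> S) J :: 'a ordinal} \<lesssim> {..<ol Q J :: 'a ordinal}"
      by (meson eqpoll_sym eqpoll_trans eqpoll_imp_lepoll)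
    then show ?thesis using initial_ord_less[OF k(1)] Q(2) by blast
  qed
  \<comment> \<open>Written once for both orders: \<open>Q\<close> is the order in which
    \<open>W\<close> is short, \<open>f\<close> its exponent and \<open>g\<close> that of the other
    order. Division by \<open>k\<close> gives length \<open>k * c + x\<close>; the part of length at
    most \<open>x\<close> falls to \<open>small_part\<close>.\<close>
  have core: "ol (R \<inter> S) W < k * omega_pow (hsum d e)"
    if W: "W \<subseteq> U" and Q: "Q = R \<or> Q = S" "ol Q W < k * omega_pow f" "f = d \<or> f = e"
      and IH: "\<And>I c. I \<subseteq> W \<Longrightarrow> c < omega_pow f \<Longrightarrow> ol Q I \<le> k * c \<Longrightarrow>
        ol (R \<inter> S) I \<le> k * hprod c (omega_pow g)"
      and fg: "hsum f g = hsum d e"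
    for W Q d e f g
  proof -
    have Q': "well_po Q W" using Q U well_po_subset[OF _ W] by blast
    obtain c x where c: "c < omega_pow f" "x < k" "ol Q W = k * c + x"
      using Q(2) by (auto simp: less_times_iff)
    obtain I where I: "I \<subseteq> W" "ol Q I \<le> k * c" "ol Q (W - I) \<le> x"
      using ex_split[OF Q' small_subset[OF W U(3)], of "k * c" x] c(3) by auto
    have "ol (R \<inter> S) I \<le> k * hprod c (omega_pow g)" by (rule IH[OF I(1) c(1) I(2)])
    also have "\<dots> < k * omega_pow (hsum d e)"
      using hprod_less_omega_pow[OF c(1), of g] by (simp add: fg k(2) times_less_cancel omega_pow_facts(1))
    finally have 1: "ol (R \<inter> S) I < k * omega_pow (hsum d e)" .
    have "ol (R \<inter> S) (W - I) < k"
      by (rule small_part[OF _ Q(1)]) (use W I(3) c(2) in auto)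
    also have "k \<le> k * omega_pow (hsum d e)"
      using times_mono_right[of 1 "omega_pow (hsum d e)" k] by (simp add: not_less[symmetric])
    finally have "ol (R \<inter> S) (W - I) < k * omega_pow (hsum d e)" .
    with 1 have "hsum (ol (R \<inter> S) I) (ol (R \<inter> S) (W - I)) < k * omega_pow (hsum d e)"
      unfolding k(2) omega_pow_plus by (rule hsum_less_omega_pow)
    then show ?thesis using un[OF W I(1) order.refl order.refl] by (rule le_less_trans[rotated])
  qed
  \<comment> \<open>Outer induction on \<open>a\<close>, inner on \<open>b\<close>, for all subsets
    of \<open>U\<close> at once, since each cut changes \<open>Z\<close>.\<close>
  have "\<forall>b Z. Z \<subseteq> U \<longrightarrow> ol R Z \<le> k * a \<longrightarrow> ol S Z \<le> k * b \<longrightarrow> ol (R \<inter> S) Z \<le> k * hprod a b" for a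
  proof (induction a rule: less_induct)
    case (less a)
    note IHa = less
    show ?case
    proof
      fix b
      show "\<forall>Z. Z \<subseteq> U \<longrightarrow> ol R Z \<le> k * a \<longrightarrow> ol S Z \<le> k * b \<longrightarrow> ol (R \<inter> S) Z \<le> k * hprod a b"
      proof (induction b rule: less_induct)
        case (less b)
        note IHb = less
        show ?case
        proof (intro allI impI)
          fix Z assume Z: "Z \<subseteq> U" and a: "ol R Z \<le> k * a" and b: "ol S Z \<le> k * b"
          note wR = well_po_subset[OF U(1) Z] and wS = well_po_subset[OF U(2) Z]
            and sZ = small_subset[OF Z U(3)] and wI = well_po_subset[OF UI Z]
          show "ol (R \<inter> S) Z \<le> k * hprod a b"
          proof (cases a rule: ordinal_cases_CNF)
            case 1
            then have "Z = {}" using ol_eq_zeroD[OF well_poD(1)[OF wR] sZ] a by simp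
            then show ?thesis by simp
          next
            case (3 c d)
            obtain I where I: "I \<subseteq> Z" "ol R I \<le> k * c" "ol R (Z - I) \<le> k * d"
              using ex_split[OF wR sZ, of "k * c" "k * d"] a 3 by (metis distrib_left_ordinal)
            have "ol S I \<le> (ol S Z :: 'a ordinal)" "ol S (Z - I) \<le> (ol S Z :: 'a ordinal)"
              using I(1) by (auto intro!: ol_mono well_poD(1)[OF wS] sZ)
            then have "ol (R \<inter> S) I \<le> k * hprod c b" "ol (R \<inter> S) (Z - I) \<le> k * hprod d b"
              using IHa[rule_format, OF 3(1), of I b] IHa[rule_format, OF 3(2), of "Z - I" b] I Z b
              by (meson Diff_subset order.trans)+
            then show ?thesis using un[OF Z I(1)] by (simp only: 3(4) hprod_hsum_left kdist)
          next
            case (2 e)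
            show ?thesis
            proof (cases b rule: ordinal_cases_CNF)
              case 1
              then have "Z = {}" using ol_eq_zeroD[OF well_poD(1)[OF wS] sZ] b by simp
              then show ?thesis by simp
            next
              case (3 c d)
              obtain I where I: "I \<subseteq> Z" "ol S I \<le> k * c" "ol S (Z - I) \<le> k * d"
                using ex_split[OF wS sZ, of "k * c" "k * d"] b 3 by (metis distrib_left_ordinal)
              have "ol R I \<le> (ol R Z :: 'a ordinal)" "ol R (Z - I) \<le> (ol R Z :: 'a ordinal)"
                using I(1) by (auto intro!: ol_mono well_poD(1)[OF wR] sZ)
              then have "ol (R \<inter> S) I \<le> k * hprod a c" "ol (R \<inter> S) (Z - I) \<le> k * hprod a d"
                using IHb[rule_format, OF 3(1), of I] IHb[rule_format, OF 3(2), of "Z - I"] I Z a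
                by (meson Diff_subset order.trans)+
              then show ?thesis using un[OF Z I(1)] by (simp only: 3(4) hprod_hsum_right kdist)
            next
              case (2 f)
              note af = \<open>a = omega_pow e\<close> and bf = \<open>b = omega_pow f\<close>
              have "ol (R \<inter> S) (resid (R \<inter> S) Z x) < k * omega_pow (hsum e f)" if x: "x \<in> Z" for x
              proof -
                define W1 where "W1 = resid R Z x"
                define W2 where "W2 = resid S Z x"
                have sub: "W1 \<subseteq> Z" "W2 \<subseteq> Z" by (simp_all add: W1_def W2_def resid_subset)
                have "ol R W1 < k * omega_pow e"
                  unfolding W1_def using ol_resid_less[OF well_poD(1)[OF wR] sZ x] a af by (metis less_le_trans)
                then have 1: "ol (R \<inter> S) W1 < k * omega_pow (hsum e f)"
                proof (rule core[of _ R, rotated 2])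
                  fix I c assume "I \<subseteq> W1" "c < omega_pow e" "ol R I \<le> k * c"
                  moreover have "ol S I \<le> k * omega_pow f"
                  proof -
                    have "ol S I \<le> (ol S Z :: 'a ordinal)"
                      by (rule ol_mono[OF well_poD(1)[OF wS] sZ]) (use \<open>I \<subseteq> W1\<close> sub in auto)
                    then show ?thesis using b bf by (metis order.trans)
                  qed
                  ultimately show "ol (R \<inter> S) I \<le> k * hprod c (omega_pow f)"
                    using IHa[of c] af sub Z by (meson order.trans)
                qed (use sub Z in auto)
                have "ol S W2 < k * omega_pow f"
                  unfolding W2_def using ol_resid_less[OF well_poD(1)[OF wS] sZ x] b bf by (metis less_le_trans)
                then have 2: "ol (R \<inter> S) W2 < k * omega_pow (hsum e f)"
                proof (rule core[of _ S, rotated 2])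
                  fix I c assume "I \<subseteq> W2" "c < omega_pow f" "ol S I \<le> k * c"
                  moreover have "ol R I \<le> k * omega_pow e"
                  proof -
                    have "ol R I \<le> (ol R Z :: 'a ordinal)"
                      by (rule ol_mono[OF well_poD(1)[OF wR] sZ]) (use \<open>I \<subseteq> W2\<close> sub in auto)
                    then show ?thesis using a af by (metis order.trans)
                  qed
                  ultimately have "ol (R \<inter> S) I \<le> k * hprod (omega_pow e) c"
                    using IHb[of c] af bf sub Z by (meson order.trans)
                  then show "ol (R \<inter> S) I \<le> k * hprod c (omega_pow e)" by (simp add: hprod_commute)
                qed (use sub Z in \<open>auto simp: hsum_commute\<close>)
                \<comment> \<open>\<open>k * omega_pow (hsum e f)\<close> is a power of omega, so
                  two smaller lengths do not reach it together.\<close>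
                have "hsum (ol (R \<inter> S) W1) (ol (R \<inter> S) W2) < k * omega_pow (hsum e f)"
                  using 1 2 unfolding k(2) omega_pow_plus by (rule hsum_less_omega_pow)
                moreover have "ol (R \<inter> S) (W1 \<union> W2) \<le> hsum (ol (R \<inter> S) W1) (ol (R \<inter> S) W2 :: 'a ordinal)"
                  by (rule ol_Un[OF well_poD(1)[OF wI] sZ sub])
                moreover have "resid (R \<inter> S) Z x = W1 \<union> W2" by (auto simp: W1_def W2_def resid_def)
                ultimately show ?thesis by simp
              qed
              then show ?thesis
                unfolding af bf hprod_omega_pow by (intro ol_leI well_poD(1)[OF wI] sZ)
            qed
          qed
        qed
      qed
    qed
  qed
  then show ?thesis using assms by blast
qed

section \<open>From two to finitely many orders\<close>

lemma well_po_INT: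
  assumes "finite I" "I \<noteq> {}" "\<And>i. i \<in> I \<Longrightarrow> well_po (R i) X"
  shows "well_po (\<Inter>i\<in>I. R i) X"
  using assms by (induction I rule: finite_ne_induct) (auto intro: well_po_Int)

lemma ol_INT_le_hprod:
  fixes q :: "nat \<Rightarrow> 'a ordinal"
  assumes "is \<noteq> []" and "small T X" "initial_ord k" "k = omega_pow m"
    and "\<And>i. i \<in> set is \<Longrightarrow> well_po (R i) X" "\<And>i. i \<in> set is \<Longrightarrow> ol (R i) X \<le> k * q i"
  shows "ol (\<Inter>i\<in>set is. R i) X \<le> k * foldr (\<lambda>i s. hprod (q i) s) is 1"
  using assms
proof (induction "is" rule: list_nonempty_induct)
  case (single i)
  then show ?case by simp
next
  case (cons i "is")
  have w: "well_po (\<Inter>i\<in>set is. R i) X" by (rule well_po_INT) (use cons in auto)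
  have "ol (R i \<inter> (\<Inter>i\<in>set is. R i)) X \<le> k * hprod (q i) (foldr (\<lambda>i s. hprod (q i) s) is 1)"
    by (rule ol_Int_le_hprod[OF _ w, where m = m]) (use cons in auto)
  then show ?case by simp
qed

theorem ol_INT_less:
  fixes q r :: "nat \<Rightarrow> 'a ordinal"
  assumes n: "1 \<le> n" and X: "small T X" and k: "initial_ord k" "k = omega_pow m"
    and R: "\<And>i. i \<in> {1..n} \<Longrightarrow> well_po (R i) X" "\<And>i. i \<in> {1..n} \<Longrightarrow> ol (R i) X = k * q i + r i"
    and r: "\<And>i. i \<in> {1..n} \<Longrightarrow> r i < k"
  shows "ol (\<Inter>i\<in>{1..n}. R i) X < k * hprod_upto n q + next_initial (ord_sum_upto n r)"
proof -
  have set_upt: "set [1..<Suc n] = {1..n}" by auto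
  define S where "S = (\<Inter>i\<in>{1..n}. R i)"
  have wS: "well_po S X" unfolding S_def by (rule well_po_INT) (use R n in auto)
  have "\<exists>I\<subseteq>X. ol (R i) I \<le> k * q i \<and> ol (R i) (X - I) \<le> r i" if i: "i \<in> {1..n}" for i
    using ex_split[OF R(1)[OF i] X, of "k * q i" "r i"] R(2)[OF i] by (metis order.refl)
  then obtain I where I: "\<And>i. i \<in> {1..n} \<Longrightarrow> I i \<subseteq> X" "\<And>i. i \<in> {1..n} \<Longrightarrow> ol (R i) (I i) \<le> k * q i"
    "\<And>i. i \<in> {1..n} \<Longrightarrow> ol (R i) (X - I i) \<le> r i" by metis
  define Y where "Y = (\<Inter>i\<in>{1..n}. I i)"
  define B where "B = (\<Union>i\<in>{1..n}. X - I i)"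
  have Y: "Y \<subseteq> I i" if "i \<in> {1..n}" for i unfolding Y_def using that by auto
  have "1 \<in> {1..n}" using n by simp
  then have YX: "Y \<subseteq> X" using Y I(1) by blast
  have BX: "B \<subseteq> X" by (auto simp: B_def)
  have XYB: "X = Y \<union> B" using YX BX unfolding Y_def B_def by auto
  have "ol (R i) Y \<le> k * q i" if i: "i \<in> {1..n}" for i
  proof -
    have "ol (R i) Y \<le> (ol (R i) (I i) :: 'a ordinal)"
      using well_poD(1)[OF well_po_subset[OF R(1)[OF i] I(1)[OF i]]] small_subset[OF I(1)[OF i] X] Y[OF i]
      by (rule ol_mono)
    then show ?thesis using I(2)[OF i] by simp
  qed
  then have "ol (\<Inter>i\<in>set [1..<Suc n]. R i) Y \<le> k * foldr (\<lambda>i s. hprod (q i) s) [1..<Suc n] 1"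
    using n R(1) by (intro ol_INT_le_hprod[OF _ small_subset[OF YX X] k] well_po_subset[OF _ YX]) auto
  then have olY: "ol S Y \<le> k * hprod_upto n q"
    unfolding set_upt S_def[symmetric] hprod_upto_def[symmetric] .
  define s where "s = ord_sum_upto n r"
  have s_less: "s < k"
    unfolding s_def ord_sum_upto_def k(2) by (rule foldr_plus_less_omega_pow) (use r k(2) in auto)
  note nxt = next_initial_facts[OF k(1) s_less]
  have "X - I i \<lesssim> {..<r i}" if i: "i \<in> {1..n}" for i
  proof -
    have D: "X - I i \<subseteq> X" by auto
    have "X - I i \<approx> {..<ol (R i) (X - I i) :: 'a ordinal}"
      by (rule ol_eqpoll[OF well_po_subset[OF R(1)[OF i] D] small_subset[OF D X]])
    then show ?thesis using lepoll_lessThan_mono[OF I(3)[OF i]] by (rule lepoll_trans1)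
  qed
  then have "(\<Union>i\<in>set [1..<Suc n]. X - I i) \<lesssim> {..<foldr (\<lambda>i s. r i + s) [1..<Suc n] 0}"
    by (intro UN_lepoll_foldr_plus) auto
  then have "B \<lesssim> {..<s}" unfolding set_upt B_def[symmetric] s_def ord_sum_upto_def .
  moreover have "B \<approx> {..<ol S B :: 'a ordinal}"
    by (rule ol_eqpoll[OF well_po_subset[OF wS BX] small_subset[OF BX X]])
  ultimately have "{..<ol S B :: 'a ordinal} \<lesssim> {..<s}" by (meson eqpoll_sym lepoll_trans1)
  \<comment> \<open>Only the cardinality of \<open>B\<close> is controlled, by that of
    \<open>s\<close>; an initial ordinal beyond \<open>s\<close> bounds every length compatible with
    it.\<close>
  then have olB: "ol S B < next_initial s" using initial_ord_less[OF nxt(2) _ nxt(3)] by blast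
  have "ol S X \<le> hsum (ol S Y) (ol S B :: 'a ordinal)"
    unfolding XYB by (rule ol_Un[of _ X]) (use well_poD(1)[OF wS] X YX BX XYB in auto)
  also have "\<dots> \<le> hsum (k * hprod_upto n q) (ol S B)" using olY by (intro hsum_mono) auto
  \<comment> \<open>The exponents of a multiple of \<open>k\<close> are at least \<open>m\<close>,
    those of \<open>ol S B\<close> are below \<open>m\<close>, so the two normal forms just
    concatenate.\<close>
  also have "\<dots> = k * hprod_upto n q + ol S B"
  proof (rule hsum_eq_plus)
    fix x y :: "'a ordinal"
    assume x: "x \<in># exps (k * hprod_upto n q)" and y: "y \<in># exps (ol S B)"
    have "ol S B < omega_pow m" using olB nxt(1) k(2) by simp
    then have "y < m" using y less_omega_pow_iff by blast
    moreover have "m \<le> x" using x unfolding k(2) by auto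
    ultimately show "y \<le> x" by simp
  qed
  also have "\<dots> < k * hprod_upto n q + next_initial s" using olB by simp
  finally show ?thesis by (simp add: S_def s_def)
qed

end

section \<open>Products of two ordinals\<close>

definition prod_le :: "('a ordinal \<times> 'a ordinal) rel"
  where "prod_le = {(u, v). fst u \<le> fst v \<and> snd u \<le> snd v}"

lemma good_pullback:
  fixes f :: "'b \<Rightarrow> 'c :: wellorder"
  shows "good {(x, y). f x \<le> f y} Z"
  unfolding good_def
proof (intro allI impI)
  fix g :: "nat \<Rightarrow> 'b"
  define v where "v = (LEAST v. v \<in> range (f \<circ> g))"
  have "v \<in> range (f \<circ> g)" unfolding v_def by (rule LeastI[of _ "f (g 0)"]) auto
  then obtain i where i: "v = f (g i)" by auto
  have "v \<le> f (g (Suc i))" unfolding v_def by (rule Least_le) auto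
  then show "\<exists>i j. i < j \<and> (g i, g j) \<in> {(x, y). f x \<le> f y}"
    using i by (intro exI[of _ i] exI[of _ "Suc i"]) auto
qed

lemma well_po_prod_le: "well_po prod_le Z"
proof (rule well_poI)
  have "prod_le = {(u, v). fst u \<le> fst v} \<inter> {(u, v). snd u \<le> (snd v :: 'a ordinal)}"
    by (auto simp: prod_le_def)
  then show "good (prod_le :: ('a ordinal \<times> 'a ordinal) rel) Z" using good_Int[OF good_pullback good_pullback] by metis
qed (auto simp: prod_le_def prod_eq_iff)

text \<open>Only comparabilities of the target have to come from the source, since fewer relations
  are easier to extend.\<close>

lemma lext_transport:
  assumes "lext R Z t" and p: "bij_betw p Z Z'"
    and mono: "\<And>x y. x \<in> Z \<Longrightarrow> y \<in> Z \<Longrightarrow> (p x, p y) \<in> R' \<Longrightarrow> (x, y) \<in> R"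
  shows "lext R' Z' t"
proof -
  obtain f where f: "bij_betw f Z {..<t}" "\<forall>x\<in>Z. \<forall>y\<in>Z. (x, y) \<in> R \<longrightarrow> f x \<le> f y"
    using assms(1) by (auto simp: lext_def)
  define q where "q = inv_into Z p"
  have q: "q x \<in> Z" "p (q x) = x" if "x \<in> Z'" for x
    using p that unfolding q_def by (auto simp: bij_betw_def inv_into_into f_inv_into_f)
  have "bij_betw q Z' Z" unfolding q_def by (rule bij_betw_inv_into[OF p])
  then have "bij_betw (f \<circ> q) Z' {..<t}" using f(1) bij_betw_trans by blast
  moreover have "(f \<circ> q) x \<le> (f \<circ> q) y" if "x \<in> Z'" "y \<in> Z'" "(x, y) \<in> R'" for x y
    using mono[of "q x" "q y"] q[OF that(1)] q[OF that(2)] that(3) f(2) by simp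
  ultimately show ?thesis unfolding lext_def by blast
qed

text \<open>The interval that the \<open>i\<close>-th term of the sum occupies among the ordinals
  below \<open>omega_sum ds\<close>.\<close>

definition block :: "'a ordinal list \<Rightarrow> nat \<Rightarrow> 'a ordinal set"
  where "block ds i = (+) (omega_sum (take i ds)) ` {..<omega_pow (ds ! i)}"

context infinite_type
begin

lemma omega_sum_append: "omega_sum (xs @ ys) = omega_sum xs + omega_sum ys" for xs ys :: "'a ordinal list"
  by (induction xs) (auto simp: plus_assoc)

lemma omega_sum_take_mono: "i \<le> j \<Longrightarrow> omega_sum (take i ds) \<le> omega_sum (take j ds)" for ds :: "'a ordinal list"
  using omega_sum_append[of "take i ds" "take (j - i) (drop i ds)"] take_add[of i "j - i" ds] by simp

lemma block_less:
  fixes ds :: "'a ordinal list"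
  assumes "i < j" "j < length ds" "x \<in> block ds i" "y \<in> block ds j"
  shows "x < y"
proof -
  obtain z where z: "x = omega_sum (take i ds) + z" "z < omega_pow (ds ! i)" using assms by (auto simp: block_def)
  then have "x < omega_sum (take i ds) + omega_pow (ds ! i)" by simp
  also have "\<dots> = omega_sum (take (Suc i) ds)"
    using assms by (simp add: take_Suc_conv_app_nth omega_sum_append)
  also have "\<dots> \<le> omega_sum (take j ds)" by (rule omega_sum_take_mono) (use assms in simp)
  also have "\<dots> \<le> y" using assms by (auto simp: block_def)
  finally show ?thesis .
qed

lemma block_le:
  fixes ds :: "'a ordinal list"
  assumes "x \<in> block ds i" "y \<in> block ds j" "x \<le> y" "i < length ds" "j < length ds"
  shows "i \<le> j"
proof (rule ccontr)
  assume "\<not> i \<le> j"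
  then have "y < x" using block_less[of j i ds y x] assms by simp
  then show False using assms by simp
qed

lemma UN_block: "(\<Union>i<length ds. block ds i) = {..<omega_sum ds}" for ds :: "'a ordinal list"
proof (induction ds)
  case (Cons e ds)
  have "(\<Union>i<length (e # ds). block (e # ds) i) = block (e # ds) 0 \<union> (\<Union>i<length ds. block (e # ds) (Suc i))"
    by (simp add: lessThan_Suc_eq_insert_0)
  also have "block (e # ds) (Suc i) = (+) (omega_pow e) ` block ds i" for i
    by (auto simp: block_def plus_assoc image_image)
  then have "(\<Union>i<length ds. block (e # ds) (Suc i)) = (+) (omega_pow e) ` {..<omega_sum ds}"
    by (simp add: image_UN flip: Cons)
  also have "block (e # ds) 0 = {..<omega_pow e}" by (simp add: block_def)
  also have "{..<omega_pow e} \<union> (+) (omega_pow e) ` {..<omega_sum ds} = {..<omega_sum (e # ds)}"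
    by (auto simp: less_plus_iff)
  finally show ?case .
qed simp

lemma block_bij: "bij_betw ((+) (omega_sum (take i ds))) {..<omega_pow (ds ! i)} (block ds i)" for ds :: "'a ordinal list"
  by (auto simp: bij_betw_def block_def inj_on_def)

lemma small_prod: "Z \<subseteq> {..<a} \<times> {..<b} \<Longrightarrow> small T Z" for a b :: "'a ordinal"
  by (rule small_subset[OF _ small_Times[OF card_lessThan_ordinal card_lessThan_ordinal]])

lemma ol_prod_mono:
  fixes a b :: "'a ordinal"
  assumes "V \<subseteq> W" "W \<subseteq> {..<a} \<times> {..<b}"
  shows "ol prod_le V \<le> (ol prod_le W :: 'a ordinal)"
  by (rule ol_mono[OF well_poD(1)[OF well_po_prod_le] small_prod[OF assms(2)] assms(1)])

lemma ol_block:
  fixes ds es :: "'a ordinal list"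
  shows "ol prod_le ({..<omega_pow (ds ! i)} \<times> {..<omega_pow (es ! j)}) \<le> (ol prod_le (block ds i \<times> block es j) :: 'a ordinal)"
proof -
  let ?p = "map_prod ((+) (omega_sum (take i ds))) ((+) (omega_sum (take j es)))"
  have b: "bij_betw ?p ({..<omega_pow (ds ! i)} \<times> {..<omega_pow (es ! j)}) (block ds i \<times> block es j)"
    by (rule bij_betw_map_prod) (rule block_bij)+
  have small: "small T (block ds i \<times> block es j)"
    unfolding block_def by (intro small_Times small_image card_lessThan_ordinal)
  have "lext prod_le ({..<omega_pow (ds ! i)} \<times> {..<omega_pow (es ! j)})
    (ol prod_le ({..<omega_pow (ds ! i)} \<times> {..<omega_pow (es ! j)}) :: 'a ordinal)"
    by (rule lext_ol[OF well_po_prod_le small_prod[OF order.refl]])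
  then have "lext prod_le (block ds i \<times> block es j)
    (ol prod_le ({..<omega_pow (ds ! i)} \<times> {..<omega_pow (es ! j)}) :: 'a ordinal)"
    by (rule lext_transport[OF _ b]) (auto simp: prod_le_def)
  then show ?thesis by (rule lext_le_ol[OF well_poD(1)[OF well_po_prod_le] small])
qed

text \<open>The blocks of the grid are stacked by non-increasing exponent \<open>hsum d e\<close>,
  so that their powers of omega add up to a normal form. The induction removes a block that can come
  last.\<close>

lemma osum_le_ol_blocks:
  fixes ds es :: "'a ordinal list"
  assumes sorted: "sorted (rev ds)" "sorted (rev es)"
    and lb: "\<And>d e. d \<in> set ds \<Longrightarrow> e \<in> set es \<Longrightarrow>
      omega_pow (hsum d e) \<le> ol prod_le ({..<omega_pow d} \<times> {..<omega_pow e})"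
    and D: "D \<subseteq> {..<length ds} \<times> {..<length es}"
    and down: "\<And>i j i' j'. (i, j) \<in> D \<Longrightarrow> i' \<le> i \<Longrightarrow> j' \<le> j \<Longrightarrow> (i', j') \<in> D"
  shows "osum (\<Sum>(i, j)\<in>D. {#hsum (ds ! i) (es ! j)#}) \<le> ol prod_le (\<Union>(i, j)\<in>D. block ds i \<times> block es j)"
  using D down
proof (induction "card D" arbitrary: D)
  case 0
  then have "finite D" using finite_subset by blast
  then have "D = {}" using 0 by simp
  then show ?case by simp
next
  case (Suc n)
  have fin: "finite D" using Suc.prems(1) finite_subset by blast
  define key where "key = (\<lambda>(i, j). hsum (ds ! i) (es ! j))"
  have anti: "key (i', j') \<le> key (i, j)"
    if "i \<le> i'" "j \<le> j'" "i' < length ds" "j' < length es" for i i' j j'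
    unfolding key_def using sorted_rev_nth_mono[OF sorted(1) that(1,3)] sorted_rev_nth_mono[OF sorted(2) that(2,4)]
    by (simp add: hsum_mono)
  have "D \<noteq> {}" using Suc.hyps(2) by auto
  \<comment> \<open>Among the pairs with least exponent, one with largest \<open>i + j\<close> is
    taken. Exponents do not increase along the grid, so this pair is maximal in \<open>D\<close> and
    its block can go on top.\<close>
  define E where "E = {p \<in> D. key p = Min (key ` D)}"
  have "Min (key ` D) \<in> key ` D" using fin \<open>D \<noteq> {}\<close> by simp
  then obtain p where "p \<in> D" "Min (key ` D) = key p" by blast
  then have "p \<in> E" unfolding E_def mem_Collect_eq by simp
  then have "E \<noteq> {}" by blast
  moreover have "finite E" using fin by (simp add: E_def)
  ultimately have "Max ((\<lambda>(i, j). i + j) ` E) \<in> (\<lambda>(i, j). i + j) ` E" by simp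
  then obtain i j where ij: "(i, j) \<in> E" "i + j = Max ((\<lambda>(i, j). i + j) ` E)" by auto
  have ijD: "(i, j) \<in> D" using ij by (simp add: E_def)
  then have len: "i < length ds" "j < length es" using Suc.prems(1) by auto
  have key_min: "key (i, j) \<le> key p" if "p \<in> D" for p
    using ij(1) fin that by (simp add: E_def)
  have maximal: "i' = i \<and> j' = j" if D': "(i', j') \<in> D" "i \<le> i'" "j \<le> j'" for i' j'
  proof -
    have "key (i', j') \<le> key (i, j)" by (rule anti) (use D' Suc.prems(1) in auto)
    then have "(i', j') \<in> E" using key_min[OF D'(1)] ij(1) D'(1) by (auto simp: E_def)
    then have "i' + j' \<le> i + j" unfolding ij(2) using \<open>finite E\<close> by (auto intro!: Max_ge)
    then show ?thesis using D' by simp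
  qed
  define D1 where "D1 = D - {(i, j)}"
  define K where "K = (\<Sum>(i, j)\<in>D1. {#hsum (ds ! i) (es ! j)#})"
  define V where "V = (\<Union>(i, j)\<in>D1. block ds i \<times> block es j)"
  define W where "W = block ds i \<times> block es j"
  have D: "D = insert (i, j) D1" "(i, j) \<notin> D1" using ijD by (auto simp: D1_def)
  have "finite D1" using fin by (simp add: D1_def)
  have "osum K \<le> ol prod_le V"
    unfolding K_def V_def
  proof (rule Suc.hyps(1))
    show "n = card D1" using Suc.hyps(2) D \<open>finite D1\<close> by simp
    show "D1 \<subseteq> {..<length ds} \<times> {..<length es}" using Suc.prems(1) by (auto simp: D1_def)
    show "(i'', j'') \<in> D1" if "(i', j') \<in> D1" "i'' \<le> i'" "j'' \<le> j'" for i' j' i'' j''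
    proof -
      have "(i', j') \<in> D" using that by (simp add: D1_def)
      then have "(i'', j'') \<in> D" using Suc.prems(2) that by blast
      moreover have "(i'', j'') \<noteq> (i, j)"
        using maximal[OF \<open>(i', j') \<in> D\<close>] that by (auto simp: D1_def)
      ultimately show ?thesis by (simp add: D1_def)
    qed
  qed
  moreover have "omega_pow (key (i, j)) \<le> ol prod_le W"
  proof -
    have "omega_pow (key (i, j)) \<le> ol prod_le ({..<omega_pow (ds ! i)} \<times> {..<omega_pow (es ! j)})"
      unfolding key_def using lb[of "ds ! i" "es ! j"] len by simp
    also have "\<dots> \<le> ol prod_le W" unfolding W_def by (rule ol_block)
    finally show ?thesis .
  qed
  ultimately have 1: "osum K + omega_pow (key (i, j)) \<le> ol prod_le V + ol prod_le W" by (rule plus_mono)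
  have 2: "ol prod_le V + ol prod_le W \<le> (ol prod_le (V \<union> W) :: 'a ordinal)"
  proof -
    have blk: "block ds i' \<times> block es j' \<subseteq> {..<omega_sum ds} \<times> {..<omega_sum es}" if "(i', j') \<in> D" for i' j'
      using that Suc.prems(1) UN_block[of ds] UN_block[of es] by blast
    then have sub: "V \<subseteq> {..<omega_sum ds} \<times> {..<omega_sum es}" "W \<subseteq> {..<omega_sum ds} \<times> {..<omega_sum es}"
      using D ijD by (auto simp: V_def W_def)
    then have sub': "V \<union> W \<subseteq> {..<omega_sum ds} \<times> {..<omega_sum es}" by simp
    have no: "(x, y) \<notin> prod_le" if x: "x \<in> W" and y: "y \<in> V" for x y
    proof
      assume le: "(x, y) \<in> prod_le"
      obtain i' j' where ij': "(i', j') \<in> D1" "fst y \<in> block ds i'" "snd y \<in> block es j'"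
        using y by (auto simp: V_def)
      have D': "(i', j') \<in> D" using ij'(1) D by simp
      then have len': "i' < length ds" "j' < length es" using Suc.prems(1) by auto
      have "i \<le> i'" "j \<le> j'"
        using block_le[OF _ ij'(2) _ len(1) len'(1), of "fst x"] block_le[OF _ ij'(3) _ len(2) len'(2), of "snd x"]
          x le by (auto simp: W_def prod_le_def)
      then have "(i', j') = (i, j)" using maximal[OF D'] by simp
      then show False using ij'(1) D(2) by simp
    qed
    have "V \<inter> W = {}" using no by (auto simp: prod_le_def)
    then have "lext prod_le (V \<union> W) (ol prod_le V + ol prod_le W :: 'a ordinal)"
      by (intro lext_combine lext_ol well_po_prod_le small_prod[OF sub(1)] small_prod[OF sub(2)] no)
    then show ?thesis by (rule lext_le_ol[OF well_poD(1)[OF well_po_prod_le] small_prod[OF sub']])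
  qed
  have 3: "osum (\<Sum>(i, j)\<in>D. {#hsum (ds ! i) (es ! j)#}) = osum K + omega_pow (key (i, j))"
  proof -
    have "(\<Sum>(i, j)\<in>D. {#hsum (ds ! i) (es ! j)#}) = K + {#key (i, j)#}"
      unfolding D(1) K_def using D(2) \<open>finite D1\<close> by (simp add: key_def)
    moreover have "key (i, j) \<le> x" if "x \<in># K" for x
    proof -
      have "x \<in> key ` D1" using that \<open>finite D1\<close>
        by (auto simp: K_def key_def set_mset_sum)
      then show ?thesis using key_min D by auto
    qed
    then have "osum (K + {#key (i, j)#}) = osum K + osum {#key (i, j)#}" by (intro osum_append) simp
    ultimately show ?thesis by (simp only: osum_single)
  qed
  have 4: "(\<Union>(i, j)\<in>D. block ds i \<times> block es j) = V \<union> W"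
    unfolding D(1) V_def W_def by auto
  show ?case unfolding 3 4 using 1 2 by (rule order.trans)
qed

lemma sum_nth_mset: "(\<Sum>i<length xs. g (xs ! i)) = (\<Sum>x\<in>#mset xs. g x)" for g :: "'b \<Rightarrow> 'c :: comm_monoid_add"
proof (induction xs)
  case (Cons x xs)
  then show ?case by (simp add: sum.lessThan_Suc_shift del: sum.lessThan_Suc)
qed simp

lemma image_mset_eq_sum: "(\<Sum>x\<in>#M. {#f x#}) = image_mset f M"
  by (induction M) auto

lemma omega_sum_eq_osum: "sorted (rev ds) \<Longrightarrow> omega_sum ds = osum (mset ds)" for ds :: "'a ordinal list"
  unfolding osum_def by (metis mset_rev rev_rev_ident sorted_list_of_multiset_mset sorted_sort_id)

lemma hprod_le_ol_lists:
  fixes ds es :: "'a ordinal list"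
  assumes "sorted (rev ds)" "sorted (rev es)"
    and "\<And>d e. d \<in> set ds \<Longrightarrow> e \<in> set es \<Longrightarrow>
      omega_pow (hsum d e) \<le> ol prod_le ({..<omega_pow d} \<times> {..<omega_pow e})"
  shows "hprod (omega_sum ds) (omega_sum es) \<le> ol prod_le ({..<omega_sum ds} \<times> {..<omega_sum es})"
proof -
  let ?D = "{..<length ds} \<times> {..<length es}"
  have "osum (\<Sum>(i, j)\<in>?D. {#hsum (ds ! i) (es ! j)#}) \<le> ol prod_le (\<Union>(i, j)\<in>?D. block ds i \<times> block es j)"
    by (rule osum_le_ol_blocks[OF assms]) auto
  moreover have "(\<Union>(i, j)\<in>?D. block ds i \<times> block es j) = {..<omega_sum ds} \<times> {..<omega_sum es}"
    unfolding UN_block[symmetric] by auto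
  moreover have "(\<Sum>(i, j)\<in>?D. {#hsum (ds ! i) (es ! j)#}) = hprod_mset (mset ds) (mset es)"
  proof -
    have "(\<Sum>(i, j)\<in>?D. {#hsum (ds ! i) (es ! j)#}) = (\<Sum>i<length ds. \<Sum>j<length es. {#hsum (ds ! i) (es ! j)#})"
      by (simp add: sum.cartesian_product)
    also have "\<dots> = (\<Sum>i<length ds. image_mset (hsum (ds ! i)) (mset es))"
      using sum_nth_mset[of "\<lambda>e. {#hsum d e#}" es for d] by (simp add: image_mset_eq_sum)
    also have "\<dots> = hprod_mset (mset ds) (mset es)"
      using sum_nth_mset[of "\<lambda>d. image_mset (hsum d) (mset es)" ds] by (simp add: hprod_mset_def)
    finally show ?thesis .
  qed
  ultimately show ?thesis using assms by (simp add: hprod_eq omega_sum_eq_osum)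
qed

text \<open>A smaller length would be 0 or below \<open>k\<close> copies of some
  \<open>omega_pow b\<close> with \<open>b < hsum d e\<close>. By \<open>less_hsumD\<close> one
  exponent can be lowered with the Hessenberg sum still at least \<open>b\<close>, and
  \<open>k\<close> copies of the lowered power fit into that side of the rectangle.\<close>

lemma omega_pow_hsum_le_ol:
  fixes d e :: "'a ordinal"
  shows "omega_pow (hsum d e) \<le> ol prod_le ({..<omega_pow d} \<times> {..<omega_pow e})"
proof -
  have step: False
    if IH: "omega_pow (hsum d' e') \<le> ol prod_le ({..<omega_pow d'} \<times> {..<omega_pow e'})"
      and de: "d' < d \<and> e' = e \<or> d' = d \<and> e' < e" and b: "b \<le> hsum d' e'"
      and c: "ol prod_le ({..<omega_pow d} \<times> {..<omega_pow e}) < omega_sum (replicate k b)"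
    for d e d' e' b :: "'a ordinal" and k
  proof -
    \<comment> \<open>The multiplicity \<open>k\<close> goes to the factor whose exponent was
      lowered.\<close>
    define k1 where "k1 = (if d' < d then k else 1)"
    define k2 where "k2 = (if d' < d then 1 else k)"
    have s: "sorted (rev (replicate k x))" for k and x :: "'a ordinal" by simp
    have rep: "omega_sum (replicate k x) = osum (replicate_mset k x)" for k and x :: "'a ordinal"
      by (simp add: omega_sum_eq_osum)
    have "image_mset f (replicate_mset k x) = replicate_mset k (f x)" for f :: "'a ordinal \<Rightarrow> 'a ordinal" and k x
      by (induction k) auto
    then have "hprod_mset (replicate_mset k1 d') (replicate_mset k2 e') = replicate_mset k (hsum d' e')"
      by (auto simp: k1_def k2_def)
    then have "hprod (omega_sum (replicate k1 d')) (omega_sum (replicate k2 e')) = omega_sum (replicate k (hsum d' e'))"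
      by (simp add: rep hprod_eq)
    then have "omega_sum (replicate k b) \<le> hprod (omega_sum (replicate k1 d')) (omega_sum (replicate k2 e'))"
      using omega_sum_replicate_mono[OF b] by simp
    also have "\<dots> \<le> ol prod_le ({..<omega_sum (replicate k1 d')} \<times> {..<omega_sum (replicate k2 e')})"
      by (rule hprod_le_ol_lists[OF s s]) (use IH in auto)
    also have "\<dots> \<le> ol prod_le ({..<omega_pow d} \<times> {..<omega_pow e})"
    proof (rule ol_prod_mono[OF _ order.refl])
      have "omega_sum (replicate k1 d') \<le> omega_pow d" "omega_sum (replicate k2 e') \<le> omega_pow e"
        using omega_sum_replicate_less[of d' d k] omega_sum_replicate_less[of e' e k] de
        by (auto simp: k1_def k2_def)
      then show "{..<omega_sum (replicate k1 d')} \<times> {..<omega_sum (replicate k2 e')} \<subseteq> {..<omega_pow d} \<times> {..<omega_pow e}"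
        by (intro Sigma_mono) auto
    qed
    finally show False using c by simp
  qed
  show ?thesis
  proof (induction d arbitrary: e rule: less_induct)
    case (less d)
    note IHd = less
    show ?case
    proof (induction e rule: less_induct)
      case (less e)
      note IHe = less
      let ?c = "ol prod_le ({..<omega_pow d} \<times> {..<omega_pow e}) :: 'a ordinal"
      show ?case
      proof (rule ccontr)
        assume "\<not> ?thesis"
        then have "?c < omega_pow (hsum d e)" by simp
        then consider "?c = 0" | b k where "b < hsum d e" "?c < omega_sum (replicate k b)"
          using less_omega_powD by blast
        then show False
        proof cases
          case 1
          then have "{..<omega_pow d} \<times> {..<omega_pow e} = {}"
            by (rule ol_eq_zeroD[OF well_poD(1)[OF well_po_prod_le] small_prod[OF order.refl]])
          moreover have "0 \<in> {..<omega_pow d}" "0 \<in> {..<omega_pow e}" by (simp_all add: omega_pow_facts(1))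
          ultimately show False by blast
        next
          case 2
          from less_hsumD[OF 2(1)] show False
            using step[OF IHd _ _ 2(2)] step[OF IHe _ _ 2(2)] by blast
        qed
      qed
    qed
  qed
qed

lemma hprod_le_ol: "hprod a b \<le> ol prod_le ({..<a} \<times> {..<b})" for a b :: "'a ordinal"
proof -
  have c: "sorted (rev (cnf a))" "omega_sum (cnf a) = a" for a :: "'a ordinal"
    using osum_exps[of a] by (simp_all add: cnf_eq osum_def)
  show ?thesis
    using hprod_le_ol_lists[OF c(1) c(1), of a b] omega_pow_hsum_le_ol by (simp add: c(2))
qed

end

section \<open>Long intersections\<close>

lemma eqpoll_fibre: "bij_betw f A B \<Longrightarrow> {z \<in> A. P (f z)} \<approx> {w \<in> B. P w}"
  unfolding eqpoll_def
  by (rule exI[of _ f]) (auto simp: bij_betw_def inj_on_def)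

lemma eqpoll_singleton_Times: "{c} \<times> A \<approx> A"
  unfolding eqpoll_def by (rule exI[of _ snd]) (auto simp: bij_betw_def inj_on_def)

lemma infinite_Times_eqpoll:
  assumes "infinite B" "A \<noteq> {}" "A \<lesssim> B"
  shows "A \<times> B \<approx> B"
proof -
  have "|A \<times> B| =o |B|"
    using card_of_Times_infinite[OF assms(1,2)] assms(3) unfolding lepoll_iff_ordLeq by blast
  then show ?thesis unfolding eqpoll_def by (simp add: card_of_ordIso[symmetric])
qed

lemma strict_mono_if_iff:
  fixes g :: "'b \<Rightarrow> 'c :: linorder" and f :: "'b \<Rightarrow> 'd :: linorder"
  assumes "\<And>x y. x \<in> X \<Longrightarrow> y \<in> X \<Longrightarrow> g x \<le> g y \<longleftrightarrow> f x \<le> f y" "x \<in> X" "y \<in> X"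
  shows "g x < g y \<longleftrightarrow> f x < f y"
  using assms(1)[OF assms(3,2)] by (simp add: not_le[symmetric])

context infinite_type
begin

text \<open>The type is at most \<open>k\<close> for a subset of \<open>{..<k}\<close>, and at least
  \<open>k\<close> because a smaller ordinal has fewer elements.\<close>

lemma subset_initial_ord_rank:
  fixes k :: "'a ordinal"
  assumes k: "initial_ord k" and Z: "Z \<subseteq> {..<k}" "Z \<approx> {..<k}"
  obtains h where "bij_betw h Z {..<k}" "\<And>x y. x \<in> Z \<Longrightarrow> y \<in> Z \<Longrightarrow> h x \<le> h y \<longleftrightarrow> x \<le> y"
proof -
  obtain t :: "'a ordinal" and h where h: "bij_betw h Z {..<t}"
    "\<And>x y. x \<in> Z \<Longrightarrow> y \<in> Z \<Longrightarrow> h x \<le> h y \<longleftrightarrow> id x \<le> id y"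
    using collapse[OF inj_on_id small_subset[OF Z(1) card_lessThan_ordinal]] by metis
  have inv: "inv_into Z h x \<in> Z" "h (inv_into Z h x) = x" if "x < t" for x
    using h(1) that by (auto simp: bij_betw_def inv_into_into f_inv_into_f)
  have "t \<le> k"
  proof (rule strict_mono_on_ordinal_le[of t "inv_into Z h"])
    fix x y assume xy: "x < y" "y < t"
    then have "x < t" by simp
    show "inv_into Z h x < inv_into Z h y"
      using strict_mono_if_iff[of Z h id, OF h(2) inv(1)[OF \<open>x < t\<close>] inv(1)[OF xy(2)]] inv(2)[OF \<open>x < t\<close>] inv(2)[OF xy(2)] xy(1)
      by simp
  next
    show "inv_into Z h x < k" if "x < t" for x using inv(1)[OF that] Z(1) by auto
  qed
  moreover have "\<not> t < k"
  proof
    assume "t < k"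
    have "Z \<approx> {..<t}" using h(1) by (auto simp: eqpoll_def)
    then have "{..<k} \<lesssim> {..<t}" using Z(2) by (meson eqpoll_sym eqpoll_trans eqpoll_imp_lepoll)
    then show False using initial_ord_less[OF k _ \<open>t < k\<close>] by blast
  qed
  ultimately have "t = k" by simp
  then show thesis using that[of h] h by simp
qed

text \<open>Each fibre is a copy of \<open>k\<close>, the fibres follow one another by index, and
  \<open>times_rank\<close> reads off the type.\<close>

lemma fibre_rank_bij:
  fixes k b :: "'a ordinal" and A :: "'b \<Rightarrow> 'a ordinal"
  assumes A: "\<And>z. z \<in> Z \<Longrightarrow> A z < b"
    and h: "\<And>c. c < b \<Longrightarrow> bij_betw (h c) {z \<in> Z. A z = c} {..<k}"
  shows "bij_betw (\<lambda>z. k * A z + h (A z) z) Z {..<k * b}"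
proof -
  have hk: "h (A z) z < k" if "z \<in> Z" for z
    using h[OF A[OF that]] that by (auto simp: bij_betw_def)
  have "bij_betw (\<lambda>z. (A z, h (A z) z)) Z ({..<b} \<times> {..<k})"
    unfolding bij_betw_def
  proof
    show "inj_on (\<lambda>z. (A z, h (A z) z)) Z"
    proof (rule inj_onI)
      fix x y assume xy: "x \<in> Z" "y \<in> Z" "(A x, h (A x) x) = (A y, h (A y) y)"
      then show "x = y" using h[OF A[OF xy(1)]] by (auto simp: bij_betw_def inj_on_def)
    qed
    have "(c, x) \<in> (\<lambda>z. (A z, h (A z) z)) ` Z" if "c < b" "x < k" for c x
    proof -
      have "x \<in> h c ` {z \<in> Z. A z = c}" using h[OF that(1)] that(2) by (simp add: bij_betw_def)
      then show ?thesis by auto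
    qed
    then show "(\<lambda>z. (A z, h (A z) z)) ` Z = {..<b} \<times> {..<k}" using A hk by auto
  qed
  then have "bij_betw ((\<lambda>(i, x). k * i + x) \<circ> (\<lambda>z. (A z, h (A z) z))) Z {..<k * b}"
    using times_rank(1) bij_betw_trans by blast
  then show ?thesis by (simp add: comp_def)
qed

text \<open>
  \<open>A i z\<close> is the index of the \<open>\<kappa>\<close>-block of \<open>z\<close> in the \<open>i\<close>-th order to be constructed, \<open>S z\<close> its index
  in the long linear extension.
\<close>

lemma ex_block_structure:
  fixes k :: "'a ordinal" and q :: "nat \<Rightarrow> 'a ordinal"
  assumes k: "infinite {..<k}" and "distinct is"
    and "\<forall>i\<in>set is. 0 < q i \<and> {..<q i} \<lesssim> {..<k}"
  shows "\<exists>A S \<tau>. foldr (\<lambda>i s. hprod (q i) s) is 1 \<le> \<tau> \<and>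
    (\<forall>z<k. S z < \<tau>) \<and> (\<forall>t<\<tau>. {z \<in> {..<k}. S z = t} \<approx> {..<k}) \<and>
    (\<forall>i\<in>set is. (\<forall>z<k. A i z < q i) \<and> (\<forall>c<q i. {z \<in> {..<k}. A i z = c} \<approx> {..<k})) \<and>
    (\<forall>z<k. \<forall>z'<k. (S z = S z' \<longrightarrow> (\<forall>i\<in>set is. A i z = A i z')) \<and>
      (S z < S z' \<longrightarrow> (\<exists>i\<in>set is. A i z < A i z')))"
    (is "\<exists>A S \<tau>. ?P is A S \<tau>")
  using assms(2-)
proof (induction "is")
  case Nil
  show ?case
    by (rule exI[of _ "\<lambda>_ _. 0"], rule exI[of _ "\<lambda>_. 0"], rule exI[of _ 1]) (auto simp flip: lessThan_def)
next
  case (Cons i "is")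
  have "\<exists>A S \<tau>. ?P is A S \<tau>" by (rule Cons.IH) (use Cons.prems in simp_all)
  then obtain A S \<tau> where IH: "foldr (\<lambda>i s. hprod (q i) s) is 1 \<le> \<tau>"
    "\<forall>z<k. S z < \<tau>" "\<forall>t<\<tau>. {z \<in> {..<k}. S z = t} \<approx> {..<k}"
    "\<forall>i\<in>set is. (\<forall>z<k. A i z < q i) \<and> (\<forall>c<q i. {z \<in> {..<k}. A i z = c} \<approx> {..<k})"
    "\<forall>z<k. \<forall>z'<k. (S z = S z' \<longrightarrow> (\<forall>i\<in>set is. A i z = A i z')) \<and>
      (S z < S z' \<longrightarrow> (\<exists>i\<in>set is. A i z < A i z'))"
    by (elim exE conjE)
  have q0: "{..<q i} \<noteq> {}" using Cons.prems(2) by auto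
  have qk: "{..<q i} \<lesssim> {..<k}" using Cons.prems(2) by simp
  have "{..<q i} \<times> {..<k} \<approx> {..<k}" by (rule infinite_Times_eqpoll[OF k q0 qk])
  \<comment> \<open>The first component of \<open>p z\<close> becomes the index in the new order
    \<open>i\<close>, the second carries the structure of the other orders. All classes keep the
    cardinality of \<open>k\<close>.\<close>
  then obtain p where p: "bij_betw p {..<k} ({..<q i} \<times> {..<k})"
    using eqpoll_sym unfolding eqpoll_def by blast
  \<comment> \<open>The new long extension arranges the pairs of indices by an optimal extension
    \<open>G\<close> of the product order, which is at least as long as
    \<open>hprod (q i) \<tau>\<close>.\<close>
  define t where "t = (ol prod_le ({..<q i} \<times> {..<\<tau>}) :: 'a ordinal)"
  have "lext prod_le ({..<q i} \<times> {..<\<tau>}) t"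
    unfolding t_def by (rule lext_ol[OF well_po_prod_le small_prod[OF order.refl]])
  then obtain G where G: "bij_betw G ({..<q i} \<times> {..<\<tau>}) {..<t}"
    "\<And>u v. u \<in> {..<q i} \<times> {..<\<tau>} \<Longrightarrow> v \<in> {..<q i} \<times> {..<\<tau>} \<Longrightarrow> (u, v) \<in> prod_le \<Longrightarrow> G u \<le> G v"
    unfolding lext_def by blast
  define A' where "A' j z = (if j = i then fst (p z) else A j (snd (p z)))" for j z
  define sk where "sk = (\<lambda>z. (fst (p z), S (snd (p z))))"
  define S' where "S' z = G (sk z)" for z
  have pz: "fst (p z) < q i" "snd (p z) < k" if "z < k" for z
    using bspec[OF bij_betwE[OF p], of z] that by (auto simp: mem_Times_iff)
  have sk: "sk z \<in> {..<q i} \<times> {..<\<tau>}" if "z < k" for z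
    using pz[OF that] IH(2) by (simp add: sk_def)
  have "i \<notin> set is" using Cons.prems(1) by simp
  have "?P (i # is) A' S' t"
  proof (intro conjI allI impI ballI)
    have "hprod (q i) (foldr (\<lambda>i s. hprod (q i) s) is 1) \<le> hprod (q i) \<tau>"
      using IH(1) by (rule hprod_mono_right)
    also have "\<dots> \<le> t" unfolding t_def by (rule hprod_le_ol)
    finally show "foldr (\<lambda>i s. hprod (q i) s) (i # is) 1 \<le> t" by simp
  next
    fix z assume "z < k"
    then show "S' z < t" using bspec[OF bij_betwE[OF G(1)] sk] by (simp add: S'_def)
  next
    fix u assume "u < t"
    then have "u \<in> G ` ({..<q i} \<times> {..<\<tau>})" using bij_betw_imp_surj_on[OF G(1)] by simp
    then obtain x s where xs: "x < q i" "s < \<tau>" "G (x, s) = u" by auto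
    have "S' z = u \<longleftrightarrow> fst (p z) = x \<and> S (snd (p z)) = s" if "z < k" for z
      using inj_onD[OF bij_betw_imp_inj_on[OF G(1)], of "sk z" "(x, s)"] sk[OF that] xs
      by (auto simp: S'_def sk_def)
    then have "{z \<in> {..<k}. S' z = u} = {z \<in> {..<k}. fst (p z) = x \<and> S (snd (p z)) = s}" by auto
    also have "\<dots> \<approx> {w \<in> {..<q i} \<times> {..<k}. fst w = x \<and> S (snd w) = s}" by (rule eqpoll_fibre[OF p])
    also have "{w \<in> {..<q i} \<times> {..<k}. fst w = x \<and> S (snd w) = s} = {x} \<times> {z \<in> {..<k}. S z = s}"
      using xs by auto
    also have "\<dots> \<approx> {z \<in> {..<k}. S z = s}" by (rule eqpoll_singleton_Times)
    also have "\<dots> \<approx> {..<k}" using IH(3) xs by blast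
    finally show "{z \<in> {..<k}. S' z = u} \<approx> {..<k}" .
  next
    fix j z assume "j \<in> set (i # is)" "z < k"
    then show "A' j z < q j" using pz[of z] IH(4) by (cases "j = i") (simp_all add: A'_def)
  next
    fix j c assume j: "j \<in> set (i # is)" and c: "c < q j"
    show "{z \<in> {..<k}. A' j z = c} \<approx> {..<k}"
    proof (cases "j = i")
      case True
      have "{z \<in> {..<k}. A' j z = c} \<approx> {w \<in> {..<q i} \<times> {..<k}. fst w = c}"
        using eqpoll_fibre[OF p, of "\<lambda>w. fst w = c"] by (simp add: A'_def True)
      also have "{w \<in> {..<q i} \<times> {..<k}. fst w = c} = {c} \<times> {..<k}" using c True by auto
      also have "\<dots> \<approx> {..<k}" by (rule eqpoll_singleton_Times)
      finally show ?thesis .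
    next
      case False
      then have "{z \<in> {..<k}. A j z = c} \<approx> {..<k}" using IH(4) j c by simp
      have "{z \<in> {..<k}. A' j z = c} \<approx> {w \<in> {..<q i} \<times> {..<k}. A j (snd w) = c}"
        using eqpoll_fibre[OF p, of "\<lambda>w. A j (snd w) = c"] False by (simp add: A'_def)
      also have "{w \<in> {..<q i} \<times> {..<k}. A j (snd w) = c} = {..<q i} \<times> {z \<in> {..<k}. A j z = c}" by auto
      also have "\<dots> \<approx> {..<q i} \<times> {..<k}"
        by (rule times_eqpoll_cong[OF eqpoll_refl]) fact
      also have "\<dots> \<approx> {..<k}" by fact
      finally show ?thesis .
    qed
  next
    fix z z' j assume z: "z < k" "z' < k" and eq: "S' z = S' z'" and j: "j \<in> set (i # is)"
    have "sk z = sk z'"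
      using inj_onD[OF bij_betw_imp_inj_on[OF G(1)], of "sk z" "sk z'"] sk[OF z(1)] sk[OF z(2)] eq
      by (auto simp: S'_def)
    then have "fst (p z) = fst (p z')" "S (snd (p z)) = S (snd (p z'))" by (simp_all add: sk_def)
    then show "A' j z = A' j z'"
      using IH(5)[rule_format, OF pz(2)[OF z(1)] pz(2)[OF z(2)]] j by (cases "j = i") (simp_all add: A'_def)
  next
    fix z z' assume z: "z < k" "z' < k" and lt: "S' z < S' z'"
    \<comment> \<open>\<open>G\<close> extends the product order, so a later pair is not below an
      earlier one in both coordinates; one of the indices increases strictly.\<close>
    have "\<not> (sk z', sk z) \<in> prod_le"
      using G(2)[OF sk[OF z(2)] sk[OF z(1)]] lt by (auto simp: S'_def)
    then consider "fst (p z) < fst (p z')" | "S (snd (p z)) < S (snd (p z'))"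
      by (auto simp: prod_le_def sk_def not_le)
    then show "\<exists>j\<in>set (i # is). A' j z < A' j z'"
    proof cases
      case 1
      then show ?thesis by (auto simp: A'_def)
    next
      case 2
      then obtain j where "j \<in> set is" "A j (snd (p z)) < A j (snd (p z'))"
        using IH(5) pz(2)[OF z(1)] pz(2)[OF z(2)] by blast
      moreover have "j \<noteq> i" using \<open>j \<in> set is\<close> \<open>i \<notin> set is\<close> by blast
      ultimately show ?thesis by (auto simp: A'_def)
    qed
  qed
  then show ?case by (intro exI)
qed

text \<open>For the empty relation \<open>lext\<close> is mere equipollence, so
  \<open>lext_combine\<close> counts disjoint unions.\<close>

lemma Sigma_eqpoll_foldr_plus:
  fixes r :: "nat \<Rightarrow> 'a ordinal"
  assumes "distinct is"
  shows "(SIGMA i:set is. {..<r i}) \<approx> {..<foldr (\<lambda>i s. r i + s) is 0}"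
  using assms
proof (induction "is")
  case (Cons i "is")
  have "lext {} ({i} \<times> {..<r i}) (r i)"
    using eqpoll_singleton_Times[of i "{..<r i}"] by (auto simp: lext_def eqpoll_def)
  moreover have "lext {} (SIGMA i:set is. {..<r i}) (foldr (\<lambda>i s. r i + s) is 0)"
    using Cons by (auto simp: lext_def eqpoll_def)
  ultimately have "lext {} ({i} \<times> {..<r i} \<union> (SIGMA i:set is. {..<r i})) (r i + foldr (\<lambda>i s. r i + s) is 0)"
    by (rule lext_combine) (use Cons.prems in auto)
  moreover have "(SIGMA i:set (i # is). {..<r i}) = {i} \<times> {..<r i} \<union> (SIGMA i:set is. {..<r i})" by auto
  ultimately show ?case using lext_eqpoll by (metis (no_types, lifting) foldr_Cons comp_apply)
qed simp

text \<open>\<open>omega_pow m\<close> absorbs \<open>b\<close>, and its multiple by a nonzero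
  \<open>q\<close> begins with one copy of it.\<close>

lemma plus_omega_pow_absorb:
  fixes b q :: "'a ordinal"
  assumes "b < omega_pow m" "0 < q"
  shows "b + omega_pow m * q = omega_pow m * q"
proof -
  have "b + omega_pow m \<le> omega_pow m"
    by (rule ordinal_leI) (use assms in \<open>auto simp: less_plus_iff intro: omega_pow_add_less less_trans\<close>)
  then have "b + omega_pow m = omega_pow m" using le_plus2[of "omega_pow m" b] by simp
  moreover have "1 \<le> q" using assms(2) by (auto simp flip: not_less)
  then obtain q' where "q = 1 + q'" using ex_plus by blast
  ultimately show ?thesis by (simp add: distrib_left_ordinal flip: plus_assoc)
qed

text \<open>\<open>F i\<close> ranks the \<open>i\<close>-th order and \<open>F0\<close> the long
  extension; the last clause is the extension property in contrapositive form. \<open>Inl\<close>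
  holds the block points, \<open>Inr\<close> the additional ones, labelled by the order on whose top
  they sit.\<close>

lemma ex_long_intersection:
  fixes q r :: "nat \<Rightarrow> 'a ordinal" and k d :: "'a ordinal"
  assumes n: "2 \<le> n" and k: "initial_ord k" "infinite {..<k}" "k = omega_pow m"
    and q: "\<And>i. i \<in> {1..n} \<Longrightarrow> 0 < q i" "\<And>i. i \<in> {1..n} \<Longrightarrow> {..<q i} \<lesssim> {..<k}"
    and r: "\<And>i. i \<in> {1..n} \<Longrightarrow> r i < k"
    and d: "{..<d} \<lesssim> {..<ord_sum_upto n r}"
  obtains C :: "('a ordinal + nat \<times> 'a ordinal) set" and F F0 t
  where "small T C"
    "\<And>i. i \<in> {1..n} \<Longrightarrow> bij_betw (F i) C {..<k * q i + r i}"
    "bij_betw F0 C {..<t}" "k * hprod_upto n q + d \<le> t"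
    "\<And>x y. x \<in> C \<Longrightarrow> y \<in> C \<Longrightarrow> F0 x < F0 y \<Longrightarrow> \<exists>i\<in>{1..n}. F i x < F i y"
proof -
  have set_upt: "set [1..<Suc n] = {1..n}" by auto
  obtain A S \<tau> where \<tau>: "hprod_upto n q \<le> \<tau>"
    and S: "\<And>z. z < k \<Longrightarrow> S z < \<tau>" "\<And>t. t < \<tau> \<Longrightarrow> {z \<in> {..<k}. S z = t} \<approx> {..<k}"
    and A: "\<And>i z. i \<in> {1..n} \<Longrightarrow> z < k \<Longrightarrow> A i z < q i"
      "\<And>i c. i \<in> {1..n} \<Longrightarrow> c < q i \<Longrightarrow> {z \<in> {..<k}. A i z = c} \<approx> {..<k}"
    and AS: "\<And>z z' i. z < k \<Longrightarrow> z' < k \<Longrightarrow> S z = S z' \<Longrightarrow> i \<in> {1..n} \<Longrightarrow> A i z = A i z'"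
      "\<And>z z'. z < k \<Longrightarrow> z' < k \<Longrightarrow> S z < S z' \<Longrightarrow> \<exists>i\<in>{1..n}. A i z < A i z'"
  proof -
    have dist: "distinct [1..<Suc n]" by simp
    have q': "\<forall>i\<in>set [1..<Suc n]. 0 < q i \<and> {..<q i} \<lesssim> {..<k}"
      using q unfolding set_upt by blast
    from ex_block_structure[where q = q, OF k(2) dist q', unfolded set_upt, folded hprod_upto_def]
    show thesis by (elim exE conjE) (rule that, assumption, blast+)
  qed
  \<comment> \<open>Each class of block points is ranked by the natural order of
    \<open>{..<k}\<close>, so that points sharing a class are compared alike in all orders.\<close>
  define rank where "rank Z = (SOME h. bij_betw h Z {..<k} \<and> (\<forall>x\<in>Z. \<forall>y\<in>Z. h x \<le> h y \<longleftrightarrow> x \<le> y))" for Z :: "'a ordinal set"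
  have rank: "bij_betw (rank Z) Z {..<k}" "\<And>x y. x \<in> Z \<Longrightarrow> y \<in> Z \<Longrightarrow> rank Z x \<le> rank Z y \<longleftrightarrow> x \<le> y"
    if Z: "Z \<subseteq> {..<k}" "Z \<approx> {..<k}" for Z
  proof -
    obtain h where "bij_betw h Z {..<k}" "\<And>x y. x \<in> Z \<Longrightarrow> y \<in> Z \<Longrightarrow> h x \<le> h y \<longleftrightarrow> x \<le> y"
      using subset_initial_ord_rank[OF k(1) Z] by metis
    then have "\<exists>h. bij_betw h Z {..<k} \<and> (\<forall>x\<in>Z. \<forall>y\<in>Z. h x \<le> h y \<longleftrightarrow> x \<le> y)" by blast
    from someI_ex[OF this, folded rank_def]
    show "bij_betw (rank Z) Z {..<k}" "\<And>x y. x \<in> Z \<Longrightarrow> y \<in> Z \<Longrightarrow> rank Z x \<le> rank Z y \<longleftrightarrow> x \<le> y"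
      by auto
  qed
  define h where "h i c = rank {z \<in> {..<k}. A i z = c}" for i c
  define h0 where "h0 c = rank {z \<in> {..<k}. S z = c}" for c
  have sub: "{z \<in> {..<k}. P z} \<subseteq> {..<k}" for P by auto
  have h: "bij_betw (h i c) {z \<in> {..<k}. A i z = c} {..<k}"
    "x \<in> {z \<in> {..<k}. A i z = c} \<Longrightarrow> y \<in> {z \<in> {..<k}. A i z = c} \<Longrightarrow> h i c x \<le> h i c y \<longleftrightarrow> x \<le> y"
    if "i \<in> {1..n}" "c < q i" for i c x y
    unfolding h_def using rank[OF sub A(2)[OF that]] by simp_all
  have h0: "bij_betw (h0 c) {z \<in> {..<k}. S z = c} {..<k}"
    "x \<in> {z \<in> {..<k}. S z = c} \<Longrightarrow> y \<in> {z \<in> {..<k}. S z = c} \<Longrightarrow> h0 c x \<le> h0 c y \<longleftrightarrow> x \<le> y"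
    if "c < \<tau>" for c x y
    unfolding h0_def using rank[OF sub S(2)[OF that]] by simp_all
  define f where "f i z = k * A i z + h i (A i z) z" for i z
  define f0 where "f0 z = k * S z + h0 (S z) z" for z
  have f_bij: "bij_betw (f i) {..<k} {..<k * q i}" if "i \<in> {1..n}" for i
    unfolding f_def by (rule fibre_rank_bij) (use A(1)[OF that] h(1)[OF that] in auto)
  have f0_bij: "bij_betw f0 {..<k} {..<k * \<tau>}"
    unfolding f0_def by (rule fibre_rank_bij) (use S h0(1) in auto)
  have hk: "h i (A i z) z < k" if "i \<in> {1..n}" "z < k" for i z
    using bij_betwE[OF h(1)[OF that(1) A(1)[OF that]]] that by auto
  have h0k: "h0 (S z) z < k" if "z < k" for z
    using bij_betwE[OF h0(1)[OF S(1)[OF that]]] that by auto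
  have f_less: "\<exists>i\<in>{1..n}. f i z < f i z'" if z: "z < k" "z' < k" and lt: "f0 z < f0 z'" for z z'
  proof -
    have "\<not> f0 z' \<le> f0 z" using lt by simp
    then have "\<not> (S z' < S z \<or> S z' = S z \<and> h0 (S z') z' \<le> h0 (S z) z)"
      unfolding f0_def by (simp add: times_plus_le_iff h0k z)
    then consider "S z < S z'" | "S z = S z'" "\<not> h0 (S z) z' \<le> h0 (S z) z"
      by (cases "S z" "S z'" rule: linorder_cases) auto
    then show ?thesis
    proof cases
      case 1
      then obtain i where i: "i \<in> {1..n}" "A i z < A i z'" using AS(2) z by blast
      then have "\<not> f i z' \<le> f i z" unfolding f_def using times_plus_le_iff hk[OF i(1)] z by auto
      then show ?thesis using i(1) not_le by blast
    next
      case 2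
      \<comment> \<open>Within one class of \<open>S\<close> all indices agree, so every order
        compares \<open>z\<close> and \<open>z'\<close> naturally; order 1 serves as
        witness.\<close>
      then have zz: "z < z'" using h0(2)[OF S(1)[OF z(1)], of z' z] z by auto
      have i: "1 \<in> {1..n}" using n by simp
      have eq: "A 1 z = A 1 z'" using AS(1)[OF z 2(1) i] .
      have "\<not> h 1 (A 1 z) z' \<le> h 1 (A 1 z) z"
        using h(2)[OF i A(1)[OF i z(1)], of z' z] z eq zz by auto
      then have "\<not> f 1 z' \<le> f 1 z"
        unfolding f_def using times_plus_le_iff hk[OF i] z eq by auto
      then show ?thesis using i not_le by blast
    qed
  qed
  define B where "B = (SIGMA i:{1..n}. {..<r i})"
  define s where "s = ord_sum_upto n r"
  have B_eq: "B \<approx> {..<s}"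
    unfolding B_def s_def ord_sum_upto_def using Sigma_eqpoll_foldr_plus[of "[1..<Suc n]" r] unfolding set_upt by simp
  have s_less: "s < k"
    unfolding s_def ord_sum_upto_def k(3) by (rule foldr_plus_less_omega_pow) (use r k(3) in auto)
  \<comment> \<open>The arrangement must have exactly the cardinality of \<open>B\<close>: a
    \<open>d\<close> up to \<open>s\<close> is replaced by \<open>s\<close>, and a \<open>d\<close>
    beyond \<open>s\<close> is equipotent to \<open>s\<close> by hypothesis.\<close>
  obtain d' where d': "d \<le> d'" "B \<approx> {..<d'}"
  proof (cases "d \<le> s")
    case True
    then show ?thesis using that B_eq by blast
  next
    case False
    then have "{..<s} \<lesssim> {..<d}" by (intro lepoll_lessThan_mono) simp
    then have "{..<d} \<approx> {..<s}" using d lepoll_antisym unfolding s_def by blast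
    then show ?thesis using that[of d] B_eq eqpoll_sym eqpoll_trans by blast
  qed
  then obtain w where w: "bij_betw w B {..<d'}" unfolding eqpoll_def by blast
  define Bi where "Bi i = {i} \<times> {..<r i}" for i
  have Bi_sub: "Bi i \<subseteq> B" if "i \<in> {1..n}" for i using that by (auto simp: Bi_def B_def)
  have small_B: "small T B"
  proof -
    have "B \<lesssim> {..<s}" using B_eq by (rule eqpoll_imp_lepoll)
    then have "|B| \<le>o |{..<s}|" unfolding lepoll_iff_ordLeq .
    then show ?thesis using card_lessThan_ordinal[of s] ordLeq_transitive by blast
  qed
  \<comment> \<open>The additional points foreign to order \<open>i\<close> keep the arrangement
    \<open>w\<close>. Their type is below \<open>k\<close> and will be absorbed by the blocks above
    them.\<close>
  have "\<exists>u b. bij_betw u (B - Bi i) {..<b} \<and> b < k \<and>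
      (\<forall>x\<in>B - Bi i. \<forall>y\<in>B - Bi i. u x \<le> u y \<longleftrightarrow> w x \<le> w y)" for i
  proof -
    have D: "B - Bi i \<subseteq> B" by auto
    have "inj_on w (B - Bi i)" using w D by (auto simp: bij_betw_def intro: inj_on_subset)
    then obtain b :: "'a ordinal" and u where u: "bij_betw u (B - Bi i) {..<b}"
      "\<And>x y. x \<in> B - Bi i \<Longrightarrow> y \<in> B - Bi i \<Longrightarrow> u x \<le> u y \<longleftrightarrow> w x \<le> w y"
      using collapse[OF _ small_subset[OF D small_B]] by metis
    have "{..<b} \<approx> B - Bi i" using u(1) eqpoll_sym unfolding eqpoll_def by blast
    also have "B - Bi i \<lesssim> {..<s}" using subset_imp_lepoll[OF D] B_eq by (rule lepoll_trans2)
    finally have "{..<b} \<lesssim> {..<s}" by (simp add: lepoll_trans1)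
    then have "b < k" using initial_ord_less[OF k(1) _ s_less] by blast
    then show ?thesis using u by blast
  qed
  then obtain u b where u: "\<And>i. bij_betw (u i) (B - Bi i) {..<b i}" and b: "\<And>i. b i < k"
    and u_iff: "\<And>i x y. x \<in> B - Bi i \<Longrightarrow> y \<in> B - Bi i \<Longrightarrow> u i x \<le> u i y \<longleftrightarrow> w x \<le> w y"
    by metis
  define C :: "('a ordinal + nat \<times> 'a ordinal) set" where "C = {..<k} <+> B"
  \<comment> \<open>From bottom to top: foreign additional points, blocks, own additional points. By
    absorption the own points start at \<open>k * q i\<close>.\<close>
  define F where "F i = case_sum (\<lambda>z. b i + f i z) (\<lambda>p. if fst p = i then k * q i + snd p else u i p)" for i
  define F0 where "F0 = case_sum f0 (\<lambda>p. k * \<tau> + w p)"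
  have inl: "bij_betw projl (Inl ` Z) Z" for Z :: "'a ordinal set"
    by (auto simp: bij_betw_def inj_on_def image_image)
  have inr: "bij_betw projr (Inr ` Z) Z" for Z :: "(nat \<times> 'a ordinal) set"
    by (auto simp: bij_betw_def inj_on_def image_image)
  have F_bij: "bij_betw (F i) C {..<k * q i + r i}" if i: "i \<in> {1..n}" for i
  proof -
    have ne: "fst p \<noteq> i" if "p \<in> B - Bi i" for p
    proof
      assume "fst p = i"
      then have "p \<in> Bi i" using that by (cases p) (auto simp: B_def Bi_def)
      then show False using that by blast
    qed
    have "bij_betw (F i) (Inr ` (B - Bi i) \<union> Inl ` {..<k}) {..<b i + k * q i}"
      by (rule bij_betw_plus_combine[OF bij_betw_trans[OF inr u] bij_betw_trans[OF inl f_bij[OF i]]])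
        (use ne in \<open>auto simp: F_def\<close>)
    also have "b i + k * q i = k * q i" unfolding k(3) by (rule plus_omega_pow_absorb) (use b k(3) q(1)[OF i] in auto)
    finally have 1: "bij_betw (F i) (Inr ` (B - Bi i) \<union> Inl ` {..<k}) {..<k * q i}" .
    have "bij_betw snd (Bi i) {..<r i}" by (auto simp: Bi_def bij_betw_def inj_on_def)
    then have 2: "bij_betw (snd \<circ> projr) (Inr ` Bi i) {..<r i}" using bij_betw_trans[OF inr] by blast
    have "bij_betw (F i) ((Inr ` (B - Bi i) \<union> Inl ` {..<k}) \<union> Inr ` Bi i) {..<k * q i + r i}"
      by (rule bij_betw_plus_combine[OF 1 2]) (auto simp: F_def Bi_def)
    moreover have "(Inr ` (B - Bi i) \<union> Inl ` {..<k}) \<union> Inr ` Bi i = C"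
      using Bi_sub[OF i] by (auto simp: C_def)
    ultimately show ?thesis by simp
  qed
  have F0_bij: "bij_betw F0 C {..<k * \<tau> + d'}"
    unfolding C_def Plus_def
    by (rule bij_betw_plus_combine[OF bij_betw_trans[OF inl f0_bij] bij_betw_trans[OF inr w]]) (auto simp: F0_def)
  have F_top: "F i (Inr (i, x)) \<ge> k * q i" for i x by (simp add: F_def)
  have F_low: "F i v < k * q i" if "i \<in> {1..n}" "v \<in> C" "v \<notin> Inr ` Bi i" for i v
  proof -
    have "b i + k * q i = k * q i"
      unfolding k(3) by (rule plus_omega_pow_absorb) (use b k(3) q(1)[OF that(1)] in auto)
    moreover have "F i v < b i + k * q i"
    proof (cases v)
      case (Inl z)
      then have "f i z < k * q i" using that(2) bij_betwE[OF f_bij[OF that(1)]] by (auto simp: C_def)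
      then show ?thesis by (simp add: F_def Inl)
    next
      case (Inr p)
      then have p: "p \<in> B - Bi i" using that by (auto simp: C_def)
      then have "fst p \<noteq> i" by (auto simp: B_def Bi_def)
      moreover have "u i p < b i" using p bij_betwE[OF u[of i]] by auto
      then have "u i p < b i + k * q i" using le_plus by (rule less_le_trans)
      ultimately show ?thesis by (simp add: F_def Inr)
    qed
    ultimately show ?thesis by simp
  qed
  have F_less: "\<exists>i\<in>{1..n}. F i x < F i y" if x: "x \<in> C" and y: "y \<in> C" and lt: "F0 x < F0 y" for x y
  proof (cases y)
    case (Inl z')
    then have z': "z' < k" using y by (auto simp: C_def)
    have "F0 y < k * \<tau>" using Inl z' bij_betwE[OF f0_bij] by (auto simp: F0_def)
    then have x_low: "F0 x < k * \<tau>" using lt by (rule less_trans[rotated])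
    obtain z where z: "x = Inl z"
    proof (cases x)
      case (Inr p)
      have "k * \<tau> \<le> F0 x" unfolding Inr F0_def by simp
      then show ?thesis using x_low leD by blast
    qed (use that in blast)
    then have "z < k" using x by (auto simp: C_def)
    then show ?thesis using f_less[of z z'] z' lt z Inl by (auto simp: F0_def F_def)
  next
    case (Inr p)
    then obtain i e where p: "p = (i, e)" "i \<in> {1..n}" "e < r i" using y by (auto simp: C_def B_def)
    show ?thesis
    proof (cases "x \<in> Inr ` Bi i")
      case False
      then have "F i x < k * q i" using F_low[OF p(2) x] by blast
      also have "\<dots> \<le> F i y" using F_top p Inr by simp
      finally show ?thesis using p(2) by blast
    next
      case True
      then obtain e' where x': "x = Inr (i, e')" "e' < r i" by (auto simp: Bi_def)
      \<comment> \<open>Both points are own points of order \<open>i\<close>; in any other order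
        they are foreign and follow \<open>w\<close>. Another order exists as \<open>n\<close> is at
        least 2.\<close>
      obtain j where j: "j \<in> {1..n}" "j \<noteq> i"
      proof (cases "i = 1")
        case True
        then show ?thesis using that[of 2] n by simp
      next
        case False
        then show ?thesis using that[of 1] n by simp
      qed
      have in_B: "(i, e) \<in> B - Bi j" "(i, e') \<in> B - Bi j" using p x' j by (auto simp: B_def Bi_def)
      have "w (i, e') < w (i, e)" using lt x' Inr p by (simp add: F0_def)
      then have "u j (i, e') < u j (i, e)" using u_iff[OF in_B] by (simp add: not_le[symmetric])
      then show ?thesis using j x' Inr p by (auto simp: F_def)
    qed
  qed
  have small_C: "small T C"
    unfolding C_def by (intro small_Plus card_lessThan_ordinal small_B)
  have "k * hprod_upto n q + d \<le> k * \<tau> + d'"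
    by (rule plus_mono[OF times_mono_right[OF \<tau>] d'(1)])
  from small_C F_bij F0_bij this F_less show thesis by (rule that)
qed

text \<open>The \<open>GREATEST\<close> is attained by the theorem of de Jongh and Parikh, and
  \<open>lext_le_ol\<close> bounds every other extension.\<close>

lemma wpo_length_eq_ol:
  fixes X :: "'a set"
  assumes R: "well_po R X" "R \<subseteq> X \<times> X"
  shows "wpo_length X R = ol R X"
proof -
  have small: "small T X" by (rule card_of_mono1) simp
  show ?thesis
    unfolding wpo_length_def
  proof (rule Greatest_equality)
    obtain f where f: "bij_betw f X {..<ol R X :: 'a ordinal}" "\<forall>x\<in>X. \<forall>y\<in>X. (x, y) \<in> R \<longrightarrow> f x \<le> f y"
      using lext_ol[OF R(1) small] unfolding lext_def by blast
    define s where "s = {(x, y). x \<in> X \<and> y \<in> X \<and> f x \<le> f y}"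
    have "inj_on f X" using f(1) by (simp add: bij_betw_def)
    note wo = Well_order_inj_on[OF this s_def]
    have "R \<subseteq> s" using R(2) f(2) by (auto simp: s_def)
    moreover have "otype s = (ol R X :: 'a ordinal)"
      by (rule otype_eqI[of f]) (use f(1) wo(2) in \<open>auto simp: s_def\<close>)
    ultimately show "\<exists>s. well_order_on X s \<and> R \<subseteq> s \<and> ol R X = (otype s :: 'a ordinal)" using wo(3) by metis
  next
    fix a :: "'a ordinal" assume "\<exists>s. well_order_on X s \<and> R \<subseteq> s \<and> a = otype s"
    then obtain s where s: "well_order_on X s" "R \<subseteq> s" "a = otype s" by blast
    have F: "Field s = X" and W: "Well_order s" using well_order_on_Well_order[OF s(1)] by auto
    obtain f where f: "bij_betw f (Field s) {..<a}"
      "\<And>x y. x \<in> Field s \<Longrightarrow> y \<in> Field s \<Longrightarrow> (x, y) \<in> s \<longleftrightarrow> f x \<le> f y"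
      using otype_rank[OF W] small unfolding F s(3) by metis
    have "lext R X a" unfolding lext_def using f s(2) F by blast
    then show "a \<le> ol R X" by (rule lext_le_ol[OF well_poD(1)[OF R(1)] small])
  qed
qed

lemma rank_order_wpo:
  fixes f :: "'a \<Rightarrow> 'a ordinal"
  assumes f: "bij_betw f X {..<a}" and R: "R = {(x, y). x \<in> X \<and> y \<in> X \<and> f x \<le> f y}"
  shows "wpo_on X R" "linear_order_on X R" "wpo_length X R = a"
proof -
  have inj: "inj_on f X" using f by (simp add: bij_betw_def)
  note wo = Well_order_inj_on[OF inj R]
  show lin: "linear_order_on X R" using wo(3) by (simp add: well_order_on_def)
  have "finite A" if A: "A \<subseteq> X" "\<forall>x\<in>A. \<forall>y\<in>A. (x, y) \<in> R \<longrightarrow> x = y" for A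
  proof -
    have "x = y" if "x \<in> A" "y \<in> A" for x y
      using A that linear[of "f x" "f y"] unfolding R by blast
    then have sub: "A \<subseteq> {x}" if "x \<in> A" for x using that by blast
    show ?thesis
    proof (cases "A = {}")
      case False
      then obtain x where "x \<in> A" by blast
      then show ?thesis using finite_subset[OF sub] by simp
    qed simp
  qed
  then show wpo: "wpo_on X R"
    unfolding wpo_on_def using lin wo(3) by (auto simp: well_order_on_def linear_order_on_def)
  have small: "small T X" by (rule card_of_mono1) simp
  note w = well_po_if_wpo_on[OF wpo]
  have "R \<subseteq> X \<times> X" unfolding R by auto
  then have len: "wpo_length X R = ol R X" by (rule wpo_length_eq_ol[OF w])
  obtain g where g: "bij_betw g X {..<ol R X :: 'a ordinal}" "\<forall>x\<in>X. \<forall>y\<in>X. (x, y) \<in> R \<longrightarrow> g x \<le> g y"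
    using lext_ol[OF w small] unfolding lext_def by blast
  \<comment> \<open>A total order has no proper linear extension.\<close>
  have iff: "g x \<le> g y \<longleftrightarrow> f x \<le> f y" if xy: "x \<in> X" "y \<in> X" for x y
  proof
    assume le: "g x \<le> g y"
    show "f x \<le> f y"
    proof (rule ccontr)
      assume "\<not> f x \<le> f y"
      then have "g y \<le> g x" "x \<noteq> y" using g(2) xy by (auto simp: R)
      then have "g x = g y" using le by simp
      then show False using g(1) xy \<open>x \<noteq> y\<close> by (auto simp: bij_betw_def inj_on_def)
    qed
  qed (use g(2) xy in \<open>auto simp: R\<close>)
  have "ol R X \<le> a" by (rule bij_betw_lessThan_unique[OF g(1) f]) (use iff in auto)
  moreover have "a \<le> ol R X" by (rule bij_betw_lessThan_unique[OF f g(1)]) (use iff in auto)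
  ultimately show "wpo_length X R = a" using len by simp
qed

text \<open>The carrier has to lie in \<open>'a\<close>, the type that indexes the ordinals, so
  \<open>C\<close> is moved there along an injection.\<close>

lemma ex_linear_orders:
  fixes C :: "'c set" and F :: "nat \<Rightarrow> 'c \<Rightarrow> 'a ordinal" and \<alpha> :: "nat \<Rightarrow> 'a ordinal"
  assumes small: "small T C" and n: "1 \<le> n"
    and F: "\<And>i. i \<in> {1..n} \<Longrightarrow> bij_betw (F i) C {..<\<alpha> i}" and F0: "bij_betw F0 C {..<t}"
    and less: "\<And>x y. x \<in> C \<Longrightarrow> y \<in> C \<Longrightarrow> F0 x < F0 y \<Longrightarrow> \<exists>i\<in>{1..n}. F i x < F i y"
  obtains X :: "'a set" and R where
    "\<forall>i\<in>{1..n}. wpo_on X (R i) \<and> linear_order_on X (R i) \<and> wpo_length X (R i) = \<alpha> i"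
    "t \<le> wpo_length X (\<Inter>i\<in>{1..n}. R i)"
proof -
  obtain e :: "'c \<Rightarrow> 'a" where e: "inj_on e C"
    using small card_of_ordLeq[of C "UNIV :: 'a set"] by blast
  define X where "X = e ` C"
  define g where "g = inv_into C e"
  have g: "bij_betw g X C" unfolding X_def g_def
    by (rule bij_betw_inv_into) (use e in \<open>simp add: bij_betw_def\<close>)
  define R where "R i = {(x, y). x \<in> X \<and> y \<in> X \<and> (F i \<circ> g) x \<le> (F i \<circ> g) y}" for i
  have R: "wpo_on X (R i) \<and> linear_order_on X (R i) \<and> wpo_length X (R i) = \<alpha> i" if "i \<in> {1..n}" for i
    using rank_order_wpo[OF bij_betw_trans[OF g F[OF that]] R_def] by blast
  define Q where "Q = (\<Inter>i\<in>{1..n}. R i)"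
  have wQ: "well_po Q X" unfolding Q_def
    by (rule well_po_INT) (use n R well_po_if_wpo_on in auto)
  have "1 \<in> {1..n}" using n by simp
  then have "Q \<subseteq> X \<times> X" unfolding Q_def R_def by auto
  then have len: "wpo_length X Q = ol Q X" by (rule wpo_length_eq_ol[OF wQ])
  have smallX: "small T X" by (rule card_of_mono1) simp
  have "lext Q X t"
    unfolding lext_def
  proof (intro exI conjI ballI impI)
    show "bij_betw (F0 \<circ> g) X {..<t}" by (rule bij_betw_trans[OF g F0])
    fix x y assume xy: "x \<in> X" "y \<in> X" "(x, y) \<in> Q"
    have gC: "g x \<in> C" "g y \<in> C" using g xy by (auto simp: bij_betw_def)
    have "\<not> F0 (g y) < F0 (g x)"
    proof
      assume "F0 (g y) < F0 (g x)"
      then obtain i where i: "i \<in> {1..n}" "F i (g y) < F i (g x)" using less[OF gC(2,1)] by blast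
      then have "(x, y) \<in> R i" using xy by (auto simp: Q_def)
      then have "F i (g x) \<le> F i (g y)" by (simp add: R_def)
      then show False using i(2) leD by blast
    qed
    then show "(F0 \<circ> g) x \<le> (F0 \<circ> g) y" by simp
  qed
  then have "t \<le> ol Q X" by (rule lext_le_ol[OF well_poD(1)[OF wQ] smallX])
  then show thesis using that[of X R] R len unfolding Q_def by simp
qed

end

lemma least_strict_upper_boundI:
  assumes "\<And>c. c \<in> C \<Longrightarrow> c < u" "\<And>v. v < u \<Longrightarrow> \<exists>c\<in>C. v \<le> c"
  shows "least_strict_upper_bound C u"
  unfolding least_strict_upper_bound_def using assms by (meson leD not_le)

theorem theorem1p1:
  fixes n :: nat
    and \<alpha> q r :: "nat \<Rightarrow> 'a ordinal"
    and \<kappa> :: "'a ordinal"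
  assumes "n \<ge> 2"
    and "\<And>i. i \<in> {1..n} \<Longrightarrow> infinite {..<\<alpha> i}"
    and "\<And>i. i \<in> {1..n} \<Longrightarrow> ord_card (\<alpha> i) = \<kappa>"
    and "\<And>i. i \<in> {1..n} \<Longrightarrow> \<alpha> i = \<kappa> * q i + r i"
    and "\<And>i. i \<in> {1..n} \<Longrightarrow> r i < \<kappa>"
  shows "least_strict_upper_bound
      {wpo_length X (\<Inter>i\<in>{1..n}. R i) | (X :: 'a set) (R :: nat \<Rightarrow> 'a rel).
        \<forall>i\<in>{1..n}. wpo_on X (R i) \<and> wpo_length X (R i) = \<alpha> i}
      (\<kappa> * hprod_upto n q + next_initial (ord_sum_upto n r))
    \<and> least_strict_upper_bound
      {wpo_length X (\<Inter>i\<in>{1..n}. R i) | (X :: 'a set) (R :: nat \<Rightarrow> 'a rel).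
        \<forall>i\<in>{1..n}. wpo_on X (R i) \<and> linear_order_on X (R i) \<and> wpo_length X (R i) = \<alpha> i}
      (\<kappa> * hprod_upto n q + next_initial (ord_sum_upto n r))"
proof -
  have one: "1 \<in> {1..n}" and n1: "1 \<le> n" using assms(1) by auto
  have "infinite (UNIV :: 'a set)"
    using card_of_ordLeq_infinite[OF card_lessThan_ordinal assms(2)[OF one]] .
  then interpret infinite_type "TYPE('a)" by unfold_locales
  have init: "initial_ord \<kappa>" using initial_ord_card[of "\<alpha> 1"] assms(3)[OF one] by simp
  have \<kappa>_eq: "{..<\<kappa>} \<approx> {..<\<alpha> i}" if "i \<in> {1..n}" for i
    using ord_card_eqpoll[of "\<alpha> i"] assms(3)[OF that] by simp
  have inf: "infinite {..<\<kappa>}" using eqpoll_finite_iff[OF \<kappa>_eq[OF one]] assms(2)[OF one] by simp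
  obtain m where m: "\<kappa> = omega_pow m" using infinite_initial_ord_eq_omega_pow[OF init inf] .
  have \<kappa>0: "0 < \<kappa>" using m omega_pow_facts(1) by simp
  have q0: "0 < q i" if i: "i \<in> {1..n}" for i
  proof (rule ccontr)
    assume "\<not> 0 < q i"
    then have "q i = 0" by (simp add: ordinal_pos_iff)
    then have "\<alpha> i < \<kappa>" using assms(4,5)[OF i] by simp
    moreover have "\<kappa> \<le> \<alpha> i" using ord_card_le[of "\<alpha> i" "\<alpha> i"] assms(3)[OF i] by simp
    ultimately show False by simp
  qed
  have q_le: "{..<q i} \<lesssim> {..<\<kappa>}" if i: "i \<in> {1..n}" for i
  proof -
    have "q i \<le> \<kappa> * q i" by (rule le_times[OF \<kappa>0])
    also have "\<dots> \<le> \<alpha> i" using assms(4)[OF i] by simp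
    finally have "{..<q i} \<lesssim> {..<\<alpha> i}" by (rule lepoll_lessThan_mono)
    then show ?thesis using \<kappa>_eq[OF i] by (meson eqpoll_sym lepoll_trans2)
  qed
  define s where "s = ord_sum_upto n r"
  define u where "u = \<kappa> * hprod_upto n q + next_initial s"
  have s_less: "s < \<kappa>"
    unfolding s_def ord_sum_upto_def m by (rule foldr_plus_less_omega_pow) (use assms(5) m in auto)
  have upper: "wpo_length X (\<Inter>i\<in>{1..n}. R i) < u"
    if R: "\<forall>i\<in>{1..n}. wpo_on X (R i) \<and> wpo_length X (R i) = \<alpha> i" for X :: "'a set" and R
  proof -
    have w: "well_po (R i) X" "R i \<subseteq> X \<times> X" if "i \<in> {1..n}" for i
      using well_po_if_wpo_on[of X "R i"] partial_order_onD(4)[of X "R i"] R that unfolding wpo_on_def by blast+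
    have len: "ol (R i) X = \<kappa> * q i + r i" if "i \<in> {1..n}" for i
      using wpo_length_eq_ol[OF w[OF that]] R that assms(4)[OF that] by simp
    have "well_po (\<Inter>i\<in>{1..n}. R i) X" by (rule well_po_INT) (use w(1) n1 in auto)
    moreover have "(\<Inter>i\<in>{1..n}. R i) \<subseteq> X \<times> X" using w(2)[OF one] one by blast
    ultimately have "wpo_length X (\<Inter>i\<in>{1..n}. R i) = ol (\<Inter>i\<in>{1..n}. R i) X" by (rule wpo_length_eq_ol)
    also have "\<dots> < u"
      unfolding u_def s_def
      by (rule ol_INT_less[OF n1 card_of_mono1[OF subset_UNIV] init m w(1) len assms(5)])
    finally show ?thesis .
  qed
  \<comment> \<open>The witnesses are linear, so they serve for both classes; the upper bound covers
    the linear class as a part of the other.\<close>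
  have lower: "\<exists>(X :: 'a set) R. (\<forall>i\<in>{1..n}. wpo_on X (R i) \<and> linear_order_on X (R i) \<and> wpo_length X (R i) = \<alpha> i) \<and>
      v \<le> wpo_length X (\<Inter>i\<in>{1..n}. R i)" if v: "v < u" for v
  proof -
    have "0 < next_initial s" using next_initial_facts(3)[OF init s_less] by (metis ordinal_pos_iff ordinal_not_less_zero)
    \<comment> \<open>If \<open>v\<close> lies below the product term, \<open>d = 0\<close> will do,
      which is where positivity of \<open>next_initial s\<close> enters.\<close>
    then obtain d where d: "d < next_initial s" "v \<le> \<kappa> * hprod_upto n q + d"
      using v unfolding u_def less_plus_iff by (metis le_plus less_imp_le order.refl order.trans)
    have ds: "{..<d} \<lesssim> {..<ord_sum_upto n r}" using lepoll_if_less_next_initial[OF d(1)] by (simp add: s_def)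
    obtain C :: "('a ordinal + nat \<times> 'a ordinal) set" and F F0 t where C:
      "small TYPE('a) C"
      "\<And>i. i \<in> {1..n} \<Longrightarrow> bij_betw (F i) C {..<\<kappa> * q i + r i}"
      "bij_betw F0 C {..<t}" "\<kappa> * hprod_upto n q + d \<le> t"
      "\<And>x y. x \<in> C \<Longrightarrow> y \<in> C \<Longrightarrow> F0 x < F0 y \<Longrightarrow> \<exists>i\<in>{1..n}. F i x < F i y"
      using ex_long_intersection[where q = q and r = r, OF assms(1) init inf m q0 q_le assms(5) ds] by blast
    have F: "bij_betw (F i) C {..<\<alpha> i}" if "i \<in> {1..n}" for i using C(2)[OF that] assms(4)[OF that] by simp
    obtain X :: "'a set" and R where
      "\<forall>i\<in>{1..n}. wpo_on X (R i) \<and> linear_order_on X (R i) \<and> wpo_length X (R i) = \<alpha> i"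
      "t \<le> wpo_length X (\<Inter>i\<in>{1..n}. R i)"
      using ex_linear_orders[where \<alpha> = \<alpha>, OF C(1) n1 F C(3) C(5)] by blast
    then show ?thesis using d(2) C(4) by (meson order.trans)
  qed
  have lower': "\<exists>c\<in>K. v \<le> c"
    if "v < u" and K: "\<And>(X :: 'a set) R. \<forall>i\<in>{1..n}. wpo_on X (R i) \<and> linear_order_on X (R i) \<and> wpo_length X (R i) = \<alpha> i \<Longrightarrow>
      wpo_length X (\<Inter>i\<in>{1..n}. R i) \<in> K" for v K
    using lower[OF that(1)] by (elim exE conjE) (rule bexI[OF _ K])
  show ?thesis
    unfolding u_def[unfolded s_def, symmetric]
  proof (intro conjI least_strict_upper_boundI)
    fix v assume v: "v < u"
    show "\<exists>c\<in>{wpo_length X (\<Inter>i\<in>{1..n}. R i) | (X :: 'a set) R. \<forall>i\<in>{1..n}. wpo_on X (R i) \<and> wpo_length X (R i) = \<alpha> i}. v \<le> c"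
      by (rule lower'[OF v]) blast
    show "\<exists>c\<in>{wpo_length X (\<Inter>i\<in>{1..n}. R i) | (X :: 'a set) R.
      \<forall>i\<in>{1..n}. wpo_on X (R i) \<and> linear_order_on X (R i) \<and> wpo_length X (R i) = \<alpha> i}. v \<le> c"
      by (rule lower'[OF v]) blast
  qed (use upper in auto)
qed

end
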